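(* Let $M$ be a connected compact Riemannian manifold with Riemannian volume measure $m$, $m(M)=1$, let $1<\lambda<\Gamma$, and let $f_\infty=(f_n)_{n\ge0}$ be a sequence of maps $f_n\in\mathcal{E}(\lambda,\Gamma)$. Let $\varphi,\psi\in\mathcal{D}$ and put $\mu_n:=f_0^n(\varphi\,dm)$ and $\nu_n:=f_0^n(\psi\,dm)$ (push-forward measures), $n\ge0$. Then there is $c>0$ such that for every sequence $\mathcal{P}_\infty=(\mathcal{P}_n)_{n\ge0}$ of finite Borel partitions of $M$ with $\sup_n\#\mathcal{P}_n<\infty$ and $m(P)<c$ for all $P\in\mathcal{P}_n$ and all $n\ge0$, $$h(f_\infty;\mathcal{P}_\infty;\mu_\infty)=h(f_\infty;\mathcal{P}_\infty;\nu_\infty).$$ Consequently, $$h_{\mathcal{E}_{\mathrm M}}(f_\infty;\mu_\infty)=h_{\mathcal{E}_{\mathrm M}}(f_\infty;\nu_\infty).$$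
   Context: $\mathcal{E}(\lambda,\Gamma)$ is the set of $f\in C^2(M,M)$ such that $|Df(v)|\ge\lambda|v|$ for all $v\in TM$ and $\|f\|_{C^2}\le\Gamma$ (the $C^2$-norm bounds the norms of the first and second derivatives of $f$ with respect to the Riemannian metric; in particular $|Df(v)|\le\Gamma|v|$). $\mathcal{D}$ is the set of Lipschitz functions $\varphi:M\to\mathbb{R}$ with $\varphi>0$ and $\int\varphi\,dm=1$. Notation: $f_k^n:=f_{k+n-1}\circ\cdots\circ f_k$, $f_k^0=\mathrm{id}$, $f_k^{-n}:=(f_k^n)^{-1}$ on sets; $d$ is the Riemannian distance. $\mu_\infty=(\mu_n)_{n\ge0}$, $\nu_\infty=(\nu_n)_{n\ge 0}$. For a sequence $\mu_\infty=(\mu_n)$ of Borel probability measures on $M$ with $f_n\mu_n=\mu_{n+1}$ (push-forward) and a sequence $\mathcal{P}_\infty$ of finite Borel partitions of $M$, $h(f_\infty;\mathcal{P}_\infty;\mu_\infty):=\limsup_{n\to\infty}\frac1n H_{\mu_0}\big(\bigvee_{i=0}^{n-1}f_0^{-i}\mathcal{P}_i\big)$, where $H_{\mu_0}$ is the Shannon entropy of a partition. The class $\mathcal{E}_{\mathrm M}$ (associated with $\mu_\infty$) consists of all sequences $\mathcal{P}_\infty$, $\mathcal{P}_n=\{P_{n,1},\dots,P_{n,k_n}\}$, with $\sup_nk_n<\infty$ such that for every $\varepsilon>0$ there are $\delta>0$ and compact sets $K_{n,i}\subset P_{n,i}$ with $\mu_n(P_{n,i}\setminus K_{n,i})\le\varepsilon$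 and $\min_{1\le i<j\le k_n}\min_{(x,y)\in K_{n,i}\times K_{n,j}}d(x,y)\ge\delta$ for all $n\ge0$. $h_{\mathcal{E}_{\mathrm M}}(f_\infty;\mu_\infty):=\sup_{\mathcal{P}_\infty\in\mathcal{E}_{\mathrm M}}h(f_\infty;\mathcal{P}_\infty;\mu_\infty)$, and similarly for $\nu_\infty$ with the class associated with $\nu_\infty$. *)

theory Defs
  imports "HOL-Analysis.Analysis"
begin

subsection \<open>Smooth manifolds\<close>

text \<open>
  The manifold is the whole carrier type \<open>'a\<close>, modelled on \<open>real ^ 'n\<close>. A chart is a pair
  \<open>(U, \<phi>)\<close>; the values of \<open>\<phi>\<close> outside \<open>U\<close> are irrelevant.
\<close>

type_synonym ('a, 'n) chart = "'a set \<times> ('a \<Rightarrow> real ^ 'n)"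

abbreviation chart_dom :: "('a, 'n::finite) chart \<Rightarrow> 'a set" where
  "chart_dom \<equiv> fst"

abbreviation chart_map :: "('a, 'n::finite) chart \<Rightarrow> 'a \<Rightarrow> real ^ 'n" where
  "chart_map \<equiv> snd"

definition chart_inv :: "('a, 'n::finite) chart \<Rightarrow> real ^ 'n \<Rightarrow> 'a" where
  "chart_inv c = inv_into (chart_dom c) (chart_map c)"

text \<open>\<open>Ck_on k S f\<close>: \<open>f\<close> is \<open>k\<close> times continuously differentiable on the open set \<open>S\<close>.\<close>

primrec Ck_on :: "nat \<Rightarrow> 'a::real_normed_vector set \<Rightarrow> ('a \<Rightarrow> 'b::real_normed_vector) \<Rightarrow> bool" where
  "Ck_on 0 S f \<longleftrightarrow> continuous_on S f"
| "Ck_on (Suc k) S f \<longleftrightarrow> (\<forall>x\<in>S. f differentiable (at x)) \<and>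
     (\<forall>v. Ck_on k S (\<lambda>x. frechet_derivative f (at x) v))"

definition smooth_on :: "'a::real_normed_vector set \<Rightarrow> ('a \<Rightarrow> 'b::real_normed_vector) \<Rightarrow> bool" where
  "smooth_on S f \<longleftrightarrow> (\<forall>k. Ck_on k S f)"

text \<open>\<open>f\<close> in local coordinates, meaningful on \<open>local_dom c c' f\<close>.\<close>

definition local_dom ::
  "('a, 'n::finite) chart \<Rightarrow> ('a, 'n) chart \<Rightarrow> ('a \<Rightarrow> 'a) \<Rightarrow> (real ^ 'n) set" where
  "local_dom c c' f = chart_map c ` (chart_dom c \<inter> f -` chart_dom c')"

definition local_rep ::
  "('a, 'n::finite) chart \<Rightarrow> ('a, 'n) chart \<Rightarrow> ('a \<Rightarrow> 'a) \<Rightarrow> real ^ 'n \<Rightarrow> real ^ 'n" where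
  "local_rep c c' f = chart_map c' \<circ> f \<circ> chart_inv c"

definition smooth_atlas :: "('a::topological_space, 'n::finite) chart set \<Rightarrow> bool" where
  "smooth_atlas A \<longleftrightarrow>
     (\<forall>c\<in>A. open (chart_dom c) \<and> open (chart_map c ` chart_dom c) \<and>
        homeomorphism (chart_dom c) (chart_map c ` chart_dom c) (chart_map c) (chart_inv c)) \<and>
     (\<Union>c\<in>A. chart_dom c) = UNIV \<and>
     (\<forall>c\<in>A. \<forall>c'\<in>A. smooth_on (local_dom c c' id) (local_rep c c' id))"

definition C2_map :: "('a::topological_space, 'n::finite) chart set \<Rightarrow> ('a \<Rightarrow> 'a) \<Rightarrow> bool" where
  "C2_map A f \<longleftrightarrow> continuous_on UNIV f \<and>
     (\<forall>c\<in>A. \<forall>c'\<in>A. Ck_on 2 (local_dom c c' f) (local_rep c c' f))"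

subsection \<open>Riemannian metrics\<close>

text \<open>
  A metric is given by its coefficient matrices: \<open>G c x\<close> is the matrix \<open>(g\<^sub>i\<^sub>j)\<close> in the chart \<open>c\<close>
  at the point with coordinates \<open>x\<close>. Tangent vectors are represented by their components in a
  chart. The last clause is the transformation law under coordinate changes.
\<close>

type_synonym ('a, 'n) metric_coeffs = "('a, 'n) chart \<Rightarrow> real ^ 'n \<Rightarrow> real ^ 'n ^ 'n"

definition tangent_inner ::
  "('a, 'n::finite) metric_coeffs \<Rightarrow> ('a, 'n) chart \<Rightarrow> real ^ 'n \<Rightarrow> real ^ 'n \<Rightarrow> real ^ 'n \<Rightarrow> real" where
  "tangent_inner G c x u v = u \<bullet> (G c x *v v)"

definition tangent_norm ::
  "('a, 'n::finite) metric_coeffs \<Rightarrow> ('a, 'n) chart \<Rightarrow> real ^ 'n \<Rightarrow> real ^ 'n \<Rightarrow> real" where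
  "tangent_norm G c x v = sqrt (tangent_inner G c x v v)"

definition riemannian_metric ::
  "('a, 'n::finite) chart set \<Rightarrow> ('a, 'n) metric_coeffs \<Rightarrow> bool" where
  "riemannian_metric A G \<longleftrightarrow>
     (\<forall>c\<in>A. smooth_on (chart_map c ` chart_dom c) (G c) \<and>
        (\<forall>x \<in> chart_map c ` chart_dom c. transpose (G c x) = G c x \<and>
           (\<forall>v. v \<noteq> 0 \<longrightarrow> tangent_inner G c x v v > 0))) \<and>
     (\<forall>c\<in>A. \<forall>c'\<in>A. \<forall>x \<in> local_dom c c' id. \<forall>u v.
        tangent_inner G c x u v =
        tangent_inner G c' (local_rep c c' id x)
          (frechet_derivative (local_rep c c' id) (at x) u)
          (frechet_derivative (local_rep c c' id) (at x) v))"

definition riemannian_manifold ::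
  "('a::t2_space, 'n::finite) chart set \<Rightarrow> ('a, 'n) metric_coeffs \<Rightarrow> bool" where
  "riemannian_manifold A G \<longleftrightarrow> smooth_atlas A \<and> riemannian_metric A G"

text \<open>
  The Riemannian volume has density \<open>sqrt (det (g\<^sub>i\<^sub>j))\<close> with respect to Lebesgue measure in
  every chart. On a compact (more generally, second countable) manifold this determines it.
\<close>

definition riemannian_volume ::
  "('a::t2_space, 'n::finite) chart set \<Rightarrow> ('a, 'n) metric_coeffs \<Rightarrow> 'a measure \<Rightarrow> bool" where
  "riemannian_volume A G m \<longleftrightarrow> sets m = sets borel \<and>
     (\<forall>c\<in>A. \<forall>B \<in> sets borel. B \<subseteq> chart_dom c \<longrightarrow>
        emeasure m B = (\<integral>\<^sup>+x \<in> chart_map c ` B. ennreal (sqrt (det (G c x))) \<partial>lborel))"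

subsection \<open>Riemannian distance\<close>

definition C1_curve_on ::
  "('a::topological_space, 'n::finite) chart set \<Rightarrow> real \<Rightarrow> real \<Rightarrow> (real \<Rightarrow> 'a) \<Rightarrow> bool" where
  "C1_curve_on A a b \<gamma> \<longleftrightarrow> continuous_on {a..b} \<gamma> \<and>
     (\<forall>c\<in>A. \<exists>v. continuous_on {t\<in>{a..b}. \<gamma> t \<in> chart_dom c} v \<and>
        (\<forall>t\<in>{a..b}. \<gamma> t \<in> chart_dom c \<longrightarrow>
           ((chart_map c \<circ> \<gamma>) has_vector_derivative v t) (at t within {a..b})))"

definition piecewise_C1_curve ::
  "('a::topological_space, 'n::finite) chart set \<Rightarrow> (real \<Rightarrow> 'a) \<Rightarrow> bool" where
  "piecewise_C1_curve A \<gamma> \<longleftrightarrow>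
     (\<exists>N \<tau>. \<tau> 0 = 0 \<and> \<tau> N = 1 \<and>
        (\<forall>i<N::nat. \<tau> i < \<tau> (Suc i) \<and> C1_curve_on A (\<tau> i) (\<tau> (Suc i)) \<gamma>))"

text \<open>
  By the transformation law the speed does not depend on the chart chosen. It is only
  meaningful away from the finitely many break points, which do not affect the length.
\<close>

definition curve_speed ::
  "('a, 'n::finite) chart set \<Rightarrow> ('a, 'n) metric_coeffs \<Rightarrow> (real \<Rightarrow> 'a) \<Rightarrow> real \<Rightarrow> real" where
  "curve_speed A G \<gamma> t =
     (let c = (SOME c. c \<in> A \<and> \<gamma> t \<in> chart_dom c)
      in tangent_norm G c (chart_map c (\<gamma> t)) (vector_derivative (chart_map c \<circ> \<gamma>) (at t)))"

definition curve_length ::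
  "('a, 'n::finite) chart set \<Rightarrow> ('a, 'n) metric_coeffs \<Rightarrow> (real \<Rightarrow> 'a) \<Rightarrow> real" where
  "curve_length A G \<gamma> = integral {0..1} (curve_speed A G \<gamma>)"

definition riem_dist ::
  "('a::topological_space, 'n::finite) chart set \<Rightarrow> ('a, 'n) metric_coeffs \<Rightarrow> 'a \<Rightarrow> 'a \<Rightarrow> real" where
  "riem_dist A G p q =
     Inf {curve_length A G \<gamma> | \<gamma>. piecewise_C1_curve A \<gamma> \<and> \<gamma> 0 = p \<and> \<gamma> 1 = q}"

subsection \<open>The C2-norm and expanding maps\<close>

text \<open>Christoffel symbols \<open>\<Gamma>\<^sup>k\<^sub>i\<^sub>j\<close> of the Levi-Civita connection.\<close>

definition christoffel ::
  "('a, 'n::finite) metric_coeffs \<Rightarrow> ('a, 'n) chart \<Rightarrow> real ^ 'n \<Rightarrow> 'n \<Rightarrow> 'n \<Rightarrow> 'n \<Rightarrow> real" where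
  "christoffel G c x k i j =
     (let dG = (\<lambda>l. frechet_derivative (G c) (at x) (axis l 1))
      in 1/2 * (\<Sum>l\<in>UNIV. matrix_inv (G c x) $ k $ l *
                   (dG i $ j $ l + dG j $ i $ l - dG l $ i $ j)))"

definition connection_term ::
  "('a, 'n::finite) metric_coeffs \<Rightarrow> ('a, 'n) chart \<Rightarrow>
   real ^ 'n \<Rightarrow> real ^ 'n \<Rightarrow> real ^ 'n \<Rightarrow> real ^ 'n" where
  "connection_term G c x u v =
     (\<chi> k. \<Sum>i\<in>UNIV. \<Sum>j\<in>UNIV. christoffel G c x k i j * u $ i * v $ j)"

text \<open>
  The differential of \<open>f\<close> and its second (covariant) derivative \<open>(\<nabla>Df)(u, v)\<close>, in the charts
  \<open>c\<close> at the source and \<open>c'\<close> at the target: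
  the second partial derivatives of \<open>f\<close> corrected by the Christoffel symbols on both sides.
\<close>

definition tangent_map ::
  "('a, 'n::finite) chart \<Rightarrow> ('a, 'n) chart \<Rightarrow> ('a \<Rightarrow> 'a) \<Rightarrow> real ^ 'n \<Rightarrow> real ^ 'n \<Rightarrow> real ^ 'n" where
  "tangent_map c c' f x = frechet_derivative (local_rep c c' f) (at x)"

definition second_deriv ::
  "('a, 'n::finite) metric_coeffs \<Rightarrow> ('a, 'n) chart \<Rightarrow> ('a, 'n) chart \<Rightarrow> ('a \<Rightarrow> 'a) \<Rightarrow>
   real ^ 'n \<Rightarrow> real ^ 'n \<Rightarrow> real ^ 'n \<Rightarrow> real ^ 'n" where
  "second_deriv G c c' f x u v =
     frechet_derivative (\<lambda>y. tangent_map c c' f y v) (at x) u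
     - tangent_map c c' f x (connection_term G c x u v)
     + connection_term G c' (local_rep c c' f x) (tangent_map c c' f x u) (tangent_map c c' f x v)"

text \<open>The maximum of the suprema of the operator norms of the first and second derivatives.\<close>

definition C2_norm ::
  "('a, 'n::finite) chart set \<Rightarrow> ('a, 'n) metric_coeffs \<Rightarrow> ('a \<Rightarrow> 'a) \<Rightarrow> ereal" where
  "C2_norm A G f = max
     (Sup {ereal (tangent_norm G c' (local_rep c c' f x) (tangent_map c c' f x v)) | c c' x v.
        c \<in> A \<and> c' \<in> A \<and> x \<in> local_dom c c' f \<and> tangent_norm G c x v \<le> 1})
     (Sup {ereal (tangent_norm G c' (local_rep c c' f x) (second_deriv G c c' f x u v)) | c c' x u v.
        c \<in> A \<and> c' \<in> A \<and> x \<in> local_dom c c' f \<and>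
        tangent_norm G c x u \<le> 1 \<and> tangent_norm G c x v \<le> 1})"

definition expanding_maps ::
  "('a::t2_space, 'n::finite) chart set \<Rightarrow> ('a, 'n) metric_coeffs \<Rightarrow> real \<Rightarrow> real \<Rightarrow> ('a \<Rightarrow> 'a) set" where
  "expanding_maps A G l \<Gamma> = {f. C2_map A f \<and>
     (\<forall>c\<in>A. \<forall>c'\<in>A. \<forall>x \<in> local_dom c c' f. \<forall>v.
        tangent_norm G c' (local_rep c c' f x) (tangent_map c c' f x v) \<ge> l * tangent_norm G c x v) \<and>
     C2_norm A G f \<le> ereal \<Gamma>}"

definition lipschitz_densities ::
  "('a::t2_space, 'n::finite) chart set \<Rightarrow> ('a, 'n) metric_coeffs \<Rightarrow> 'a measure \<Rightarrow> ('a \<Rightarrow> real) set" where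
  "lipschitz_densities A G m = {\<phi>.
     (\<exists>L. \<forall>x y. \<bar>\<phi> x - \<phi> y\<bar> \<le> L * riem_dist A G x y) \<and>
     (\<forall>x. \<phi> x > 0) \<and> (\<integral>x. \<phi> x \<partial>m) = 1}"

subsection \<open>Entropy of nonautonomous systems\<close>

text \<open>\<open>seq_iter f k n = f (k + n - 1) \<circ> \<dots> \<circ> f k\<close>\<close>

primrec seq_iter :: "(nat \<Rightarrow> 'a \<Rightarrow> 'a) \<Rightarrow> nat \<Rightarrow> nat \<Rightarrow> 'a \<Rightarrow> 'a" where
  "seq_iter f k 0 = id"
| "seq_iter f k (Suc n) = f (k + n) \<circ> seq_iter f k n"

definition finite_borel_partition :: "'a::topological_space set set \<Rightarrow> bool" where
  "finite_borel_partition P \<longleftrightarrow> finite P \<and> P \<subseteq> sets borel \<and> partition_on UNIV P"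

definition shannon_entropy :: "'a measure \<Rightarrow> 'a set set \<Rightarrow> real" where
  "shannon_entropy \<mu> P = - (\<Sum>B\<in>P. measure \<mu> B * ln (measure \<mu> B))"

text \<open>The join of the pulled back partitions \<open>f\<^sub>0\<^sup>-\<^sup>i P\<^sub>i\<close>, \<open>i < n\<close>.\<close>

definition joined_partition :: "(nat \<Rightarrow> 'a \<Rightarrow> 'a) \<Rightarrow> (nat \<Rightarrow> 'a set set) \<Rightarrow> nat \<Rightarrow> 'a set set" where
  "joined_partition f P n =
     {\<Inter>i\<in>{..<n}. seq_iter f 0 i -` C i | C. \<forall>i<n. C i \<in> P i} - {{}}"

definition partition_entropy ::
  "(nat \<Rightarrow> 'a \<Rightarrow> 'a) \<Rightarrow> (nat \<Rightarrow> 'a set set) \<Rightarrow> (nat \<Rightarrow> 'a measure) \<Rightarrow> ereal" where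
  "partition_entropy f P \<mu> =
     limsup (\<lambda>n. ereal (shannon_entropy (\<mu> 0) (joined_partition f P n) / real n))"

definition misiurewicz_class ::
  "('a::t2_space, 'n::finite) chart set \<Rightarrow> ('a, 'n) metric_coeffs \<Rightarrow>
   (nat \<Rightarrow> 'a measure) \<Rightarrow> (nat \<Rightarrow> 'a set set) set" where
  "misiurewicz_class A G \<mu> = {P.
     (\<forall>n. finite_borel_partition (P n)) \<and> bdd_above (range (\<lambda>n. card (P n))) \<and>
     (\<forall>\<epsilon>>0. \<exists>\<delta>>0. \<exists>K. \<forall>n.
        (\<forall>B \<in> P n. compact (K n B) \<and> K n B \<subseteq> B \<and> measure (\<mu> n) (B - K n B) \<le> \<epsilon>) \<and>
        (\<forall>B \<in> P n. \<forall>B' \<in> P n. B \<noteq> B' \<longrightarrow>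
           (\<forall>x \<in> K n B. \<forall>y \<in> K n B'. riem_dist A G x y \<ge> \<delta>)))}"

definition misiurewicz_entropy ::
  "('a::t2_space, 'n::finite) chart set \<Rightarrow> ('a, 'n) metric_coeffs \<Rightarrow>
   (nat \<Rightarrow> 'a \<Rightarrow> 'a) \<Rightarrow> (nat \<Rightarrow> 'a measure) \<Rightarrow> ereal" where
  "misiurewicz_entropy A G f \<mu> = (SUP P \<in> misiurewicz_class A G \<mu>. partition_entropy f P \<mu>)"

end

theory Submission imports Defs "HOL-Probability.Probability_Measure" begin

text \<open>
  The limit that defines the entropy of a sequence of partitions ignores any finite number of
  initial times, and the dynamics forgets the initial density; so the two initial densities yield
  the same entropy.

  \<^emph>\<open>Loss of memory.\<close> Let \<open>d\<close> be the dimension, and consider positive densities whose logarithm has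
  pointwise Lipschitz constant at most \<open>K\<close> in the Riemannian metric (\<open>log_lipschitz\<close>). If \<open>f\<close> expands
  by the factor \<open>l\<close> and has \<open>C2\<close>-norm at most \<open>\<Gamma>\<close>, then it pushes such a density forward to one with
  constant \<open>(K + d * \<Gamma> / l) / l\<close> (\<open>transfer\<close>): the inverse branches contract by the factor \<open>l\<close>, and the
  logarithm of the Jacobian has a gradient of norm at most \<open>d * \<Gamma> / l\<close>, because its derivative is the
  trace of the inverse differential composed with the covariant second derivative
  (\<open>log_jacobian_has_derivative\<close>). As \<open>l > 1\<close>, a large \<open>K\<close> is preserved with room to spare. On a
  compact connected manifold the densities in the class satisfy a uniform Harnack inequality
  (\<open>harnack\<close>), so in every step a fixed proportion of both densities can be split off as one and
  the same constant, while the remainders stay in the class. Hence the push-forwards under \<open>k\<close> maps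
  of the two initial measures differ by at most \<open>\<theta> ^ k\<close> on every Borel set, for some \<open>\<theta> < 1\<close>
  (\<open>memory_loss\<close>). The Lipschitz densities of the theorem belong to the class for a suitable \<open>K\<close>
  (\<open>lipschitz_density_in_log_lipschitz\<close>).

  \<^emph>\<open>Entropy.\<close> If the partitions have at most \<open>N\<close> atoms, leaving out the first \<open>k\<close> of them changes the
  entropy of the join of the first \<open>n\<close> pull-backs by at most \<open>k * ln N\<close>. The atoms that remain are
  preimages under the first \<open>k\<close> maps, and there are at most \<open>N ^ n\<close> of them; if the two measures
  differ by at most \<open>\<epsilon>\<close> on such preimages, the entropies of what remains differ by at most
  \<open>1 + 2 * \<epsilon> + 2 * \<epsilon> * n * ln N\<close>. Dividing by \<open>n\<close> and letting first \<open>n\<close> tend to infinity and then \<open>\<epsilon>\<close> to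
  zero shows that the entropies agree (\<open>partition_entropy_eq_if_asymptotically_equal\<close>).

  \<^emph>\<open>Misiurewicz classes.\<close> Each of the two densities is bounded by a multiple of the other, and so are
  their push-forwards. Both sequences of measures therefore admit the same sequences of partitions,
  and the suprema over the two classes agree as well.
\<close>

section \<open>Change of variables over finite index types\<close>

text \<open>
  The change of variables formula \<open>has_measure_differentiable_image\<close> concerns well-ordered index
  types. This copy of a finite index type inherits the order of the natural numbers; relabelling
  the coordinates carries the formula back to the original type.
\<close>

typedef ('n::finite) ordered_index = "{..<CARD('n)}"
  by (rule exI[of _ 0]) simp

instance ordered_index :: (finite) finite
proof
  have "range (Rep_ordered_index :: 'a ordered_index \<Rightarrow> nat) \<subseteq> {..<CARD('a)}"
    using Rep_ordered_index by blast
  then show "finite (UNIV :: 'a ordered_index set)"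
    by (meson Rep_ordered_index_inject finite_imageD finite_lessThan finite_subset injI)
qed

instantiation ordered_index :: (finite) wellorder
begin
definition less_eq_ordered_index :: "'a ordered_index \<Rightarrow> 'a ordered_index \<Rightarrow> bool" where
  "less_eq_ordered_index x y \<longleftrightarrow> Rep_ordered_index x \<le> Rep_ordered_index y"
definition less_ordered_index :: "'a ordered_index \<Rightarrow> 'a ordered_index \<Rightarrow> bool" where
  "less_ordered_index x y \<longleftrightarrow> Rep_ordered_index x < Rep_ordered_index y"
instance
proof
  fix P :: "'a ordered_index \<Rightarrow> bool" and a
  assume step: "\<And>x. (\<And>y. y < x \<Longrightarrow> P y) \<Longrightarrow> P x"
  show "P a"
    by (induction "Rep_ordered_index a" arbitrary: a rule: less_induct)
       (metis step less_ordered_index_def)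
qed (auto simp: less_eq_ordered_index_def less_ordered_index_def Rep_ordered_index_inject)
end

lemma CARD_ordered_index: "CARD('n::finite ordered_index) = CARD('n)"
  using type_definition.card[OF type_definition_ordered_index[where 'n='n]] by simp

definition reindex :: "('k \<Rightarrow> 'n) \<Rightarrow> real ^ 'n \<Rightarrow> real ^ 'k" where
  "reindex b v = (\<chi> k. v $ b k)"

lemma linear_reindex: "linear (reindex (b :: 'k::finite \<Rightarrow> 'n::finite))"
  by (auto simp: reindex_def linear_iff vec_eq_iff)

lemma continuous_on_reindex [continuous_intros]: "continuous_on S (reindex (b :: 'k::finite \<Rightarrow> 'n::finite))"
  by (simp add: linear_continuous_on linear_conv_bounded_linear[symmetric] linear_reindex)

lemma reindex_reindex_inv:
  assumes "bij b"
  shows "reindex b (reindex (inv b) v) = v" "reindex (inv b) (reindex b w) = w"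
  using assms by (auto simp: reindex_def vec_eq_iff bij_is_inj inv_f_f bij_is_surj surj_f_inv_f)

text \<open>
  Conjugation by the relabelling is a sign-preserving bijection between the permutations of the two
  index types, so the two Leibniz sums agree term by term.
\<close>

lemma det_reindex:
  fixes A :: "real ^ 'n::finite ^ 'n" and b :: "'k::finite \<Rightarrow> 'n"
  assumes b: "bij b"
  shows "det (\<chi> i j. A $ b i $ b j) = det A"
proof -
  have inj: "inj b" using b by (rule bij_is_inj)
  have bb: "bij_betw b UNIV UNIV" using b by simp
  have "bij_betw (map_permutation UNIV b) {p. p permutes UNIV} {p. p permutes UNIV}"
  proof (rule bij_betwI[where g = "map_permutation UNIV (inv b)"])
    show "map_permutation UNIV b \<in> {p. p permutes UNIV} \<rightarrow> {p. p permutes UNIV}"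
      using map_permutation_permutes[OF bb] by auto
    show "map_permutation UNIV (inv b) \<in> {p. p permutes UNIV} \<rightarrow> {p. p permutes UNIV}"
      using map_permutation_permutes[OF bij_imp_bij_inv[OF b]] by auto
  qed (auto simp: map_permutation_def restrict_id_def fun_eq_iff b inv_inv_eq bij_is_surj[OF b]
        inv_f_f[OF inj] surj_f_inv_f[OF bij_is_surj[OF b]]  bij_is_surj[OF bij_imp_bij_inv[OF b]])
  then have "det A = (\<Sum>p | p permutes (UNIV :: 'k set).
      of_int (sign (map_permutation UNIV b p)) * (\<Prod>i\<in>UNIV. A $ i $ map_permutation UNIV b p i))"
    unfolding det_def by (rule sum.reindex_bij_betw[symmetric])
  also have "\<dots> = (\<Sum>p | p permutes (UNIV :: 'k set). of_int (sign p) * (\<Prod>i\<in>UNIV. A $ b i $ b (p i)))"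
  proof (rule sum.cong[OF refl])
    fix p :: "'k \<Rightarrow> 'k" assume "p \<in> {p. p permutes UNIV}"
    then have "sign (map_permutation UNIV b p) = sign p"
      using sign_map_permutation[OF inj] by simp
    moreover have "(\<Prod>i\<in>UNIV. A $ i $ map_permutation UNIV b p i) = (\<Prod>i\<in>UNIV. A $ b i $ map_permutation UNIV b p (b i))"
      by (rule prod.reindex_bij_betw[OF bb, symmetric])
    moreover have "map_permutation UNIV b p (b i) = b (p i)" for i
      by (simp add: map_permutation_def restrict_id_def inv_f_f[OF inj])
    ultimately show "of_int (sign (map_permutation UNIV b p)) * (\<Prod>i\<in>UNIV. A $ i $ map_permutation UNIV b p i)
        = of_int (sign p) * (\<Prod>i\<in>UNIV. A $ b i $ b (p i))" by simp
  qed
  finally show ?thesis by (simp add: det_def)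
qed

lemma distr_lborel_reindex:
  fixes b :: "'k::finite \<Rightarrow> 'n::finite"
  assumes b: "bij b"
  shows "distr lborel borel (reindex b) = lborel"
proof (rule lborel_eqI[symmetric])
  have m: "reindex b \<in> borel \<rightarrow>\<^sub>M borel"
    by (rule borel_measurable_continuous_onI) (rule continuous_on_reindex)
  fix l u :: "real ^ 'k" assume "\<And>i. i \<in> Basis \<Longrightarrow> l \<bullet> i \<le> u \<bullet> i"
  then have le: "l $ i \<le> u $ i" for i
    by (metis axis_in_Basis_iff Basis_real_def inner_axis inner_real_def mult.right_neutral insertI1)
  have "reindex b -` box l u = box (reindex (inv b) l) (reindex (inv b) u)"
    unfolding reindex_def by (auto simp: mem_box_cart) (metis b bij_inv_eq_iff)+
  moreover have "emeasure lborel (box (reindex (inv b) l) (reindex (inv b) u))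
      = ennreal (\<Prod>i\<in>UNIV. (reindex (inv b) u - reindex (inv b) l) $ i)"
    by (subst emeasure_lborel_box_eq) (use le in \<open>auto simp: Basis_vec_def inner_axis reindex_def 
        inj_on_def axis_eq_axis prod.reindex UNION_singleton_eq_range\<close>)
  moreover have "(\<Prod>i\<in>UNIV. (reindex (inv b) u - reindex (inv b) l) $ i) = (\<Prod>i\<in>UNIV. (u - l) $ i)"
    using prod.reindex_bij_betw[OF bij_imp_bij_inv[OF b], of "\<lambda>i. (u - l) $ i"]
    by (simp add: reindex_def)
  moreover have "(\<Prod>b\<in>Basis. (u - l) \<bullet> b) = (\<Prod>i\<in>UNIV. (u - l) $ i)"
    by (auto simp: Basis_vec_def inner_axis inj_on_def axis_eq_axis prod.reindex UNION_singleton_eq_range)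
  ultimately show "emeasure (distr lborel borel (reindex b)) (box l u) = (\<Prod>b\<in>Basis. (u - l) \<bullet> b)"
    using m by (subst emeasure_distr) auto
qed simp

text \<open>
  Conjugating \<open>F\<close> with the relabelling changes neither volumes nor Jacobian determinants. The bound
  on the image makes both sides finite, so that the integral exists in the Henstock-Kurzweil sense.
\<close>

lemma emeasure_diffeomorphic_image:
  fixes F :: "real ^ 'n::finite \<Rightarrow> real ^ 'n"
  assumes C: "C \<in> sets borel" and FC: "F ` C \<in> sets borel" "bounded (F ` C)"
    and der: "\<And>x. x \<in> C \<Longrightarrow> (F has_derivative F' x) (at x)"
    and inj: "inj_on F C"
    and meas: "(\<lambda>x. ennreal \<bar>det (matrix (F' x))\<bar> * indicator C x) \<in> borel_measurable borel"
  shows "emeasure lborel (F ` C) = (\<integral>\<^sup>+x. ennreal \<bar>det (matrix (F' x))\<bar> * indicator C x \<partial>lborel)"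
proof -
  obtain b :: "'n ordered_index \<Rightarrow> 'n" where b: "bij b"
    using finite_same_card_bij[of "UNIV :: 'n ordered_index set" "UNIV :: 'n set"]
    by (auto simp: CARD_ordered_index)
  have ib: "bij (inv b)" using b by (rule bij_imp_bij_inv)
  define R where "R = reindex b"
  define S where "S = reindex (inv b)"
  have RS [simp]: "R (S v) = v" "S (R w) = w" for v w
    using reindex_reindex_inv[OF b] by (auto simp: R_def S_def)
  have bl: "bounded_linear R" "bounded_linear S"
    by (auto simp: R_def S_def linear_conv_bounded_linear[symmetric] linear_reindex)
  have mS: "S \<in> borel \<rightarrow>\<^sub>M borel" and mR: "R \<in> borel \<rightarrow>\<^sub>M borel"
    by (auto simp: R_def S_def intro!: borel_measurable_continuous_onI continuous_on_reindex)
  have vimage_eq: "S -` X = R ` X" for X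
    by (auto simp: image_iff) (metis RS)
  define F2 where "F2 = R \<circ> F \<circ> S"
  define F2' where "F2' = (\<lambda>x. R \<circ> F' (S x) \<circ> S)"
  have C2: "S -` C \<in> sets borel" and FC2: "S -` (F ` C) \<in> sets borel"
    using measurable_sets_borel[OF mS] C FC by auto
  have img: "F2 ` (S -` C) = S -` (F ` C)"
    by (auto simp: F2_def vimage_eq image_comp)
  have bnd: "bounded (F2 ` (S -` C))"
    unfolding img unfolding vimage_eq by (rule bounded_linear_image[OF FC(2) bl(1)])
  have der2: "(F2 has_derivative F2' x) (at x within S -` C)" if "x \<in> S -` C" for x
    unfolding F2_def F2'_def comp_def
  proof -
    have "((\<lambda>y. F (S y)) has_derivative (\<lambda>y. F' (S x) (S y))) (at x)"
      using has_derivative_compose[OF bounded_linear_imp_has_derivative[OF bl(2)] der] that by blast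
    then have "((\<lambda>y. R (F (S y))) has_derivative (\<lambda>y. R (F' (S x) (S y)))) (at x)"
      by (rule bounded_linear.has_derivative[OF bl(1)])
    then show "((\<lambda>y. R (F (S y))) has_derivative (\<lambda>y. R (F' (S x) (S y)))) (at x within S -` C)"
      by (rule has_derivative_at_withinI)
  qed
  have inj2: "inj_on F2 (S -` C)"
    using inj unfolding F2_def inj_on_def by (metis RS comp_apply vimageE)
  have lm: "F2 ` (S -` C) \<in> lmeasurable"
    using bnd FC2 by (intro bounded_set_imp_lmeasurable) (auto simp: img)
  have det_eq: "det (matrix (F2' x)) = det (matrix (F' (S x)))" for x
  proof -
    have "S (axis j 1) = axis (b j) 1" for j
    proof -
      have "(inv b k = j) = (k = b j)" for k
        by (metis b bij_inv_eq_iff)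
      then show ?thesis
        by (simp add: S_def reindex_def axis_def vec_eq_iff)
    qed
    then have "matrix (F2' x) = (\<chi> i j. matrix (F' (S x)) $ b i $ b j)"
      by (simp add: matrix_def F2'_def R_def reindex_def)
    then show ?thesis by (simp add: det_reindex[OF b])
  qed
  have "((\<lambda>x. \<bar>det (matrix (F2' x))\<bar>) has_integral measure lebesgue (F2 ` (S -` C))) (S -` C)"
    using has_measure_differentiable_image[of "S -` C" F2 F2'] C2 der2 inj2 lm by auto
  then have "(\<integral>\<^sup>+x. ennreal \<bar>det (matrix (F2' x))\<bar> * indicator (S -` C) x \<partial>lborel)
      = ennreal (measure lebesgue (F2 ` (S -` C)))"
    by (intro nn_integral_has_integral_lebesgue') auto
  also have "\<dots> = emeasure lebesgue (F2 ` (S -` C))"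
    using lm by (simp add: emeasure_eq_measure2)
  also have "\<dots> = emeasure lborel (S -` (F ` C))"
    using FC2 by (simp add: img)
  also have "\<dots> = emeasure (distr lborel borel S) (F ` C)"
    using FC mS by (simp add: emeasure_distr)
  also have "distr lborel borel S = lborel"
    unfolding S_def by (rule distr_lborel_reindex[OF ib])
  finally have "emeasure lborel (F ` C) =
    (\<integral>\<^sup>+x. ennreal \<bar>det (matrix (F' (S x)))\<bar> * indicator C (S x) \<partial>lborel)"
    by (simp add: det_eq indicator_def)
  also have "\<dots> = (\<integral>\<^sup>+x. ennreal \<bar>det (matrix (F' x))\<bar> * indicator C x \<partial>distr lborel borel S)"
    using mS meas by (subst nn_integral_distr) auto
  also have "distr lborel borel S = lborel"
    unfolding S_def by (rule distr_lborel_reindex[OF ib])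
  finally show ?thesis .
qed

section \<open>Determinants, traces and norms\<close>

text \<open>
  A permutation other than the identity moves at least two indices. Its Leibniz summand therefore
  still contains a vanishing off-diagonal entry after one factor has been differentiated, and only
  the diagonal survives.
\<close>

lemma det_has_derivative_at_mat_1:
  fixes M :: "'b::real_normed_vector \<Rightarrow> real ^ 'n::finite ^ 'n"
  assumes M: "(M has_derivative M') (at z)" and z: "M z = mat 1"
  shows "((\<lambda>x. det (M x)) has_derivative (\<lambda>u. trace (M' u))) (at z)"
proof -
  have entry: "((\<lambda>x. M x $ i $ j) has_derivative (\<lambda>u. M' u $ i $ j)) (at z)" for i j
    by (intro bounded_linear.has_derivative[OF bounded_linear_vec_nth] M)
  have "((\<lambda>x. det (M x)) has_derivative (\<lambda>u. \<Sum>p | p permutes (UNIV :: 'n set).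
      of_int (sign p) * (\<Sum>i\<in>UNIV. M' u $ i $ p i * (\<Prod>j\<in>UNIV - {i}. M z $ j $ p j)))) (at z)"
    unfolding det_def
    by (intro has_derivative_sum has_derivative_mult_right has_derivative_prod entry)
  moreover have "(\<Sum>p | p permutes (UNIV :: 'n set).
      of_int (sign p) * (\<Sum>i\<in>UNIV. M' u $ i $ p i * (\<Prod>j\<in>UNIV - {i}. M z $ j $ p j)))
      = trace (M' u)" for u
  proof -
    have *: "(\<Prod>j\<in>UNIV - {i}. M z $ j $ p j) = 0" if p: "p permutes (UNIV :: 'n set)" and "p \<noteq> id" for p i
    proof -
      have "\<exists>j. j \<noteq> i \<and> p j \<noteq> j"
      proof (rule ccontr)
        assume "\<not> ?thesis"
        then have a: "p j = j" if "j \<noteq> i" for j using that by blast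
        moreover have "p i = i"
          using a[of "p i"] permutes_inj[OF p] by (auto dest: injD)
        ultimately have "p j = j" for j by (cases "j = i") auto
        then show False using \<open>p \<noteq> id\<close> by (simp add: fun_eq_iff)
      qed
      then obtain j where j: "j \<noteq> i" "p j \<noteq> j" by blast
      then show ?thesis
        using j by (intro prod_zero) (auto simp: z mat_def intro!: bexI[of _ j])
    qed
    have "(\<Sum>p | p permutes (UNIV :: 'n set).
      of_int (sign p) * (\<Sum>i\<in>UNIV. M' u $ i $ p i * (\<Prod>j\<in>UNIV - {i}. M z $ j $ p j)))
      = (\<Sum>p\<in>{id}. of_int (sign p) * (\<Sum>i\<in>UNIV. M' u $ i $ p i * (\<Prod>j\<in>UNIV - {i}. M z $ j $ p j)))"
      by (rule sum.mono_neutral_right) (auto simp: permutes_id * finite_permutations)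
    also have "\<dots> = trace (M' u)"
      by (simp add: trace_def z mat_def)
    finally show ?thesis .
  qed
  ultimately show ?thesis by simp
qed

text \<open>
  Jacobi's formula: multiplication by \<open>N\<close>, the inverse of \<open>M z\<close>, moves the base point to the
  identity matrix and adds only a constant to the logarithm.
\<close>

lemma ln_abs_det_has_derivative:
  fixes M :: "'b::real_normed_vector \<Rightarrow> real ^ 'n::finite ^ 'n"
  assumes M: "(M has_derivative M') (at z)" and N: "N ** M z = mat 1"
  shows "((\<lambda>x. ln \<bar>det (M x)\<bar>) has_derivative (\<lambda>u. trace (N ** M' u))) (at z)"
proof -
  have dN: "det N * det (M z) = 1"
    using N by (metis det_I det_mul)
  have bl: "bounded_linear (\<lambda>A. N ** A)"
    unfolding linear_conv_bounded_linear[symmetric] linear_iff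
    by (auto simp: matrix_add_ldistrib scalar_matrix_assoc matrix_scalar_ac scalar_mult_eq_scaleR[symmetric])
  have "((\<lambda>x. det (N ** M x)) has_derivative (\<lambda>u. trace (N ** M' u))) (at z)"
    by (intro det_has_derivative_at_mat_1 bounded_linear.has_derivative[OF bl] M N)
  moreover have "((\<lambda>t. ln \<bar>t\<bar>) has_derivative (\<lambda>t. t)) (at (det (N ** M z)))"
  proof -
    have "(ln has_derivative (\<lambda>t. t)) (at (1::real))"
      by (auto intro!: derivative_eq_intros)
    then have "((\<lambda>t. ln \<bar>t\<bar>) has_derivative (\<lambda>t. t)) (at (1::real))"
      by (rule has_derivative_transform_within_open[of _ _ _ _ "{0<..}"]) auto
    then show ?thesis by (simp add: N)
  qed
  ultimately have "((\<lambda>x. ln \<bar>det (N ** M x)\<bar>) has_derivative (\<lambda>u. trace (N ** M' u))) (at z)"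
    using has_derivative_compose by blast
  then have *: "((\<lambda>x. ln \<bar>det (N ** M x)\<bar> - ln \<bar>det N\<bar>) has_derivative (\<lambda>u. trace (N ** M' u))) (at z)"
    using has_derivative_diff[OF _ has_derivative_const] by fastforce
  have cont: "isCont (\<lambda>x. det (N ** M x)) z"
    using \<open>((\<lambda>x. det (N ** M x)) has_derivative _) (at z)\<close> has_derivative_continuous by blast
  have "eventually (\<lambda>x. det (N ** M x) > 0) (at z)"
    by (rule order_tendstoD[OF cont[unfolded isCont_def]]) (simp add: N)
  then have "eventually (\<lambda>x. det (N ** M x) > 0) (nhds z)"
    unfolding eventually_at_filter by (rule eventually_mono) (use N in force)
  then obtain W where W: "open W" "z \<in> W" "\<And>x. x \<in> W \<Longrightarrow> det (N ** M x) > 0"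
    by (auto simp: eventually_nhds)
  show ?thesis
  proof (rule has_derivative_transform_within_open[OF * W(1,2)])
    fix x assume "x \<in> W"
    then have "det (N ** M x) \<noteq> 0" using W(3) by force
    then have "det N \<noteq> 0" "det (M x) \<noteq> 0" by (auto simp: det_mul)
    then show "ln \<bar>det (N ** M x)\<bar> - ln \<bar>det N\<bar> = ln \<bar>det (M x)\<bar>"
      by (simp add: det_mul abs_mult ln_mult)
  qed
qed

text \<open>
  The segment from the identity matrix to \<open>A\<close> consists of positive definite matrices, on which the
  determinant has no zero.
\<close>

lemma det_pos_if_positive_definite:
  fixes A :: "real ^ 'n::finite ^ 'n"
  assumes pos: "\<And>v. v \<noteq> 0 \<Longrightarrow> v \<bullet> (A *v v) > 0"
  shows "det A > 0"
proof (rule ccontr)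
  assume "\<not> det A > 0"
  define B where "B t = (1 - t) *\<^sub>R mat 1 + t *\<^sub>R A" for t :: real
  have "continuous_on {0..1} (\<lambda>t. det (B t))"
    unfolding det_def B_def by (intro continuous_intros)
  moreover have "det (B 1) \<le> 0" "0 \<le> det (B 0)"
    using \<open>\<not> det A > 0\<close> by (auto simp: B_def)
  ultimately obtain t where t: "0 \<le> t" "t \<le> 1" "det (B t) = 0"
    using IVT2'[of "\<lambda>t. det (B t)" 1 0 0] by auto
  then have "\<not> invertible (B t)" by (simp add: invertible_det_nz)
  then obtain v where v: "v \<noteq> 0" "B t *v v = 0"
    using invertible_left_inverse matrix_left_invertible_ker by blast
  have "v \<bullet> (B t *v v) = (1 - t) * (v \<bullet> v) + t * (v \<bullet> (A *v v))"
    by (simp add: B_def matrix_vector_mult_add_rdistrib inner_add_right scaleR_matrix_vector_assoc[symmetric])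
  moreover have "v \<bullet> v > 0" using v by simp
  moreover have "v \<bullet> (A *v v) > 0" using v pos by simp
  ultimately have "v \<bullet> (B t *v v) > 0"
    using t by (cases "t = 1") (auto intro!: add_pos_nonneg)
  with v show False by simp
qed

lemma le_if_power_le_mult_power:
  fixes x y K :: real
  assumes "0 \<le> x" "0 \<le> y" and le: "\<And>k. x ^ k \<le> K * y ^ k"
  shows "x \<le> y"
proof (rule ccontr)
  assume "\<not> x \<le> y"
  then have "y < x" by simp
  show False
  proof (cases "y = 0")
    case True
    then show False using le[of 1] \<open>y < x\<close> by simp
  next
    case False
    then have y: "y > 0" using assms by simp
    obtain k where "K < (x / y) ^ k"
      using real_arch_pow[of "x / y" K] \<open>y < x\<close> y by auto
    then show False
      using le[of k] y by (simp add: power_divide field_simps)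
  qed
qed

lemma abs_det_le_entries:
  fixes A :: "real ^ 'n::finite ^ 'n"
  assumes "\<And>i j. \<bar>A $ i $ j\<bar> \<le> c"
  shows "\<bar>det A\<bar> \<le> fact CARD('n) * c ^ CARD('n)"
proof -
  have "\<bar>det A\<bar> \<le> (\<Sum>p | p permutes (UNIV :: 'n set). \<bar>of_int (sign p) * (\<Prod>i\<in>UNIV. A $ i $ p i)\<bar>)"
    unfolding det_def by (rule sum_abs)
  also have "\<dots> \<le> (\<Sum>p | p permutes (UNIV :: 'n set). c ^ CARD('n))"
  proof (rule sum_mono)
    fix p :: "'n \<Rightarrow> 'n"
    have "\<bar>\<Prod>i\<in>UNIV. A $ i $ p i\<bar> \<le> (\<Prod>i\<in>(UNIV :: 'n set). c)"
      unfolding abs_prod by (rule prod_mono) (use assms in auto)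
    moreover have "\<bar>real_of_int (sign p)\<bar> = 1"
      by (simp add: sign_def)
    ultimately show "\<bar>of_int (sign p) * (\<Prod>i\<in>UNIV. A $ i $ p i)\<bar> \<le> c ^ CARD('n)"
      by (simp add: abs_mult)
  qed
  also have "\<dots> = fact CARD('n) * c ^ CARD('n)"
    using card_permutations[of "UNIV :: 'n set" "CARD('n)"] by simp
  finally show ?thesis .
qed

text \<open>
  As \<open>q\<close> is comparable to the Euclidean norm, the entries of the \<open>k\<close>-th power of \<open>A\<close> are
  at most a constant times \<open>\<rho> ^ k\<close>. Hence \<open>\<bar>det A\<bar> ^ k\<close> is at most a constant times
  \<open>\<rho> ^ (k * CARD('n))\<close>, and the constant disappears as \<open>k\<close> grows.
\<close>

lemma abs_det_le_power_norm:
  fixes A :: "real ^ 'n::finite ^ 'n" and q :: "real ^ 'n \<Rightarrow> real"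
  assumes a: "a > 0" "\<And>v. a * norm v \<le> q v" and b: "\<And>v. q v \<le> b * norm v"
    and \<rho>: "0 \<le> \<rho>" "\<And>v. q (A *v v) \<le> \<rho> * q v"
  shows "\<bar>det A\<bar> \<le> \<rho> ^ CARD('n)"
proof (rule le_if_power_le_mult_power)
  fix k :: nat
  define B where "B = (\<lambda>k. ((**) A ^^ k) (mat 1))"
  have qB: "q (B k *v v) \<le> \<rho> ^ k * q v" for k v
  proof (induction k)
    case (Suc k)
    have "q (B (Suc k) *v v) = q (A *v (B k *v v))"
      by (simp add: B_def matrix_vector_mul_assoc)
    also have "\<dots> \<le> \<rho> * q (B k *v v)" by (rule \<rho>)
    also have "\<dots> \<le> \<rho> * (\<rho> ^ k * q v)" by (rule mult_left_mono[OF Suc \<rho>(1)])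
    finally show ?case by simp
  qed (simp add: B_def)
  have detB: "det (B k) = det A ^ k" for k
    by (induction k) (auto simp: B_def det_mul)
  have "\<bar>B k $ i $ j\<bar> \<le> \<rho> ^ k * (b / a)" for i j
  proof -
    have "\<bar>B k $ i $ j\<bar> = \<bar>(B k *v axis j 1) $ i\<bar>"
      by (simp add: matrix_vector_mul_component inner_axis)
    also have "\<dots> \<le> norm (B k *v axis j 1)" by (rule component_le_norm_cart)
    also have "\<dots> \<le> q (B k *v axis j 1) / a"
      using a(2)[of "B k *v axis j 1"] a(1) by (simp add: field_simps)
    also have "\<dots> \<le> \<rho> ^ k * q (axis j 1) / a"
      using qB a(1) by (simp add: divide_right_mono)
    also have "\<dots> \<le> \<rho> ^ k * b / a"
      using b[of "axis j 1"] a(1) \<rho>(1) by (intro divide_right_mono mult_left_mono) auto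
    finally show ?thesis by simp
  qed
  then have "\<bar>det (B k)\<bar> \<le> fact CARD('n) * (\<rho> ^ k * (b / a)) ^ CARD('n)"
    by (rule abs_det_le_entries)
  then show "\<bar>det A\<bar> ^ k \<le> fact CARD('n) * (b / a) ^ CARD('n) * (\<rho> ^ CARD('n)) ^ k"
    by (simp add: detB power_abs power_mult_distrib power_divide mult_ac flip: power_mult)
qed (use \<rho> in auto)

text \<open>
  The trace is the derivative at \<open>t = 0\<close> of \<open>det (mat 1 + t *\<^sub>R T)\<close>, and for \<open>t \<ge> 0\<close> this determinant
  is at most \<open>(1 + t * \<tau>) ^ CARD('n)\<close> because \<open>mat 1 + t *\<^sub>R T\<close> has operator norm at most \<open>1 + t * \<tau>\<close> with respect to \<open>q\<close>.
\<close>

lemma trace_le_norm: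
  fixes T :: "real ^ 'n::finite ^ 'n" and q :: "real ^ 'n \<Rightarrow> real" and \<tau> :: real
  assumes a: "a > 0" "\<And>v. a * norm v \<le> q v" and b: "\<And>v. q v \<le> b * norm v"
    and tri: "\<And>v w. q (v + w) \<le> q v + q w" and hom: "\<And>r v. q (r *\<^sub>R v) = \<bar>r\<bar> * q v"
    and \<tau>: "0 \<le> \<tau>" "\<And>v. q (T *v v) \<le> \<tau> * q v"
  shows "\<bar>trace T\<bar> \<le> CARD('n) * \<tau>"
proof -
  have *: "trace T \<le> CARD('n) * \<tau>" if T: "\<And>v. q (T *v v) \<le> \<tau> * q v" for T :: "real ^ 'n ^ 'n"
  proof (rule ccontr)
    assume neg: "\<not> trace T \<le> CARD('n) * \<tau>"
    \<comment> \<open>\<open>h\<close> is nonnegative for \<open>t \<ge> 0\<close> and vanishes at \<open>0\<close>, so its derivative there cannot be negative\<close>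
    define h where "h t = (1 + t * \<tau>) ^ CARD('n) - det (mat 1 + t *\<^sub>R T)" for t :: real
    have h0: "h t \<ge> 0" if "t \<ge> 0" for t :: real
    proof -
      have "q ((mat 1 + t *\<^sub>R T) *v v) \<le> (1 + t * \<tau>) * q v" for v
      proof -
        have "q ((mat 1 + t *\<^sub>R T) *v v) \<le> q v + t * q (T *v v)"
          using tri[of v "t *\<^sub>R (T *v v)"] that
          by (simp add: matrix_vector_mult_add_rdistrib hom scaleR_matrix_vector_assoc[symmetric])
        also have "\<dots> \<le> q v + t * (\<tau> * q v)"
          using T that by (intro add_left_mono mult_left_mono)
        finally show ?thesis by (simp add: algebra_simps)
      qed
      then have "\<bar>det (mat 1 + t *\<^sub>R T)\<bar> \<le> (1 + t * \<tau>) ^ CARD('n)"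
        using \<tau>(1) that by (intro abs_det_le_power_norm[OF a b]) auto
      then show ?thesis by (simp add: h_def)
    qed
    have "((\<lambda>t. mat 1 + t *\<^sub>R T) has_derivative (\<lambda>t. t *\<^sub>R T)) (at 0)"
      by (auto intro!: derivative_eq_intros)
    then have "((\<lambda>t. det (mat 1 + t *\<^sub>R T)) has_derivative (\<lambda>t. trace (t *\<^sub>R T))) (at 0)"
      by (rule det_has_derivative_at_mat_1) simp
    then have "((\<lambda>t. det (mat 1 + t *\<^sub>R T)) has_field_derivative trace T) (at 0)"
      by (simp add: has_field_derivative_def trace_def sum_distrib_left[symmetric] mult.commute[of _ "sum _ _"])
    moreover have "((\<lambda>t. (1 + t * \<tau>) ^ CARD('n)) has_field_derivative CARD('n) * \<tau>) (at 0)"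
      by (auto intro!: derivative_eq_intros)
    ultimately have "(h has_field_derivative CARD('n) * \<tau> - trace T) (at 0)"
      unfolding h_def by (rule DERIV_diff[rotated])
    from DERIV_neg_dec_right[OF this] neg
    obtain d where d: "d > 0" "\<And>t. 0 < t \<Longrightarrow> t < d \<Longrightarrow> h t < h 0" by auto
    then have "h (d / 2) < h 0" by simp
    moreover have "h 0 = 0" by (simp add: h_def)
    ultimately show False using h0[of "d / 2"] d(1) by simp
  qed
  have "trace T \<le> CARD('n) * \<tau>" by (rule *[OF \<tau>(2)])
  moreover have "trace (- T) \<le> CARD('n) * \<tau>"
  proof (rule *)
    fix v
    have "(- T) *v v = (- 1) *\<^sub>R (T *v v)"
      by (metis scaleR_matrix_vector_assoc scaleR_minus1_left)
    then have "q ((- T) *v v) = q (T *v v)" using hom[of "-1" "T *v v"] by simp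
    then show "q ((- T) *v v) \<le> \<tau> * q v" using \<tau>(2) by simp
  qed
  moreover have "trace (- T) = - trace T" by (simp add: trace_def sum_negf)
  ultimately show ?thesis by simp
qed

section \<open>Charts and the Riemannian metric\<close>

lemma norm_matrix_vector_mult_le: "norm (A *v v) \<le> norm A * norm v" for A :: "real ^ 'n::finite ^ 'k::finite"
proof -
  have "norm (A *v v) = L2_set (\<lambda>i. \<bar>A $ i \<bullet> v\<bar>) UNIV"
    by (simp add: norm_vec_def matrix_vector_mul_component)
  also have "\<dots> \<le> L2_set (\<lambda>i. norm (A $ i) * norm v) UNIV"
    by (intro L2_set_mono) (auto simp: Cauchy_Schwarz_ineq2)
  also have "\<dots> = norm A * norm v"
    using L2_set_left_distrib[of "norm v" "\<lambda>i. norm (A $ i)" UNIV] by (simp only: norm_vec_def[of A] norm_ge_zero)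
  finally show ?thesis .
qed

lemma abs_inner_matrix_le: "\<bar>v \<bullet> (A *v v)\<bar> \<le> norm A * (norm v)\<^sup>2" for A :: "real ^ 'n::finite ^ 'n"
proof -
  have "\<bar>v \<bullet> (A *v v)\<bar> \<le> norm v * norm (A *v v)" by (rule Cauchy_Schwarz_ineq2)
  also have "\<dots> \<le> norm v * (norm A * norm v)" by (intro mult_left_mono norm_matrix_vector_mult_le) simp
  finally show ?thesis by (simp add: power2_eq_square mult_ac)
qed

text \<open>
  A mean value inequality for functions that need not be differentiable: the bounds on adjacent
  intervals add up, so Bolzano's lemma chains the local ones.
\<close>

lemma abs_diff_le_if_local_slope_le:
  fixes h :: "real \<Rightarrow> real"
  assumes "\<And>t. 0 \<le> t \<Longrightarrow> t \<le> 1 \<Longrightarrow> \<forall>\<^sub>F s in nhds t. \<bar>h s - h t\<bar> \<le> C * \<bar>s - t\<bar>"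
  shows "\<bar>h 1 - h 0\<bar> \<le> C"
proof -
  have "\<bar>h 1 - h 0\<bar> \<le> C * (1 - 0)"
  proof (rule Bolzano[of 0 1 "\<lambda>a b. \<bar>h b - h a\<bar> \<le> C * (b - a)"])
    fix a b c assume "\<bar>h b - h a\<bar> \<le> C * (b - a)" "\<bar>h c - h b\<bar> \<le> C * (c - b)"
    then show "\<bar>h c - h a\<bar> \<le> C * (c - a)" by (auto simp: algebra_simps abs_le_iff)
  next
    fix x :: real assume "0 \<le> x" "x \<le> 1"
    from assms[OF this] obtain d where d: "d > 0" "\<And>s. dist s x < d \<Longrightarrow> \<bar>h s - h x\<bar> \<le> C * \<bar>s - x\<bar>"
      by (auto simp: eventually_nhds_metric)
    show "\<exists>d>0. \<forall>a b. a \<le> x \<and> x \<le> b \<and> b - a < d \<longrightarrow> \<bar>h b - h a\<bar> \<le> C * (b - a)"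
    proof (intro exI[of _ d] conjI d(1) allI impI)
      fix a b assume *: "a \<le> x \<and> x \<le> b \<and> b - a < d"
      have "\<bar>h a - h x\<bar> \<le> C * (x - a)" "\<bar>h b - h x\<bar> \<le> C * (b - x)"
        using d(2)[of a] d(2)[of b] * by (auto simp: dist_real_def)
      then show "\<bar>h b - h a\<bar> \<le> C * (b - a)" by (auto simp: algebra_simps abs_le_iff)
    qed
  qed simp
  then show ?thesis by simp
qed

text \<open>
  Positive functions whose logarithm has pointwise Lipschitz constant at most \<open>K\<close> in the Riemannian
  metric. The distance of nearby points \<open>y\<close> from \<open>x\<close> is measured in a chart, with the metric
  evaluated at \<open>x\<close>. As the condition concerns only the germ at each point, it can be followed
  through local inverse branches without lifting curves.
\<close>

definition log_lipschitz ::
  "('a::t2_space, 'n::finite) chart set \<Rightarrow> ('a, 'n) metric_coeffs \<Rightarrow> real \<Rightarrow> ('a \<Rightarrow> real) set" where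
  "log_lipschitz A G K = {\<alpha>. (\<forall>x. \<alpha> x > 0) \<and>
     (\<forall>c\<in>A. \<forall>x\<in>chart_dom c. \<forall>e>0. \<forall>\<^sub>F y in nhds x.
        \<bar>ln (\<alpha> y) - ln (\<alpha> x)\<bar> \<le> (K + e) * tangent_norm G c (chart_map c x) (chart_map c y - chart_map c x))}"

locale compact_riemannian =
  fixes A :: "('a::t2_space, 'n::finite) chart set" and G :: "('a, 'n) metric_coeffs"
    and m :: "'a measure"
  assumes manifold: "riemannian_manifold A G"
    and compact_M: "compact (UNIV :: 'a set)"
    and connected_M: "connected (UNIV :: 'a set)"
    and volume: "riemannian_volume A G m"
    and volume_1: "emeasure m UNIV = 1"
begin

abbreviation chart_img :: "('a, 'n) chart \<Rightarrow> (real ^ 'n) set" where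
  "chart_img c \<equiv> chart_map c ` chart_dom c"

lemma
  assumes "c \<in> A"
  shows open_chart_dom: "open (chart_dom c)" and open_chart_img: "open (chart_img c)"
    and chart_inv_map [simp]: "x \<in> chart_dom c \<Longrightarrow> chart_inv c (chart_map c x) = x"
    and chart_map_inv [simp]: "z \<in> chart_img c \<Longrightarrow> chart_map c (chart_inv c z) = z"
    and chart_inv_in_dom: "z \<in> chart_img c \<Longrightarrow> chart_inv c z \<in> chart_dom c"
    and continuous_on_chart_map: "continuous_on (chart_dom c) (chart_map c)"
    and continuous_on_chart_inv: "continuous_on (chart_img c) (chart_inv c)"
  using manifold assms
  by (auto simp: riemannian_manifold_def smooth_atlas_def homeomorphism_def)

lemma chart_at: obtains c where "c \<in> A" "x \<in> chart_dom c"
proof -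
  have "x \<in> (\<Union>c\<in>A. chart_dom c)"
    using manifold by (simp add: riemannian_manifold_def smooth_atlas_def)
  then show thesis using that by blast
qed

lemma local_dom_eq:
  assumes "c \<in> A"
  shows "local_dom c c' f = {z \<in> chart_img c. f (chart_inv c z) \<in> chart_dom c'}"
  using assms by (auto simp: local_dom_def image_iff)

lemma open_local_dom:
  assumes "c \<in> A" "c' \<in> A" "continuous_on UNIV f"
  shows "open (local_dom c c' f)"
proof -
  have "continuous_on (chart_img c) (\<lambda>z. f (chart_inv c z))"
    using continuous_on_compose2[OF assms(3) continuous_on_chart_inv[OF assms(1)]] by simp
  then have "open (chart_img c \<inter> (\<lambda>z. f (chart_inv c z)) -` chart_dom c')"
    using open_chart_img[OF assms(1)] open_chart_dom[OF assms(2)]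
    by (simp add: continuous_on_open_vimage Int_commute)
  also have "chart_img c \<inter> (\<lambda>z. f (chart_inv c z)) -` chart_dom c' = local_dom c c' f"
    unfolding local_dom_eq[OF assms(1)] by blast
  finally show ?thesis .
qed

lemma tendsto_chart_map:
  assumes "c \<in> A" "x \<in> chart_dom c"
  shows "(chart_map c \<longlongrightarrow> chart_map c x) (nhds x)"
  using continuous_on_chart_map[OF assms(1)] open_chart_dom[OF assms(1)] assms(2)
  by (metis continuous_on_eq_continuous_at isCont_def tendsto_at_iff_tendsto_nhds)

lemma tendsto_chart_inv:
  assumes "c \<in> A" "z \<in> chart_img c"
  shows "(chart_inv c \<longlongrightarrow> chart_inv c z) (nhds z)"
  using continuous_on_chart_inv[OF assms(1)] open_chart_img[OF assms(1)] assms(2)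
  by (metis continuous_on_eq_continuous_at isCont_def tendsto_at_iff_tendsto_nhds)

lemma eventually_in_chart_dom:
  assumes "c \<in> A" "x \<in> chart_dom c"
  shows "\<forall>\<^sub>F y in nhds x. y \<in> chart_dom c"
  using open_chart_dom[OF assms(1)] assms(2) by (rule eventually_nhds_in_open)

lemma
  assumes "c \<in> A" "z \<in> chart_img c"
  shows metric_sym: "transpose (G c z) = G c z"
    and metric_pos: "v \<noteq> 0 \<Longrightarrow> v \<bullet> (G c z *v v) > 0"
  using manifold assms by (auto simp: riemannian_manifold_def riemannian_metric_def tangent_inner_def)

lemma metric_nonneg:
  assumes "c \<in> A" "z \<in> chart_img c"
  shows "v \<bullet> (G c z *v v) \<ge> 0"
  using metric_pos[OF assms, of v] by (cases "v = 0") auto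

lemma det_metric_pos:
  assumes "c \<in> A" "z \<in> chart_img c"
  shows "det (G c z) > 0"
  using metric_pos[OF assms] by (rule det_pos_if_positive_definite)

lemma metric_differentiable:
  assumes "c \<in> A" "z \<in> chart_img c"
  shows "G c differentiable (at z)"
  using manifold assms
  by (force simp: riemannian_manifold_def riemannian_metric_def smooth_on_def dest: spec[of _ "Suc 0"])

lemma continuous_on_metric:
  assumes "c \<in> A"
  shows "continuous_on (chart_img c) (G c)"
  using metric_differentiable[OF assms]
  by (meson continuous_at_imp_continuous_on differentiable_imp_continuous_within)

lemma tangent_norm_power2:
  assumes "c \<in> A" "z \<in> chart_img c"
  shows "(tangent_norm G c z v)\<^sup>2 = v \<bullet> (G c z *v v)"
  using metric_nonneg[OF assms] by (simp add: tangent_norm_def tangent_inner_def)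

lemma tangent_norm_nonneg:
  assumes "c \<in> A" "z \<in> chart_img c"
  shows "tangent_norm G c z v \<ge> 0"
  using metric_nonneg[OF assms] by (simp add: tangent_norm_def tangent_inner_def)

lemma tangent_norm_scaleR: "tangent_norm G c z (r *\<^sub>R v) = \<bar>r\<bar> * tangent_norm G c z v"
proof -
  have "G c z *v (r *\<^sub>R v) = r *\<^sub>R (G c z *v v)"
    by (simp add: linear_scale matrix_vector_mul_linear)
  then have "tangent_inner G c z (r *\<^sub>R v) (r *\<^sub>R v) = r\<^sup>2 * tangent_inner G c z v v"
    by (simp add: tangent_inner_def power2_eq_square)
  then show ?thesis by (simp add: tangent_norm_def real_sqrt_mult)
qed

lemma tangent_norm_0 [simp]: "tangent_norm G c z 0 = 0"
  by (simp add: tangent_norm_def tangent_inner_def)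

lemma tangent_norm_minus: "tangent_norm G c z (- v) = tangent_norm G c z v"
  using tangent_norm_scaleR[of c z "-1" v] by simp

lemma tangent_inner_sym:
  assumes "c \<in> A" "z \<in> chart_img c"
  shows "u \<bullet> (G c z *v v) = v \<bullet> (G c z *v u)"
  using metric_sym[OF assms] by (metis dot_lmul_matrix inner_commute vector_transpose_matrix)

text \<open>
  The Cauchy-Schwarz inequality comes from the nonnegativity of the square of \<open>u - t v\<close> at the
  minimising \<open>t\<close>.
\<close>

lemma tangent_norm_triangle:
  assumes c: "c \<in> A" "z \<in> chart_img c"
  shows "tangent_norm G c z (u + v) \<le> tangent_norm G c z u + tangent_norm G c z v"
proof -
  let ?N = "tangent_norm G c z"
  let ?B = "\<lambda>u v. u \<bullet> (G c z *v v)"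
  have exp: "?B (p + r *\<^sub>R q) (p + r *\<^sub>R q) = ?B p p + 2 * r * ?B p q + r * r * ?B q q" for p q r
  proof -
    have "G c z *v (p + r *\<^sub>R q) = G c z *v p + r *\<^sub>R (G c z *v q)"
      by (simp only: matrix_vector_right_distrib linear_scale[OF matrix_vector_mul_linear])
    then show ?thesis
      using tangent_inner_sym[OF c, of q p] by (simp add: inner_add_left inner_add_right algebra_simps)
  qed
  have CS: "?B u v \<le> ?N u * ?N v"
  proof (cases "v = 0")
    case False
    have pos: "?B v v > 0" using metric_pos[OF c False] .
    define t where "t = ?B u v / ?B v v"
    have "0 \<le> ?B (u + (- t) *\<^sub>R v) (u + (- t) *\<^sub>R v)" by (rule metric_nonneg[OF c])
    also have "\<dots> = ?B u u - 2 * t * ?B u v + t * t * ?B v v"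
      unfolding exp by simp
    finally have "0 \<le> ?B u u - 2 * t * ?B u v + t * t * ?B v v" .
    moreover have "2 * t * ?B u v = 2 * ((?B u v)\<^sup>2 / ?B v v)"
      by (simp only: t_def power2_eq_square) simp
    moreover have "t * t * ?B v v = (?B u v)\<^sup>2 / ?B v v"
      unfolding t_def power2_eq_square using pos by simp
    ultimately have "(?B u v)\<^sup>2 / ?B v v \<le> ?B u u" by linarith
    then have "(?B u v)\<^sup>2 \<le> ?B u u * ?B v v" using pos by (simp only: pos_divide_le_eq)
    also have "\<dots> = (?N u * ?N v)\<^sup>2" by (simp only: power_mult_distrib tangent_norm_power2[OF c])
    finally show ?thesis
      by (rule power2_le_imp_le) (intro mult_nonneg_nonneg tangent_norm_nonneg[OF c])
  qed simp
  have "(?N (u + v))\<^sup>2 = (?N u)\<^sup>2 + 2 * ?B u v + (?N v)\<^sup>2"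
    using exp[of u 1 v] by (simp add: tangent_norm_power2[OF c])
  also have "\<dots> \<le> (?N u + ?N v)\<^sup>2"
    using CS by (simp add: power2_sum)
  finally show ?thesis
    by (rule power2_le_imp_le) (intro add_nonneg_nonneg tangent_norm_nonneg[OF c])
qed

lemma tangent_norm_le_norm:
  assumes "c \<in> A" "z \<in> chart_img c" "norm (G c z) \<le> b\<^sup>2" "b \<ge> 0"
  shows "tangent_norm G c z v \<le> b * norm v"
proof (rule power2_le_imp_le)
  have "(tangent_norm G c z v)\<^sup>2 \<le> norm (G c z) * (norm v)\<^sup>2"
    using abs_inner_matrix_le[of v "G c z"] by (simp add: tangent_norm_power2 assms)
  also have "\<dots> \<le> b\<^sup>2 * (norm v)\<^sup>2" using assms by (intro mult_right_mono) auto
  finally show "(tangent_norm G c z v)\<^sup>2 \<le> (b * norm v)\<^sup>2" by (simp add: power_mult_distrib)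
qed (use assms in simp)

lemma tangent_norm_upper:
  assumes "c \<in> A" "z \<in> chart_img c"
  obtains b where "b > 0" "\<And>v. tangent_norm G c z v \<le> b * norm v"
proof
  show "1 + sqrt (norm (G c z)) > 0" by (simp add: add_pos_nonneg)
  fix v show "tangent_norm G c z v \<le> (1 + sqrt (norm (G c z))) * norm v"
    by (rule tangent_norm_le_norm[OF assms]) (auto simp: power2_sum)
qed

lemma tangent_norm_lower:
  assumes c: "c \<in> A" "z \<in> chart_img c"
  obtains a where "a > 0" "\<And>v. a * norm v \<le> tangent_norm G c z v"
proof -
  have "continuous_on (sphere 0 1) (\<lambda>v. v \<bullet> (G c z *v v))"
    by (intro continuous_intros linear_continuous_on) (simp add: linear_linear)
  moreover have "axis undefined 1 \<in> sphere (0 :: real ^ 'n) 1" by simp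
  ultimately obtain w where w: "norm w = 1" "\<And>v. norm v = 1 \<Longrightarrow> w \<bullet> (G c z *v w) \<le> v \<bullet> (G c z *v v)"
    using continuous_attains_inf[of "sphere (0 :: real ^ 'n) 1" "\<lambda>v. v \<bullet> (G c z *v v)"]
    by (auto simp: compact_sphere)
  have w0: "tangent_norm G c z w > 0"
  proof -
    have "w \<noteq> 0" using w(1) by auto
    from metric_pos[OF c this] show ?thesis by (simp add: tangent_norm_def tangent_inner_def)
  qed
  show thesis
  proof (rule that[OF w0])
    fix v :: "real ^ 'n"
    show "tangent_norm G c z w * norm v \<le> tangent_norm G c z v"
    proof (cases "v = 0")
      case False
      let ?u = "inverse (norm v) *\<^sub>R v"
      have "norm ?u = 1" using False by simp
      then have "tangent_norm G c z w \<le> tangent_norm G c z ?u"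
        unfolding tangent_norm_def tangent_inner_def using w(2)[of ?u] by simp
      also have "\<dots> = tangent_norm G c z v / norm v"
        by (simp add: tangent_norm_scaleR divide_inverse mult.commute)
      finally show ?thesis using False by (simp add: field_simps)
    qed simp
  qed
qed

text \<open>
  The squares of the two norms differ by at most \<open>norm (G c z' - G c z) * (norm v)\<^sup>2\<close>, and \<open>norm v\<close>
  is controlled by the norm at \<open>z\<close>. Any factor above \<open>1\<close> could replace \<open>2\<close>.
\<close>

lemma tangent_norm_le_2_near:
  assumes c: "c \<in> A" "z \<in> chart_img c"
  shows "\<forall>\<^sub>F z' in nhds z. z' \<in> chart_img c \<and> (\<forall>v. tangent_norm G c z' v \<le> 2 * tangent_norm G c z v)"
proof -
  obtain a where a: "a > 0" "\<And>v. a * norm v \<le> tangent_norm G c z v"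
    using tangent_norm_lower[OF c] by blast
  have "(G c \<longlongrightarrow> G c z) (nhds z)"
    using continuous_on_metric[OF c(1)] open_chart_img[OF c(1)] c(2)
    by (metis continuous_on_eq_continuous_at isCont_def tendsto_at_iff_tendsto_nhds)
  then have "\<forall>\<^sub>F z' in nhds z. dist (G c z') (G c z) < a\<^sup>2"
    by (rule tendstoD) (use a in simp)
  moreover have "\<forall>\<^sub>F z' in nhds z. z' \<in> chart_img c"
    by (rule eventually_nhds_in_open[OF open_chart_img[OF c(1)] c(2)])
  ultimately show ?thesis
  proof eventually_elim
    case (elim z')
    have "tangent_norm G c z' v \<le> 2 * tangent_norm G c z v" for v
    proof (rule power2_le_imp_le)
      have "v \<bullet> (G c z' *v v) = v \<bullet> (G c z *v v) + v \<bullet> ((G c z' - G c z) *v v)"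
        by (simp add: matrix_vector_mult_diff_rdistrib inner_diff_right)
      also have "v \<bullet> ((G c z' - G c z) *v v) \<le> norm (G c z' - G c z) * (norm v)\<^sup>2"
        using abs_inner_matrix_le[of v "G c z' - G c z"] by simp
      also have "\<dots> \<le> a\<^sup>2 * (norm v)\<^sup>2"
        using elim(1) by (intro mult_right_mono) (auto simp: dist_norm)
      also have "\<dots> \<le> (tangent_norm G c z v)\<^sup>2"
        unfolding power_mult_distrib[symmetric] using a by (intro power_mono) auto
      finally have "(tangent_norm G c z' v)\<^sup>2 \<le> 2 * (tangent_norm G c z v)\<^sup>2"
        using elim(2) c by (simp add: tangent_norm_power2)
      then show "(tangent_norm G c z' v)\<^sup>2 \<le> (2 * tangent_norm G c z v)\<^sup>2"
        using zero_le_power2[of "tangent_norm G c z v"]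
          power_mult_distrib[of 2 "tangent_norm G c z v" 2] unfolding power2_eq_square[of "2::real"] by linarith
    qed (intro mult_nonneg_nonneg tangent_norm_nonneg[OF c], simp)
    then show ?case using elim(2) by blast
  qed
qed

end

section \<open>Log-Lipschitz densities and Harnack's inequality\<close>

context compact_riemannian begin

lemma log_lipschitz_pos: "\<alpha> \<in> log_lipschitz A G K \<Longrightarrow> \<alpha> x > 0"
  by (simp add: log_lipschitz_def)

lemma log_lipschitzD:
  assumes "\<alpha> \<in> log_lipschitz A G K" "c \<in> A" "x \<in> chart_dom c" "e > 0"
  shows "\<forall>\<^sub>F y in nhds x. \<bar>ln (\<alpha> y) - ln (\<alpha> x)\<bar>
    \<le> (K + e) * tangent_norm G c (chart_map c x) (chart_map c y - chart_map c x)"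
  using assms by (auto simp: log_lipschitz_def)

lemma tendsto_tangent_norm_diff:
  assumes c: "c \<in> A" "x \<in> chart_dom c"
  shows "((\<lambda>y. tangent_norm G c (chart_map c x) (chart_map c y - chart_map c x)) \<longlongrightarrow> 0) (nhds x)"
proof -
  have z: "chart_map c x \<in> chart_img c" using c by simp
  obtain b where b: "b > 0" "\<And>v. tangent_norm G c (chart_map c x) v \<le> b * norm v"
    using tangent_norm_upper[OF c(1) z] by blast
  have lim: "((\<lambda>y. b * norm (chart_map c y - chart_map c x)) \<longlongrightarrow> 0) (nhds x)"
    using tendsto_mult[OF tendsto_const tendsto_norm[OF tendsto_diff[OF tendsto_chart_map[OF c] tendsto_const]], of b "chart_map c x"]
    by simp
  show ?thesis
    by (rule tendsto_sandwich[OF _ _ tendsto_const lim])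
       (use b(2) tangent_norm_nonneg[OF c(1) z] in \<open>auto intro!: always_eventually\<close>)
qed

lemma tendsto_if_abs_diff_le_tangent_norm:
  fixes h :: "'a \<Rightarrow> real"
  assumes c: "c \<in> A" "x \<in> chart_dom c"
    and le: "\<forall>\<^sub>F y in nhds x. \<bar>h y - h x\<bar> \<le> B * tangent_norm G c (chart_map c x) (chart_map c y - chart_map c x)"
  shows "(h \<longlongrightarrow> h x) (nhds x)"
proof -
  have "((\<lambda>y. B * tangent_norm G c (chart_map c x) (chart_map c y - chart_map c x)) \<longlongrightarrow> 0) (nhds x)"
    using tendsto_mult[OF tendsto_const tendsto_tangent_norm_diff[OF c], of B] by simp
  then have "((\<lambda>y. h y - h x) \<longlongrightarrow> 0) (nhds x)"
    by (rule Lim_null_comparison[rotated]) (use le in simp)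
  then show ?thesis by (simp add: LIM_zero_iff)
qed

lemma continuous_on_UNIV_if_tendsto_nhds:
  fixes h :: "'a \<Rightarrow> real"
  assumes "\<And>x. (h \<longlongrightarrow> h x) (nhds x)"
  shows "continuous_on UNIV h"
  using assms by (auto simp: continuous_on_eq_continuous_at isCont_def tendsto_at_iff_tendsto_nhds)

lemma log_lipschitz_continuous_on:
  assumes \<alpha>: "\<alpha> \<in> log_lipschitz A G K"
  shows "continuous_on UNIV \<alpha>"
proof -
  have "((\<lambda>y. ln (\<alpha> y)) \<longlongrightarrow> ln (\<alpha> x)) (nhds x)" for x
  proof -
    obtain c where c: "c \<in> A" "x \<in> chart_dom c" by (rule chart_at)
    show ?thesis
      by (rule tendsto_if_abs_diff_le_tangent_norm[OF c log_lipschitzD[OF \<alpha> c zero_less_one]])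
  qed
  then have "continuous_on UNIV (\<lambda>x. ln (\<alpha> x))"
    by (rule continuous_on_UNIV_if_tendsto_nhds)
  then have "continuous_on UNIV (\<lambda>x. exp (ln (\<alpha> x)))"
    by (rule continuous_on_exp)
  then show ?thesis using log_lipschitz_pos[OF \<alpha>] by simp
qed

text \<open>
  Along coordinate segments in a ball on which the metric is bounded, the slope of \<open>ln \<circ> \<alpha>\<close> is
  bounded, with the same bound for all \<open>\<alpha>\<close> in the class.
\<close>

lemma harnack_local:
  assumes K: "K \<ge> 0"
  shows "\<exists>V C. open V \<and> x \<in> V \<and> (\<forall>\<alpha>\<in>log_lipschitz A G K. \<forall>y\<in>V. \<forall>y'\<in>V. \<alpha> y' \<le> exp C * \<alpha> y)"
proof -
  obtain c where c: "c \<in> A" "x \<in> chart_dom c" by (rule chart_at)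
  let ?z = "chart_map c x"
  have "?z \<in> chart_img c" using c by simp
  then obtain r where r: "r > 0" "cball ?z r \<subseteq> chart_img c"
    using open_chart_img[OF c(1)] open_contains_cball by blast
  have "compact (G c ` cball ?z r)"
    using continuous_on_subset[OF continuous_on_metric[OF c(1)] r(2)]
    by (intro compact_continuous_image) auto
  then obtain b0 where b0: "\<And>z. z \<in> cball ?z r \<Longrightarrow> norm (G c z) \<le> b0"
    using compact_imp_bounded[of "G c ` cball ?z r"] unfolding bounded_iff by blast
  define b where "b = sqrt (max b0 0)"
  have b: "b \<ge> 0" "norm (G c z) \<le> b\<^sup>2" if "z \<in> cball ?z r" for z
    using b0[OF that] by (auto simp: b_def)
  define V where "V = chart_dom c \<inter> chart_map c -` ball ?z r"
  have "open V"
    unfolding V_def using continuous_on_chart_map[OF c(1)] open_chart_dom[OF c(1)]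
    by (metis continuous_on_open_vimage Int_commute open_ball)
  moreover have "x \<in> V" using c r by (simp add: V_def)
  moreover have "\<alpha> y' \<le> exp ((K + 1) * b * (2 * r)) * \<alpha> y"
    if \<alpha>: "\<alpha> \<in> log_lipschitz A G K" and y: "y \<in> V" "y' \<in> V" for \<alpha> y y'
  proof -
    let ?w = "chart_map c y' - chart_map c y"
    define z where "z t = chart_map c y + t *\<^sub>R ?w" for t :: real
    have zt: "z t \<in> ball ?z r" if "0 \<le> t" "t \<le> 1" for t
    proof -
      have "z t = (1 - t) *\<^sub>R chart_map c y + t *\<^sub>R chart_map c y'"
        by (simp add: z_def algebra_simps)
      then show ?thesis
        using convex_ball[of ?z r] y that by (auto simp: V_def convex_alt)
    qed
    define h where "h t = ln (\<alpha> (chart_inv c (z t)))" for t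
    have "\<bar>h 1 - h 0\<bar> \<le> (K + 1) * b * norm ?w"
    proof (rule abs_diff_le_if_local_slope_le)
      fix t :: real assume t: "0 \<le> t" "t \<le> 1"
      have zi: "z t \<in> chart_img c" "z t \<in> cball ?z r"
        using zt[OF t] r(2) by auto
      have lim: "(z \<longlongrightarrow> z t) (nhds t)"
        unfolding z_def by (intro tendsto_intros filterlim_ident)
      have "filterlim (\<lambda>s. chart_inv c (z s)) (nhds (chart_inv c (z t))) (nhds t)"
        by (rule filterlim_compose[OF tendsto_chart_inv[OF c(1) zi(1)] lim])
      from this log_lipschitzD[OF \<alpha> c(1) chart_inv_in_dom[OF c(1) zi(1)] zero_less_one]
      have "\<forall>\<^sub>F s in nhds t. \<bar>ln (\<alpha> (chart_inv c (z s))) - ln (\<alpha> (chart_inv c (z t)))\<bar>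
         \<le> (K + 1) * tangent_norm G c (chart_map c (chart_inv c (z t)))
              (chart_map c (chart_inv c (z s)) - chart_map c (chart_inv c (z t)))"
        by (rule eventually_compose_filterlim[rotated])
      moreover have "\<forall>\<^sub>F s in nhds t. z s \<in> chart_img c"
        by (rule topological_tendstoD[OF lim open_chart_img[OF c(1)] zi(1)])
      ultimately show "\<forall>\<^sub>F s in nhds t. \<bar>h s - h t\<bar> \<le> (K + 1) * b * norm ?w * \<bar>s - t\<bar>"
      proof eventually_elim
        case (elim s)
        have "z s - z t = (s - t) *\<^sub>R ?w" by (simp add: z_def algebra_simps)
        then have "\<bar>h s - h t\<bar> \<le> (K + 1) * (\<bar>s - t\<bar> * tangent_norm G c (z t) ?w)"
          using elim c zi by (simp add: h_def tangent_norm_scaleR)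
        also have "\<dots> \<le> (K + 1) * (\<bar>s - t\<bar> * (b * norm ?w))"
          using K tangent_norm_le_norm[OF c(1) zi(1) b(2)[OF zi(2)] b(1)[OF zi(2)]]
          by (intro mult_left_mono) auto
        finally show ?case by (simp add: mult_ac)
      qed
    qed
    also have "norm ?w \<le> 2 * r"
      using y dist_triangle2[of "chart_map c y'" "chart_map c y" ?z]
      by (simp add: V_def dist_norm norm_minus_commute)
    finally have "\<bar>h 1 - h 0\<bar> \<le> (K + 1) * b * (2 * r)"
      using K b(1)[of ?z] r by (simp add: mult_left_mono)
    moreover have "h 1 = ln (\<alpha> y')" "h 0 = ln (\<alpha> y)"
      using y c by (auto simp: h_def z_def V_def)
    ultimately have "ln (\<alpha> y') \<le> (K + 1) * b * (2 * r) + ln (\<alpha> y)" by linarith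
    then have "exp (ln (\<alpha> y')) \<le> exp ((K + 1) * b * (2 * r) + ln (\<alpha> y))" by simp
    then show ?thesis using log_lipschitz_pos[OF \<alpha>] by (simp add: exp_add)
  qed
  ultimately show ?thesis by blast
qed

text \<open>
  Having values that are comparable uniformly over the class is an equivalence relation on points,
  and its equivalence classes are open. Connectedness leaves a single one, and compactness makes
  the constant independent of the points.
\<close>

theorem harnack:
  assumes K: "K \<ge> 0"
  obtains C where "C > 0" "\<And>\<alpha> x y. \<alpha> \<in> log_lipschitz A G K \<Longrightarrow> \<alpha> x \<le> C * \<alpha> y"
proof -
  obtain V C where V: "\<And>x. open (V x)" "\<And>x. x \<in> V x"
    and C: "\<And>x \<alpha> y y'. \<alpha> \<in> log_lipschitz A G K \<Longrightarrow> y \<in> V x \<Longrightarrow> y' \<in> V x \<Longrightarrow> \<alpha> y' \<le> exp (C x) * \<alpha> y"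
    using harnack_local[OF K] by metis
  define R where "R x y \<longleftrightarrow> (\<exists>C>0. \<forall>\<alpha>\<in>log_lipschitz A G K. \<alpha> x \<le> C * \<alpha> y \<and> \<alpha> y \<le> C * \<alpha> x)" for x y
  have R_trans: "R x z" if Rxyz: "R x y" "R y z" for x y z
  proof -
    obtain C1 C2 where *: "C1 > 0" "C2 > 0"
      "\<And>\<alpha>. \<alpha> \<in> log_lipschitz A G K \<Longrightarrow> \<alpha> x \<le> C1 * \<alpha> y \<and> \<alpha> y \<le> C1 * \<alpha> x"
      "\<And>\<alpha>. \<alpha> \<in> log_lipschitz A G K \<Longrightarrow> \<alpha> y \<le> C2 * \<alpha> z \<and> \<alpha> z \<le> C2 * \<alpha> y"
      using Rxyz unfolding R_def by blast
    have "\<alpha> x \<le> C1 * C2 * \<alpha> z \<and> \<alpha> z \<le> C1 * C2 * \<alpha> x" if "\<alpha> \<in> log_lipschitz A G K" for \<alpha>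
      using *(3,4)[OF that] mult_left_mono[of "\<alpha> y" "C2 * \<alpha> z" C1] mult_left_mono[of "\<alpha> y" "C1 * \<alpha> x" C2] *(1,2)
      by (auto simp: mult_ac intro: order_trans)
    then show ?thesis using *(1,2) unfolding R_def by (intro exI[of _ "C1 * C2"]) auto
  qed
  have R_sym: "R x y \<Longrightarrow> R y x" for x y by (auto simp: R_def)
  have R_V: "R y y'" if "y \<in> V x" "y' \<in> V x" for x y y'
    unfolding R_def using C[OF _ that] C[OF _ that(2,1)] by (intro exI[of _ "exp (C x)"]) auto
  obtain x0 :: 'a where True by simp
  have op: "open {y. R x0 y}" "open {y. \<not> R x0 y}"
  proof -
    show "open {y. R x0 y}"
    proof (subst open_subopen, intro ballI)
      fix y assume "y \<in> {y. R x0 y}"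
      then have "V y \<subseteq> {y. R x0 y}" using R_trans R_V V(2) by blast
      then show "\<exists>T. open T \<and> y \<in> T \<and> T \<subseteq> {y. R x0 y}" using V by blast
    qed
    show "open {y. \<not> R x0 y}"
    proof (subst open_subopen, intro ballI)
      fix y assume "y \<in> {y. \<not> R x0 y}"
      then have "V y \<subseteq> {y. \<not> R x0 y}" using R_trans R_V V(2) by blast
      then show "\<exists>T. open T \<and> y \<in> T \<and> T \<subseteq> {y. \<not> R x0 y}" using V by blast
    qed
  qed
  have "R x0 x0" using R_V V by blast
  then have all: "R x0 y" for y
    using connectedD[OF connected_M op] by blast
  obtain F where F: "finite F" "UNIV \<subseteq> (\<Union>x\<in>F. V x)"
  proof -
    have "UNIV \<subseteq> \<Union> (range V)" using V(2) by blast
    from compactE_image[OF compact_M _ this] V(1) that show thesis by metis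
  qed
  have "\<exists>D>0. \<forall>\<alpha>\<in>log_lipschitz A G K. \<forall>y\<in>V x. \<alpha> y \<le> D * \<alpha> x0 \<and> \<alpha> x0 \<le> D * \<alpha> y" for x
  proof -
    obtain D where D: "D > 0" "\<And>\<alpha>. \<alpha> \<in> log_lipschitz A G K \<Longrightarrow> \<alpha> x0 \<le> D * \<alpha> x \<and> \<alpha> x \<le> D * \<alpha> x0"
      using all[of x] by (auto simp: R_def)
    have "\<alpha> y \<le> (exp (C x) * D) * \<alpha> x0 \<and> \<alpha> x0 \<le> (exp (C x) * D) * \<alpha> y"
      if "\<alpha> \<in> log_lipschitz A G K" "y \<in> V x" for \<alpha> y
    proof -
      have "\<alpha> y \<le> exp (C x) * \<alpha> x" "\<alpha> x \<le> exp (C x) * \<alpha> y" using C[OF that(1)] V(2) that(2) by auto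
      then show ?thesis
        using D(2)[OF that(1)] mult_left_mono[of "\<alpha> x" "D * \<alpha> x0" "exp (C x)"]
          mult_left_mono[of "\<alpha> x" "exp (C x) * \<alpha> y" D] D(1)
        by (auto simp: mult_ac intro: order_trans)
    qed
    then show ?thesis using D(1) by (intro exI[of _ "exp (C x) * D"]) auto
  qed
  then obtain D where D: "\<And>x. D x > 0"
    "\<And>x \<alpha> y. \<alpha> \<in> log_lipschitz A G K \<Longrightarrow> y \<in> V x \<Longrightarrow> \<alpha> y \<le> D x * \<alpha> x0 \<and> \<alpha> x0 \<le> D x * \<alpha> y"
    by metis
  define E where "E = (\<Sum>x\<in>F. D x)"
  have DE: "D x \<le> E" if "x \<in> F" for x
    unfolding E_def using F(1) D(1) that by (intro member_le_sum) (auto intro: less_imp_le)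
  have "F \<noteq> {}" using F by auto
  then have E: "E > 0" unfolding E_def using F(1) D(1) by (intro sum_pos) auto
  have b: "\<alpha> y \<le> E * \<alpha> x0 \<and> \<alpha> x0 \<le> E * \<alpha> y" if \<alpha>: "\<alpha> \<in> log_lipschitz A G K" for \<alpha> y
  proof -
    obtain x where x: "x \<in> F" "y \<in> V x" using F by blast
    have "D x * \<alpha> x0 \<le> E * \<alpha> x0" "D x * \<alpha> y \<le> E * \<alpha> y"
      using DE[OF x(1)] log_lipschitz_pos[OF \<alpha>] by (auto intro!: mult_right_mono intro: less_imp_le)
    then show ?thesis using D(2)[OF \<alpha> x(2)] by linarith
  qed
  show thesis
  proof (rule that[of "E * E"])
    show "E * E > 0" using E by simp
    fix \<alpha> x y assume \<alpha>: "\<alpha> \<in> log_lipschitz A G K"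
    have "\<alpha> x \<le> E * \<alpha> x0" using b[OF \<alpha>] by blast
    also have "\<dots> \<le> E * (E * \<alpha> y)" using b[OF \<alpha>] E by (intro mult_left_mono) auto
    finally show "\<alpha> x \<le> E * E * \<alpha> y" by (simp add: mult.assoc)
  qed
qed

section \<open>Upper bounds on the Riemannian distance\<close>

lemma chart_change_C1:
  assumes "c \<in> A" "c' \<in> A"
  shows "z \<in> local_dom c c' id \<Longrightarrow> local_rep c c' id differentiable (at z)"
    and "continuous_on (local_dom c c' id) (\<lambda>z. frechet_derivative (local_rep c c' id) (at z) v)"
proof -
  have "Ck_on (Suc 0) (local_dom c c' id) (local_rep c c' id)"
    using manifold assms unfolding riemannian_manifold_def smooth_atlas_def smooth_on_def by blast
  then show "z \<in> local_dom c c' id \<Longrightarrow> local_rep c c' id differentiable (at z)"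
    and "continuous_on (local_dom c c' id) (\<lambda>z. frechet_derivative (local_rep c c' id) (at z) v)"
    by simp_all
qed

lemma curve_speed_nonneg: "curve_speed A G \<gamma> t \<ge> 0"
proof -
  let ?P = "\<lambda>c. c \<in> A \<and> \<gamma> t \<in> chart_dom c"
  have "\<exists>c. ?P c" using chart_at by blast
  then have "?P (SOME c. ?P c)" by (rule someI_ex)
  then show ?thesis
    unfolding curve_speed_def Let_def by (intro tangent_norm_nonneg) auto
qed

lemma curve_length_nonneg: "curve_length A G \<gamma> \<ge> 0"
  unfolding curve_length_def
  by (cases "curve_speed A G \<gamma> integrable_on {0..1}")
     (auto intro: integral_nonneg simp: curve_speed_nonneg not_integrable_integral)

lemma riem_dist_le_curve_length:
  assumes "piecewise_C1_curve A \<gamma>"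
  shows "riem_dist A G (\<gamma> 0) (\<gamma> 1) \<le> curve_length A G \<gamma>"
  unfolding riem_dist_def
proof (rule cInf_lower)
  show "bdd_below {curve_length A G \<gamma>' |\<gamma>'. piecewise_C1_curve A \<gamma>' \<and> \<gamma>' 0 = \<gamma> 0 \<and> \<gamma>' 1 = \<gamma> 1}"
    using curve_length_nonneg by (intro bdd_belowI[of _ 0]) auto
qed (use assms in auto)

text \<open>
  The coordinate segment from \<open>x\<close> to \<open>y\<close> competes in the infimum. By the transformation law of the
  metric, its speed in whichever chart \<open>curve_speed\<close> selects is its speed in \<open>c\<close>, which is at most
  twice the speed measured by the metric at \<open>x\<close>.
\<close>

lemma riem_dist_le_in_chart:
  assumes c: "c \<in> A" "x \<in> chart_dom c"
  shows "\<forall>\<^sub>F y in nhds x. 0 \<le> riem_dist A G x y \<and>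
    riem_dist A G x y \<le> 2 * tangent_norm G c (chart_map c x) (chart_map c y - chart_map c x)"
proof -
  let ?z = "chart_map c x"
  have zi: "?z \<in> chart_img c" using c by simp
  obtain r where r: "r > 0" "\<And>z. z \<in> ball ?z r \<Longrightarrow> z \<in> chart_img c"
    "\<And>z v. z \<in> ball ?z r \<Longrightarrow> tangent_norm G c z v \<le> 2 * tangent_norm G c ?z v"
    using tangent_norm_le_2_near[OF c(1) zi]
    by (auto simp: eventually_nhds_metric dist_commute)
  have "\<forall>\<^sub>F y in nhds x. chart_map c y \<in> ball ?z r"
    by (rule topological_tendstoD[OF tendsto_chart_map[OF c]]) (use r in auto)
  moreover note eventually_in_chart_dom[OF c]
  ultimately show ?thesis
  proof eventually_elim
    case (elim y)
    define w where "w = chart_map c y - ?z"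
    define z where "z t = ?z + t *\<^sub>R w" for t :: real
    define \<gamma> where "\<gamma> t = chart_inv c (z t)" for t
    have z_ball: "z t \<in> ball ?z r" if "t \<in> {0..1}" for t
    proof -
      have "norm (t *\<^sub>R w) \<le> norm w" using that by (auto intro: mult_left_le_one_le)
      also have "\<dots> < r" using elim(1) by (simp add: w_def dist_norm norm_minus_commute)
      finally show ?thesis by (simp add: z_def dist_norm)
    qed
    have z_img: "z t \<in> chart_img c" if "t \<in> {0..1}" for t using z_ball[OF that] r(2) by blast
    have cont_z: "continuous_on S z" for S unfolding z_def by (intro continuous_intros)
    have rep: "(chart_map c1 \<circ> \<gamma>) = (\<lambda>t. local_rep c c1 id (z t))" for c1
      by (auto simp: local_rep_def \<gamma>_def)
    have dom: "z t \<in> local_dom c c1 id" if "t \<in> {0..1}" "\<gamma> t \<in> chart_dom c1" for t c1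
      using that z_img by (simp add: local_dom_eq[OF c(1)] \<gamma>_def)
    have der: "((chart_map c1 \<circ> \<gamma>) has_vector_derivative
        frechet_derivative (local_rep c c1 id) (at (z t)) w) (at t)"
      if "c1 \<in> A" "t \<in> {0..1}" "\<gamma> t \<in> chart_dom c1" for t c1
    proof -
      have "(local_rep c c1 id has_derivative frechet_derivative (local_rep c c1 id) (at (z t))) (at (z t))"
        using chart_change_C1(1)[OF c(1) that(1) dom[OF that(2,3)]] frechet_derivative_works by blast
      moreover have "(z has_vector_derivative w) (at t)"
        unfolding z_def by (auto intro!: derivative_eq_intros)
      ultimately show ?thesis
        unfolding rep using vector_derivative_diff_chain_within[of z w t UNIV "local_rep c c1 id"]
        by (simp add: comp_def has_derivative_at_withinI)
    qed
    have "C1_curve_on A 0 1 \<gamma>"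
      unfolding C1_curve_on_def
    proof (intro conjI ballI)
      show "continuous_on {0..1} \<gamma>"
        unfolding \<gamma>_def using z_img
        by (intro continuous_on_compose2[OF continuous_on_chart_inv[OF c(1)] cont_z]) auto
      fix c1 assume c1: "c1 \<in> A"
      let ?T = "{t \<in> {0..1}. \<gamma> t \<in> chart_dom c1}"
      let ?v = "\<lambda>t. frechet_derivative (local_rep c c1 id) (at (z t)) w"
      have "continuous_on ?T ?v"
        using dom by (intro continuous_on_compose2[OF chart_change_C1(2)[OF c(1) c1] cont_z]) blast
      moreover have "\<forall>t\<in>{0..1}. \<gamma> t \<in> chart_dom c1 \<longrightarrow>
           ((chart_map c1 \<circ> \<gamma>) has_vector_derivative ?v t) (at t within {0..1})"
        using der[OF c1] by (blast intro: has_vector_derivative_at_within)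
      ultimately show "\<exists>v. continuous_on ?T v \<and> (\<forall>t\<in>{0..1}. \<gamma> t \<in> chart_dom c1 \<longrightarrow>
           ((chart_map c1 \<circ> \<gamma>) has_vector_derivative v t) (at t within {0..1}))" by blast
    qed
    then have pw: "piecewise_C1_curve A \<gamma>"
      unfolding piecewise_C1_curve_def by (intro exI[of _ 1] exI[of _ real]) auto
    have speed: "curve_speed A G \<gamma> t \<le> 2 * tangent_norm G c ?z w" if t: "t \<in> {0..1}" for t
    proof -
      let ?P = "\<lambda>c. c \<in> A \<and> \<gamma> t \<in> chart_dom c"
      define c1 where "c1 = (SOME c. ?P c)"
      have "\<exists>c. ?P c" using chart_at by blast
      then have c1: "c1 \<in> A" "\<gamma> t \<in> chart_dom c1" unfolding c1_def using someI_ex[of ?P] by auto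
      have "curve_speed A G \<gamma> t = tangent_norm G c1 (local_rep c c1 id (z t))
          (frechet_derivative (local_rep c c1 id) (at (z t)) w)"
        unfolding curve_speed_def Let_def c1_def[symmetric]
        using vector_derivative_at[OF der[OF c1(1) t c1(2)]] by (simp add: local_rep_def \<gamma>_def)
      also have "\<dots> = tangent_norm G c (z t) w"
        using manifold dom[OF t c1(2)] c(1) c1(1)
        unfolding riemannian_manifold_def riemannian_metric_def tangent_norm_def by metis
      also have "\<dots> \<le> 2 * tangent_norm G c ?z w" by (rule r(3)[OF z_ball[OF t]])
      finally show ?thesis .
    qed
    have "curve_length A G \<gamma> \<le> 2 * tangent_norm G c ?z w"
    proof (cases "curve_speed A G \<gamma> integrable_on {0..1}")
      case True
      then have "curve_length A G \<gamma> \<le> integral {0..1} (\<lambda>t::real. 2 * tangent_norm G c ?z w)"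
        unfolding curve_length_def using speed by (intro integral_le) auto
      then show ?thesis by simp
    next
      case False
      then show ?thesis
        unfolding curve_length_def using tangent_norm_nonneg[OF c(1) zi] by (simp add: not_integrable_integral)
    qed
    moreover have "\<gamma> 0 = x" "\<gamma> 1 = y" using c elim by (auto simp: \<gamma>_def z_def w_def)
    moreover have "0 \<le> riem_dist A G x y"
      unfolding riem_dist_def
    proof (rule cInf_greatest)
      show "{curve_length A G \<gamma>' |\<gamma>'. piecewise_C1_curve A \<gamma>' \<and> \<gamma>' 0 = x \<and> \<gamma>' 1 = y} \<noteq> {}"
        using pw \<open>\<gamma> 0 = x\<close> \<open>\<gamma> 1 = y\<close> by blast
    qed (use curve_length_nonneg in auto)
    ultimately show ?case
      using riem_dist_le_curve_length[OF pw] by (auto simp: w_def)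
  qed
qed

text \<open>
  By compactness \<open>\<phi>\<close> has a positive minimum \<open>p\<close>, and the logarithm is Lipschitz with constant \<open>1 / p\<close>
  above \<open>p\<close>.
\<close>

lemma lipschitz_density_in_log_lipschitz:
  assumes \<phi>: "\<phi> \<in> lipschitz_densities A G m"
  obtains K where "K \<ge> 0" "\<phi> \<in> log_lipschitz A G K"
proof -
  obtain L where L: "\<And>x y. \<bar>\<phi> x - \<phi> y\<bar> \<le> L * riem_dist A G x y" and pos: "\<And>x. \<phi> x > 0"
    using \<phi> by (auto simp: lipschitz_densities_def)
  have slope: "\<forall>\<^sub>F y in nhds x. \<bar>\<phi> y - \<phi> x\<bar>
    \<le> 2 * \<bar>L\<bar> * tangent_norm G c (chart_map c x) (chart_map c y - chart_map c x)"
    if c: "c \<in> A" "x \<in> chart_dom c" for c x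
    using riem_dist_le_in_chart[OF c]
  proof eventually_elim
    case (elim y)
    have "\<bar>\<phi> y - \<phi> x\<bar> \<le> L * riem_dist A G x y" using L[of x y] by (simp add: abs_minus_commute)
    also have "\<dots> \<le> \<bar>L\<bar> * riem_dist A G x y" using elim by (intro mult_right_mono) auto
    also have "\<dots> \<le> \<bar>L\<bar> * (2 * tangent_norm G c (chart_map c x) (chart_map c y - chart_map c x))"
      using elim by (intro mult_left_mono) auto
    finally show ?case by (simp add: mult_ac)
  qed
  have "continuous_on UNIV \<phi>"
  proof (rule continuous_on_UNIV_if_tendsto_nhds)
    fix x
    obtain c where c: "c \<in> A" "x \<in> chart_dom c" by (rule chart_at)
    show "(\<phi> \<longlongrightarrow> \<phi> x) (nhds x)"
      by (rule tendsto_if_abs_diff_le_tangent_norm[OF c slope[OF c]])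
  qed
  then obtain x0 where x0: "\<And>x. \<phi> x0 \<le> \<phi> x"
    using continuous_attains_inf[OF compact_M, of \<phi>] by auto
  define p where "p = \<phi> x0"
  have p: "p > 0" "\<And>x. p \<le> \<phi> x" using pos x0 by (auto simp: p_def)
  have ln_le: "\<bar>ln a - ln b\<bar> \<le> \<bar>a - b\<bar> / p" if ab: "a \<ge> p" "b \<ge> p" for a b
  proof -
    have *: "ln a - ln b \<le> \<bar>a - b\<bar> / p" if ab: "a \<ge> p" "b \<ge> p" for a b
    proof -
      have "ln a - ln b = ln (a / b)" using ab p by (simp add: ln_div)
      also have "\<dots> \<le> a / b - 1" using ab p by (intro ln_le_minus_one) auto
      also have "\<dots> = (a - b) / b" using ab p by (simp add: field_simps)
      also have "\<dots> \<le> \<bar>a - b\<bar> / b" using ab p by (intro divide_right_mono) auto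
      also have "\<dots> \<le> \<bar>a - b\<bar> / p" using ab p by (intro divide_left_mono) auto
      finally show ?thesis .
    qed
    show ?thesis using *[of a b] *[of b a] ab by (simp add: abs_minus_commute abs_le_iff)
  qed
  show thesis
  proof (rule that[of "2 * \<bar>L\<bar> / p"])
    show "\<phi> \<in> log_lipschitz A G (2 * \<bar>L\<bar> / p)"
      unfolding log_lipschitz_def
    proof (intro CollectI conjI allI ballI impI pos)
      fix c x and e :: real assume c: "c \<in> A" "x \<in> chart_dom c" and e: "e > 0"
      show "\<forall>\<^sub>F y in nhds x. \<bar>ln (\<phi> y) - ln (\<phi> x)\<bar>
        \<le> (2 * \<bar>L\<bar> / p + e) * tangent_norm G c (chart_map c x) (chart_map c y - chart_map c x)"
        using slope[OF c]
      proof eventually_elim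
        case (elim y)
        let ?N = "tangent_norm G c (chart_map c x) (chart_map c y - chart_map c x)"
        have N: "?N \<ge> 0" using c by (intro tangent_norm_nonneg) auto
        have "\<bar>ln (\<phi> y) - ln (\<phi> x)\<bar> \<le> \<bar>\<phi> y - \<phi> x\<bar> / p" using p by (intro ln_le) auto
        also have "\<dots> \<le> 2 * \<bar>L\<bar> * ?N / p" using elim p by (intro divide_right_mono) auto
        also have "\<dots> \<le> (2 * \<bar>L\<bar> / p + e) * ?N" using N e by (simp add: algebra_simps)
        finally show ?case .
      qed
    qed
  qed (use p in simp)
qed

end

section \<open>Integration in charts\<close>

text \<open>
  The hypothesis \<open>eq\<close> identifies the restriction of \<open>N\<close> to \<open>E\<close> with the image of the weighted measure
  \<open>w M\<close> under \<open>\<phi>\<close>. Both charts and diffeomorphisms of Euclidean space are instances.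
\<close>

lemma nn_integral_transport:
  fixes \<phi> :: "'x::topological_space \<Rightarrow> 'y::topological_space"
  assumes sets: "sets M = sets borel" "sets N = sets borel"
    and D: "D \<in> sets borel" and E: "E \<in> sets borel"
    and cont: "continuous_on D \<phi>" and img: "\<phi> ` D \<subseteq> E"
    and w: "(\<lambda>x. w x * indicator D x) \<in> borel_measurable borel"
    and eq: "\<And>B. B \<in> sets borel \<Longrightarrow> B \<subseteq> E \<Longrightarrow>
      emeasure N B = (\<integral>\<^sup>+x. w x * indicator (D \<inter> \<phi> -` B) x \<partial>M)"
    and h: "(\<lambda>y. h y * indicator E y) \<in> borel_measurable borel"
  shows "(\<integral>\<^sup>+y. h y * indicator E y \<partial>N) = (\<integral>\<^sup>+x. h (\<phi> x) * (w x * indicator D x) \<partial>M)"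
proof -
  have mM: "(borel_measurable M :: ('x \<Rightarrow> ennreal) set) = borel_measurable borel"
    and mN: "(borel_measurable N :: ('y \<Rightarrow> ennreal) set) = borel_measurable borel"
    using sets by (auto intro: measurable_cong_sets)
  define \<phi>' where "\<phi>' x = (if x \<in> D then \<phi> x else undefined)" for x
  have pre: "D \<inter> \<phi> -` B \<in> sets borel" if "B \<in> sets borel" for B
  proof -
    have "\<phi> -` B \<inter> space (restrict_space borel D) \<in> sets (restrict_space borel D)"
      by (rule measurable_sets[OF borel_measurable_continuous_on_restrict[OF cont] that])
    then show ?thesis using D by (simp add: sets_restrict_space_iff space_restrict_space Int_commute)
  qed
  have \<phi>': "\<phi>' \<in> M \<rightarrow>\<^sub>M borel"
  proof (rule measurableI)
    fix B :: "'y set" assume B: "B \<in> sets borel"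
    have "\<phi>' -` B \<inter> space M = (D \<inter> \<phi> -` B) \<union> (if undefined \<in> B then - D else {})"
      using sets_eq_imp_space_eq[OF sets(1)] by (auto simp: \<phi>'_def split: if_splits)
    then show "\<phi>' -` B \<inter> space M \<in> sets M" using pre[OF B] D sets by auto
  qed simp
  define M' where "M' = density M (\<lambda>x. w x * indicator D x)"
  have wM: "(\<lambda>x. w x * indicator D x) \<in> borel_measurable M" using w mM by simp
  have eqM: "distr M' borel \<phi>' = density N (indicator E)"
  proof (rule measure_eqI)
    fix B assume "B \<in> sets (distr M' borel \<phi>')"
    then have B: "B \<in> sets borel" by simp
    have "emeasure (distr M' borel \<phi>') B = emeasure M' (\<phi>' -` B \<inter> space M)"
      using \<phi>' B by (subst emeasure_distr) (auto simp: M'_def)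
    also have "\<dots> = (\<integral>\<^sup>+x. (w x * indicator D x) * indicator (\<phi>' -` B \<inter> space M) x \<partial>M)"
      unfolding M'_def using wM measurable_sets[OF \<phi>' B] by (rule emeasure_density)
    also have "\<dots> = (\<integral>\<^sup>+x. w x * indicator (D \<inter> \<phi> -` (B \<inter> E)) x \<partial>M)"
      using img by (intro nn_integral_cong) (auto simp: indicator_def \<phi>'_def)
    also have "\<dots> = emeasure N (B \<inter> E)" using eq[of "B \<inter> E"] B E by simp
    also have "\<dots> = emeasure (density N (indicator E)) B"
      using B E sets by (subst emeasure_restricted) (auto simp: Int_commute)
    finally show "emeasure (distr M' borel \<phi>') B = emeasure (density N (indicator E)) B" .
  qed (use sets in auto)
  have "(\<integral>\<^sup>+y. h y * indicator E y \<partial>N) = (\<integral>\<^sup>+y. indicator E y * (h y * indicator E y) \<partial>N)"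
    by (intro nn_integral_cong) (auto simp: indicator_def)
  also have "\<dots> = (\<integral>\<^sup>+y. h y * indicator E y \<partial>density N (indicator E))"
    using h E sets mN by (subst nn_integral_density) auto
  also have "\<dots> = (\<integral>\<^sup>+y. h y * indicator E y \<partial>distr M' borel \<phi>')" by (simp only: eqM)
  also have "\<dots> = (\<integral>\<^sup>+x. h (\<phi>' x) * indicator E (\<phi>' x) \<partial>M')"
    using \<phi>' h by (subst nn_integral_distr) (auto simp: M'_def)
  also have "\<dots> = (\<integral>\<^sup>+x. (w x * indicator D x) * (h (\<phi>' x) * indicator E (\<phi>' x)) \<partial>M)"
    unfolding M'_def using wM measurable_compose[OF \<phi>' h] by (rule nn_integral_density)
  also have "\<dots> = (\<integral>\<^sup>+x. h (\<phi> x) * (w x * indicator D x) \<partial>M)"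
    using img by (intro nn_integral_cong) (auto simp: indicator_def \<phi>'_def mult_ac)
  finally show ?thesis .
qed

lemma borel_measurable_continuous_on_times_indicator:
  fixes h :: "'x::topological_space \<Rightarrow> real"
  assumes "D \<in> sets borel" "continuous_on D h"
  shows "(\<lambda>x. ennreal (h x) * indicator D x) \<in> borel_measurable borel"
proof -
  have "(\<lambda>x. indicator D x *\<^sub>R h x) \<in> borel_measurable borel"
    by (rule borel_measurable_continuous_on_indicator[OF assms])
  then have "(\<lambda>x. ennreal (indicator D x *\<^sub>R h x)) \<in> borel_measurable borel" by measurable
  also have "(\<lambda>x. ennreal (indicator D x *\<^sub>R h x)) = (\<lambda>x. ennreal (h x) * indicator D x)"
    by (auto simp: indicator_def)
  finally show ?thesis .
qed

lemma nn_integral_diffeomorphism: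
  fixes F :: "real ^ 'n::finite \<Rightarrow> real ^ 'n"
  assumes D: "open D" and E: "open E" "bounded E" and hom: "homeomorphism D E F g"
    and der: "\<And>z. z \<in> D \<Longrightarrow> (F has_derivative F' z) (at z)"
    and cont: "continuous_on D (\<lambda>z. det (matrix (F' z)))"
    and h: "(\<lambda>y. h y * indicator E y) \<in> borel_measurable borel"
  shows "(\<integral>\<^sup>+y. h y * indicator E y \<partial>lborel)
    = (\<integral>\<^sup>+z. h (F z) * (ennreal \<bar>det (matrix (F' z))\<bar> * indicator D z) \<partial>lborel)"
proof (rule nn_integral_transport)
  have cF: "continuous_on D F" and cg: "continuous_on E g" and img: "F ` D = E"
    and gF: "\<And>z. z \<in> D \<Longrightarrow> g (F z) = z"
    and Fg: "\<And>y. y \<in> E \<Longrightarrow> F (g y) = y" "\<And>y. y \<in> E \<Longrightarrow> g y \<in> D"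
    using hom by (auto simp: homeomorphism_def)
  show "continuous_on D F" "F ` D \<subseteq> E" using cF img by auto
  show w: "(\<lambda>x. ennreal \<bar>det (matrix (F' x))\<bar> * indicator D x) \<in> borel_measurable borel"
    using D cont by (intro borel_measurable_continuous_on_times_indicator continuous_intros) auto
  fix B :: "(real ^ 'n) set" assume B: "B \<in> sets borel" "B \<subseteq> E"
  let ?C = "D \<inter> F -` B"
  have "F -` B \<inter> space (restrict_space borel D) \<in> sets (restrict_space borel D)"
    by (rule measurable_sets[OF borel_measurable_continuous_on_restrict[OF cF] B(1)])
  then have C: "?C \<in> sets borel" using D by (simp add: sets_restrict_space_iff space_restrict_space Int_commute)
  have FC: "F ` ?C = B" using B(2) img by auto
  have "(\<lambda>x. (ennreal \<bar>det (matrix (F' x))\<bar> * indicator D x) * indicator ?C x) \<in> borel_measurable borel"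
    using w C by measurable
  also have "(\<lambda>x. (ennreal \<bar>det (matrix (F' x))\<bar> * indicator D x) * indicator ?C x)
      = (\<lambda>x. ennreal \<bar>det (matrix (F' x))\<bar> * indicator ?C x)"
    by (auto simp: indicator_def)
  finally have meas: "(\<lambda>x. ennreal \<bar>det (matrix (F' x))\<bar> * indicator ?C x) \<in> borel_measurable borel" .
  have "emeasure lborel (F ` ?C) = (\<integral>\<^sup>+x. ennreal \<bar>det (matrix (F' x))\<bar> * indicator ?C x \<partial>lborel)"
  proof (rule emeasure_diffeomorphic_image[OF C])
    show "F ` ?C \<in> sets borel" "bounded (F ` ?C)"
      unfolding FC using B E(2) bounded_subset by auto
    show "inj_on F ?C" using gF by (metis Int_iff inj_onI)
  qed (use der meas in auto)
  then show "emeasure lborel B = (\<integral>\<^sup>+x. ennreal \<bar>det (matrix (F' x))\<bar> * indicator ?C x \<partial>lborel)"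
    by (simp only: FC)
qed (use D E h in auto)

context compact_riemannian begin

lemma sets_m: "sets m = sets borel"
  using volume by (simp add: riemannian_volume_def)

lemma prob_space_m: "prob_space m"
  using volume_1 sets_eq_imp_space_eq[OF sets_m] by (intro prob_spaceI) simp

lemma continuous_on_sqrt_det_metric:
  assumes "c \<in> A"
  shows "continuous_on (chart_img c) (\<lambda>z. sqrt (det (G c z)))"
  unfolding det_def using continuous_on_metric[OF assms]
  by (intro continuous_intros)

lemma nn_integral_volume_in_chart:
  assumes c: "c \<in> A" and h: "(\<lambda>y. h y * indicator (chart_dom c) y) \<in> borel_measurable borel"
  shows "(\<integral>\<^sup>+y. h y * indicator (chart_dom c) y \<partial>m)
    = (\<integral>\<^sup>+z. h (chart_inv c z) * (ennreal (sqrt (det (G c z))) * indicator (chart_img c) z) \<partial>lborel)"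
proof (rule nn_integral_transport)
  show "(\<lambda>z. ennreal (sqrt (det (G c z))) * indicator (chart_img c) z) \<in> borel_measurable borel"
    using open_chart_img[OF c] continuous_on_sqrt_det_metric[OF c]
    by (intro borel_measurable_continuous_on_times_indicator) auto
  fix B :: "'a set" assume B: "B \<in> sets borel" "B \<subseteq> chart_dom c"
  have "chart_map c ` B = chart_img c \<inter> chart_inv c -` B"
  proof
    show "chart_map c ` B \<subseteq> chart_img c \<inter> chart_inv c -` B" using B(2) c by auto
    show "chart_img c \<inter> chart_inv c -` B \<subseteq> chart_map c ` B"
      using c by (auto simp: image_iff)
  qed
  moreover have "emeasure m B = (\<integral>\<^sup>+z \<in> chart_map c ` B. ennreal (sqrt (det (G c z))) \<partial>lborel)"
    using volume B c unfolding riemannian_volume_def by blast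
  ultimately show "emeasure m B =
      (\<integral>\<^sup>+z. ennreal (sqrt (det (G c z))) * indicator (chart_img c \<inter> chart_inv c -` B) z \<partial>lborel)"
    by simp
next
  show "chart_img c \<in> sets borel" "chart_dom c \<in> sets borel"
    by (rule borel_open open_chart_img[OF c] open_chart_dom[OF c])+
  show "chart_inv c ` chart_img c \<subseteq> chart_dom c" using chart_inv_in_dom[OF c] by (rule image_subsetI)
qed (rule sets_lborel sets_m continuous_on_chart_inv[OF c] h)+

lemma volume_open_pos:
  assumes T: "open T" "x \<in> T"
  shows "emeasure m T > 0"
proof -
  obtain c where c: "c \<in> A" "x \<in> chart_dom c" by (rule chart_at)
  let ?D = "chart_img c \<inter> chart_inv c -` T"
  have op: "open ?D"
    using continuous_on_open_vimage[OF open_chart_img[OF c(1)]] continuous_on_chart_inv[OF c(1)] T(1)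
    by (metis Int_commute)
  have "chart_map c x \<in> ?D" using c T(2) by auto
  then have pos: "emeasure lborel ?D > 0"
  proof -
    have "\<not> negligible ?D" using \<open>chart_map c x \<in> ?D\<close> open_not_negligible[OF op] by blast
    moreover have "?D \<in> sets lborel" using op by simp
    then have "?D \<in> sets lebesgue" "emeasure lebesgue ?D = emeasure lborel ?D" by simp_all
    ultimately show ?thesis using negligible_iff_emeasure0[of ?D] by (simp add: zero_less_iff_neq_zero)
  qed
  have meas: "(\<lambda>z. ennreal (sqrt (det (G c z))) * indicator ?D z) \<in> borel_measurable borel"
    using op continuous_on_subset[OF continuous_on_sqrt_det_metric[OF c(1)]]
    by (intro borel_measurable_continuous_on_times_indicator) auto
  have "(\<integral>\<^sup>+z. ennreal (sqrt (det (G c z))) * indicator ?D z \<partial>lborel) \<noteq> 0"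
  proof
    assume "(\<integral>\<^sup>+z. ennreal (sqrt (det (G c z))) * indicator ?D z \<partial>lborel) = 0"
    then have "AE z in lborel. ennreal (sqrt (det (G c z))) * indicator ?D z = 0"
      using meas by (subst (asm) nn_integral_0_iff_AE) auto
    then have "AE z in lborel. z \<notin> ?D"
    proof (rule eventually_mono)
      fix z assume *: "ennreal (sqrt (det (G c z))) * indicator ?D z = 0"
      show "z \<notin> ?D"
      proof
        assume z: "z \<in> ?D"
        then have "ennreal (sqrt (det (G c z))) > 0" using det_metric_pos[OF c(1), of z] by simp
        with * z show False by simp
      qed
    qed
    then have "emeasure lborel ?D = 0"
      using op by (subst (asm) AE_iff_measurable[of ?D]) auto
    with pos show False by simp
  qed
  moreover have "(\<integral>\<^sup>+z. ennreal (sqrt (det (G c z))) * indicator ?D z \<partial>lborel)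
      = (\<integral>\<^sup>+z. indicator T (chart_inv c z) * (ennreal (sqrt (det (G c z))) * indicator (chart_img c) z) \<partial>lborel)"
    by (intro nn_integral_cong) (auto simp: indicator_def)
  moreover have "\<dots> = (\<integral>\<^sup>+y. indicator T y * indicator (chart_dom c) y \<partial>m)"
    using T open_chart_dom[OF c(1)] by (intro nn_integral_volume_in_chart[OF c(1), symmetric]) auto
  moreover have "\<dots> = emeasure m (T \<inter> chart_dom c)"
    using T(1) open_chart_dom[OF c(1)] sets_m
    by (simp flip: indicator_inter_arith add: indicator_inter_arith[symmetric] mult.commute)
  ultimately have "emeasure m (T \<inter> chart_dom c) > 0" by (simp add: zero_less_iff_neq_zero)
  also have "emeasure m (T \<inter> chart_dom c) \<le> emeasure m T"
    using T(1) sets_m by (intro emeasure_mono) auto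
  finally show ?thesis .
qed

end

section \<open>Distortion of the Jacobian\<close>

lemma matrix_mult_linear: "linear f \<Longrightarrow> matrix f *v v = f v" for f :: "real ^ 'n::finite \<Rightarrow> real ^ 'k::finite"
  using matrix_works[of f v] by (simp add: linear_def scalar_mult_eq_scaleR[abs_def])

lemma matrix_matrix_mult_diff_right: "A ** (B - C) = A ** B - A ** C"
  for A :: "real ^ 'n::finite ^ 'm::finite"
  by (simp add: matrix_matrix_mult_def vec_eq_iff algebra_simps sum_subtractf)

lemma matrix_has_derivative:
  fixes L :: "'b::real_normed_vector \<Rightarrow> real ^ 'n::finite \<Rightarrow> real ^ 'n"
  assumes "\<And>j. ((\<lambda>z. L z (axis j 1)) has_derivative L' j) (at z0)"
  shows "((\<lambda>z. matrix (L z)) has_derivative (\<lambda>u. \<chi> i j. L' j u $ i)) (at z0)"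
proof -
  define P where "P j w = (\<chi> i k. if k = j then w $ i else 0)" for j :: 'n and w :: "real ^ 'n"
  have P: "bounded_linear (P j)" for j
    unfolding linear_conv_bounded_linear[symmetric] linear_iff
    by (auto simp: P_def vec_eq_iff)
  have eq: "(\<Sum>j\<in>UNIV. P j (w j)) = (\<chi> i j. w j $ i)" for w
    by (simp add: P_def vec_eq_iff sum.delta)
  have "((\<lambda>z. \<Sum>j\<in>UNIV. P j (L z (axis j 1))) has_derivative (\<lambda>u. \<Sum>j\<in>UNIV. P j (L' j u))) (at z0)"
    by (intro has_derivative_sum bounded_linear.has_derivative[OF P] assms)
  then show ?thesis by (simp only: eq matrix_def)
qed

lemma slope_le_if_has_derivative:
  fixes h :: "real ^ 'n::finite \<Rightarrow> real" and q :: "real ^ 'n \<Rightarrow> real"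
  assumes der: "(h has_derivative h') (at z0)" and bd: "\<And>u. \<bar>h' u\<bar> \<le> B * q u"
    and a: "a > 0" "\<And>v. a * norm v \<le> q v" and e: "e > 0"
  shows "\<forall>\<^sub>F z in nhds z0. \<bar>h z - h z0\<bar> \<le> (B + e) * q (z - z0)"
proof -
  obtain d where d: "d > 0" "\<And>z. norm (z - z0) < d \<Longrightarrow> norm (h z - h z0 - h' (z - z0)) \<le> e * a * norm (z - z0)"
    using der a(1) e unfolding has_derivative_at_alt by (metis mult_pos_pos)
  have "\<bar>h z - h z0\<bar> \<le> (B + e) * q (z - z0)" if "dist z z0 < d" for z
  proof -
    have "\<bar>h z - h z0\<bar> \<le> \<bar>h' (z - z0)\<bar> + e * (a * norm (z - z0))"
      using d(2)[of z] that by (simp add: dist_norm mult.assoc)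
    also have "\<dots> \<le> B * q (z - z0) + e * q (z - z0)"
      using a e by (intro add_mono bd mult_left_mono) auto
    finally show ?thesis by (simp add: algebra_simps)
  qed
  then show ?thesis using d(1) unfolding eventually_nhds_metric by blast
qed

lemma invertible_matrix_inv:
  fixes B :: "real ^ 'n::finite ^ 'n"
  assumes "invertible B"
  shows "B ** matrix_inv B = mat 1" "matrix_inv B ** B = mat 1"
  using someI_ex[OF assms[unfolded invertible_def]] by (simp_all add: matrix_inv_def)

context compact_riemannian begin

lemma linear_connection_term: "linear (connection_term G c z u)"
  by (auto simp: linear_iff connection_term_def vec_eq_iff algebra_simps sum.distrib sum_distrib_left)

text \<open>
  In the contracted Christoffel symbol, two of the three derivatives of the metric cancel by the
  symmetry of the inverse metric. The third gives half of the logarithmic derivative of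
  \<open>det (G c z)\<close>.
\<close>

lemma trace_connection_term:
  assumes c: "c \<in> A" "z \<in> chart_img c"
  shows "trace (matrix (connection_term G c z u))
    = 1/2 * trace (matrix_inv (G c z) ** frechet_derivative (G c) (at z) u)"
proof -
  let ?I = "matrix_inv (G c z)"
  let ?dG = "\<lambda>l. frechet_derivative (G c) (at z) (axis l 1)"
  have I: "?I ** G c z = mat 1" "G c z ** ?I = mat 1"
    using det_metric_pos[OF c] by (simp_all add: invertible_matrix_inv invertible_det_nz)
  have "transpose ?I ** G c z = transpose (G c z ** ?I)"
    by (simp add: matrix_transpose_mul metric_sym[OF c])
  then have "transpose ?I ** G c z = mat 1" by (simp add: I transpose_mat)
  then have "(transpose ?I ** G c z) ** ?I = ?I" by simp
  then have tr: "transpose ?I = ?I" unfolding matrix_mul_assoc[symmetric] I(2) matrix_mul_rid .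
  have sym: "?I $ k $ l = ?I $ l $ k" for k l 
  proof -
    have "transpose ?I $ l $ k = ?I $ k $ l" by (simp add: transpose_def)
    then show ?thesis by (simp only: tr)
  qed
  have lin: "linear (frechet_derivative (G c) (at z))"
    using metric_differentiable[OF c] by (rule linear_frechet_derivative)
  have dGu: "frechet_derivative (G c) (at z) u = (\<Sum>i\<in>UNIV. u $ i *\<^sub>R ?dG i)"
  proof -
    have "u = (\<Sum>i\<in>UNIV. u $ i *\<^sub>R axis i 1)"
      by (metis (no_types) basis_expansion scalar_mult_eq_scaleR sum.cong)
    then have "frechet_derivative (G c) (at z) u = frechet_derivative (G c) (at z) (\<Sum>i\<in>UNIV. u $ i *\<^sub>R axis i 1)"
      by simp
    then show ?thesis by (simp add: linear_sum[OF lin] linear_scale[OF lin])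
  qed
  have chr: "(\<Sum>k\<in>UNIV. christoffel G c z k i k) = 1/2 * (\<Sum>k\<in>UNIV. \<Sum>l\<in>UNIV. ?I $ k $ l * ?dG i $ l $ k)" for i
  proof -
    have "(\<Sum>k\<in>UNIV. \<Sum>l\<in>UNIV. ?I $ k $ l * ?dG k $ i $ l) = (\<Sum>k\<in>UNIV. \<Sum>l\<in>UNIV. ?I $ k $ l * ?dG l $ i $ k)"
      by (subst sum.swap) (simp add: sym)
    moreover have "(\<Sum>k\<in>UNIV. \<Sum>l\<in>UNIV. ?I $ k $ l * ?dG i $ k $ l) = (\<Sum>k\<in>UNIV. \<Sum>l\<in>UNIV. ?I $ k $ l * ?dG i $ l $ k)"
      by (subst sum.swap) (simp add: sym)
    ultimately show ?thesis
      by (simp add: christoffel_def Let_def algebra_simps sum.distrib sum_subtractf sum_divide_distrib[symmetric])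
  qed
  have "trace (matrix (connection_term G c z u)) = (\<Sum>k\<in>UNIV. \<Sum>i\<in>UNIV. christoffel G c z k i k * u $ i)"
    by (simp add: trace_def matrix_def connection_term_def axis_def if_distrib[where f = "\<lambda>x. _ * x"] sum.delta cong: if_cong)
  also have "\<dots> = (\<Sum>i\<in>UNIV. u $ i * (\<Sum>k\<in>UNIV. christoffel G c z k i k))"
    by (subst sum.swap) (simp add: sum_distrib_left mult.commute)
  also have "\<dots> = (\<Sum>i\<in>UNIV. u $ i * (1/2 * (\<Sum>k\<in>UNIV. \<Sum>l\<in>UNIV. ?I $ k $ l * ?dG i $ l $ k)))"
    by (simp only: chr)
  also have "\<dots> = 1/2 * (\<Sum>k\<in>UNIV. \<Sum>l\<in>UNIV. ?I $ k $ l * (\<Sum>i\<in>UNIV. u $ i * ?dG i $ l $ k))"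
  proof -
    let ?t = "\<lambda>i k l. 1/2 * (?I $ k $ l * (u $ i * ?dG i $ l $ k))"
    have "(\<Sum>i\<in>UNIV. u $ i * (1/2 * (\<Sum>k\<in>UNIV. \<Sum>l\<in>UNIV. ?I $ k $ l * ?dG i $ l $ k)))
        = (\<Sum>i\<in>UNIV. \<Sum>k\<in>UNIV. \<Sum>l\<in>UNIV. ?t i k l)"
      by (simp only: sum_distrib_left mult_ac)
    also have "\<dots> = (\<Sum>k\<in>UNIV. \<Sum>i\<in>UNIV. \<Sum>l\<in>UNIV. ?t i k l)" by (rule sum.swap)
    also have "\<dots> = (\<Sum>k\<in>UNIV. \<Sum>l\<in>UNIV. \<Sum>i\<in>UNIV. ?t i k l)" by (intro sum.cong refl sum.swap)
    also have "\<dots> = 1/2 * (\<Sum>k\<in>UNIV. \<Sum>l\<in>UNIV. ?I $ k $ l * (\<Sum>i\<in>UNIV. u $ i * ?dG i $ l $ k))"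
      by (simp only: sum_distrib_left)
    finally show ?thesis .
  qed
  also have "\<dots> = 1/2 * trace (?I ** frechet_derivative (G c) (at z) u)"
    by (simp add: trace_def matrix_matrix_mult_def dGu sum_component)
  finally show ?thesis .
qed

end

locale expanding_map = compact_riemannian A G m
  for A :: "('a::t2_space, 'n::finite) chart set" and G m +
  fixes l \<Gamma> :: real and f :: "'a \<Rightarrow> 'a"
  assumes l: "l > 0" and \<Gamma>: "\<Gamma> > 0" and expanding: "f \<in> expanding_maps A G l \<Gamma>"
begin

lemma continuous_f: "continuous_on UNIV f"
  using expanding by (simp add: expanding_maps_def C2_map_def)

context
  fixes c c' z
  assumes c: "c \<in> A" "c' \<in> A" and z: "z \<in> local_dom c c' f"
begin

lemma local_dom_img: "z \<in> chart_img c"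
  using z by (auto simp: local_dom_eq[OF c(1)])

lemma local_rep_img: "local_rep c c' f z \<in> chart_img c'"
  using z by (auto simp: local_dom_eq[OF c(1)] local_rep_def)

lemma open_local_dom_f: "open (local_dom c c' f)"
  by (rule open_local_dom[OF c continuous_f])

lemma Ck_local_rep: "Ck_on (Suc (Suc 0)) (local_dom c c' f) (local_rep c c' f)"
  using expanding c unfolding expanding_maps_def C2_map_def numeral_2_eq_2 by blast

lemma local_rep_has_derivative: "(local_rep c c' f has_derivative tangent_map c c' f z) (at z)"
  using Ck_local_rep z unfolding tangent_map_def Ck_on.simps frechet_derivative_works[symmetric] by blast

lemma linear_tangent_map: "linear (tangent_map c c' f z)"
  using local_rep_has_derivative has_derivative_linear by blast

lemma tangent_map_differentiable: "(\<lambda>y. tangent_map c c' f y v) differentiable (at z)"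
  using Ck_local_rep z unfolding tangent_map_def by (auto simp del: split_paired_All)

lemma tangent_map_expands:
  "l * tangent_norm G c z v \<le> tangent_norm G c' (local_rep c c' f z) (tangent_map c c' f z v)"
  using expanding c z unfolding expanding_maps_def by blast

lemma second_deriv_bound:
  assumes "tangent_norm G c z u \<le> 1" "tangent_norm G c z v \<le> 1"
  shows "tangent_norm G c' (local_rep c c' f z) (second_deriv G c c' f z u v) \<le> \<Gamma>"
proof -
  let ?X = "{ereal (tangent_norm G c' (local_rep c c' f x) (second_deriv G c c' f x u v)) | c c' x u v.
        c \<in> A \<and> c' \<in> A \<and> x \<in> local_dom c c' f \<and>
        tangent_norm G c x u \<le> 1 \<and> tangent_norm G c x v \<le> 1}"
  have "ereal (tangent_norm G c' (local_rep c c' f z) (second_deriv G c c' f z u v)) \<in> ?X"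
    using assms c z by blast
  then have "ereal (tangent_norm G c' (local_rep c c' f z) (second_deriv G c c' f z u v)) \<le> Sup ?X"
    by (rule Sup_upper)
  also have "Sup ?X \<le> C2_norm A G f" unfolding C2_norm_def by (rule max.cobounded2)
  also have "\<dots> \<le> ereal \<Gamma>" using expanding by (simp add: expanding_maps_def)
  finally show ?thesis by simp
qed

end

context
  fixes c c' z
  assumes c: "c \<in> A" "c' \<in> A" and z: "z \<in> local_dom c c' f"
begin

definition "Df = matrix (tangent_map c c' f z)"

definition "D2f u = (\<chi> i j. frechet_derivative (\<lambda>y. tangent_map c c' f y (axis j 1)) (at z) u $ i)"

lemma Df_mult: "Df *v v = tangent_map c c' f z v"
  unfolding Df_def by (rule matrix_mult_linear[OF linear_tangent_map[OF c z]])

lemma Df_inv: "matrix_inv Df ** Df = mat 1" "Df ** matrix_inv Df = mat 1"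
proof -
  have "v = 0" if "Df *v v = 0" for v
  proof (rule ccontr)
    assume "v \<noteq> 0"
    then have "v \<bullet> (G c z *v v) > 0" using metric_pos[OF c(1) local_dom_img[OF c z]] by blast
    then have "tangent_norm G c z v > 0" by (simp add: tangent_norm_def tangent_inner_def)
    then have "l * tangent_norm G c z v > 0" using l by simp
    with tangent_map_expands[OF c z, of v] that show False by (simp add: Df_mult)
  qed
  then have "invertible Df"
    using invertible_left_inverse matrix_left_invertible_ker by blast
  then show "matrix_inv Df ** Df = mat 1" "Df ** matrix_inv Df = mat 1"
    by (simp_all add: invertible_matrix_inv)
qed

lemma Df_has_derivative: "((\<lambda>y. matrix (tangent_map c c' f y)) has_derivative D2f) (at z)"
  unfolding D2f_def
  by (rule matrix_has_derivative) (use tangent_map_differentiable[OF c z] frechet_derivative_works in blast)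

text \<open>
  The covariant second derivative in direction \<open>u\<close> as a matrix, so that its trace can be compared
  with the logarithmic derivative of the Jacobian.
\<close>

lemma second_deriv_eq_matrix:
  "second_deriv G c c' f z u v =
     (D2f u - Df ** matrix (connection_term G c z u)
      + matrix (connection_term G c' (local_rep c c' f z) (tangent_map c c' f z u)) ** Df) *v v"
proof -
  let ?C = "connection_term G c z u"
  let ?C' = "connection_term G c' (local_rep c c' f z) (tangent_map c c' f z u)"
  have "((\<lambda>y. matrix (tangent_map c c' f y) *v v) has_derivative (\<lambda>u. D2f u *v v)) (at z)"
  proof -
    have "bounded_linear (\<lambda>B. B *v v)" for v :: "real ^ 'n"
      unfolding linear_conv_bounded_linear[symmetric] linear_iff
      by (auto simp: matrix_vector_mult_add_rdistrib scaleR_matrix_vector_assoc)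
    from bounded_linear.has_derivative[OF this Df_has_derivative] show ?thesis .
  qed
  then have "((\<lambda>y. tangent_map c c' f y v) has_derivative (\<lambda>u. D2f u *v v)) (at z)"
  proof (rule has_derivative_transform_within_open[OF _ open_local_dom_f[OF c z] z])
    fix y assume "y \<in> local_dom c c' f"
    then show "matrix (tangent_map c c' f y) *v v = tangent_map c c' f y v"
      by (intro matrix_mult_linear linear_tangent_map[OF c])
  qed
  then have "frechet_derivative (\<lambda>y. tangent_map c c' f y v) (at z) u = D2f u *v v"
    by (metis frechet_derivative_at)
  moreover have "tangent_map c c' f z (?C v) = (Df ** matrix ?C) *v v"
    by (simp add: Df_mult[symmetric] matrix_mult_linear[OF linear_connection_term] matrix_vector_mul_assoc[symmetric])
  moreover have "?C' (tangent_map c c' f z v) = (matrix ?C' ** Df) *v v"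
    by (simp add: matrix_vector_mul_assoc[symmetric] Df_mult matrix_mult_linear[OF linear_connection_term])
  ultimately show ?thesis
    by (simp add: second_deriv_def matrix_vector_mult_add_rdistrib matrix_vector_mult_diff_rdistrib)
qed

text \<open>
  The derivative in direction \<open>u\<close> of the logarithm of the Riemannian Jacobian is the trace of the
  inverse of \<open>Df\<close> composed with the covariant second derivative in direction \<open>u\<close>: Jacobi's formula
  yields the trace for the coordinate derivative \<open>D2f u\<close>, and the two metric determinants supply
  exactly the connection terms. In the Riemannian norms the inverse of \<open>Df\<close> is bounded by \<open>1 / l\<close>
  and the second derivative by \<open>\<Gamma>\<close>, which bounds the trace by \<open>CARD('n) * \<Gamma> / l\<close>.
\<close>

lemma log_jacobian_has_derivative:
  "\<exists>J'. ((\<lambda>y. ln \<bar>det (matrix (tangent_map c c' f y))\<bar> + 1/2 * ln \<bar>det (G c' (local_rep c c' f y))\<bar>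
         - 1/2 * ln \<bar>det (G c y)\<bar>) has_derivative J') (at z) \<and>
     (\<forall>u. \<bar>J' u\<bar> \<le> CARD('n) * \<Gamma> / l * tangent_norm G c z u)"
proof -
  let ?F = "local_rep c c' f"
  let ?C = "\<lambda>u. matrix (connection_term G c z u)"
  let ?C' = "\<lambda>u. matrix (connection_term G c' (?F z) (tangent_map c c' f z u))"
  let ?N = "tangent_norm G c z" and ?N' = "tangent_norm G c' (?F z)"
  have dG: "((\<lambda>y. ln \<bar>det (G c1 y)\<bar>) has_derivative (\<lambda>u. 2 * trace (matrix (connection_term G c1 w u)))) (at w)"
    if c1: "c1 \<in> A" "w \<in> chart_img c1" for c1 w
  proof -
    have "(G c1 has_derivative frechet_derivative (G c1) (at w)) (at w)"
      using metric_differentiable[OF c1] frechet_derivative_works by blast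
    moreover have "matrix_inv (G c1 w) ** G c1 w = mat 1"
      using det_metric_pos[OF c1] by (simp add: invertible_matrix_inv invertible_det_nz)
    ultimately have "((\<lambda>y. ln \<bar>det (G c1 y)\<bar>) has_derivative
        (\<lambda>u. trace (matrix_inv (G c1 w) ** frechet_derivative (G c1) (at w) u))) (at w)"
      by (rule ln_abs_det_has_derivative)
    then show ?thesis by (simp add: trace_connection_term[OF c1])
  qed
  have d1: "((\<lambda>y. ln \<bar>det (matrix (tangent_map c c' f y))\<bar>) has_derivative
      (\<lambda>u. trace (matrix_inv Df ** D2f u))) (at z)"
    using ln_abs_det_has_derivative[OF Df_has_derivative] Df_inv(1) by (simp add: Df_def)
  have d2: "((\<lambda>y. ln \<bar>det (G c' (?F y))\<bar>) has_derivative (\<lambda>u. 2 * trace (?C' u))) (at z)"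
    by (rule has_derivative_compose[OF local_rep_has_derivative[OF c z] dG[OF c(2) local_rep_img[OF c z]]])
  define J' where "J' = (\<lambda>u. trace (matrix_inv Df ** D2f u) + trace (?C' u) - trace (?C u))"
  have der: "((\<lambda>y. ln \<bar>det (matrix (tangent_map c c' f y))\<bar> + 1/2 * ln \<bar>det (G c' (?F y))\<bar>
         - 1/2 * ln \<bar>det (G c y)\<bar>) has_derivative J') (at z)"
  proof -
    have "((\<lambda>y. ln \<bar>det (matrix (tangent_map c c' f y))\<bar> + 1/2 * ln \<bar>det (G c' (?F y))\<bar>
         - 1/2 * ln \<bar>det (G c y)\<bar>) has_derivative
        (\<lambda>u. trace (matrix_inv Df ** D2f u) + 1/2 * (2 * trace (?C' u)) - 1/2 * (2 * trace (?C u)))) (at z)"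
      by (intro has_derivative_add has_derivative_diff has_derivative_mult_right d1 d2 dG[OF c(1) local_dom_img[OF c z]])
    then show ?thesis by (simp add: J'_def)
  qed
  have lin: "linear J'" using der by (rule has_derivative_linear)
  obtain a where a: "a > 0" "\<And>v. a * norm v \<le> ?N v"
    using tangent_norm_lower[OF c(1) local_dom_img[OF c z]] by blast
  obtain b where b: "\<And>v. ?N v \<le> b * norm v"
    using tangent_norm_upper[OF c(1) local_dom_img[OF c z]] by blast
  have unit: "\<bar>J' u\<bar> \<le> CARD('n) * (\<Gamma> / l)" if u: "?N u \<le> 1" for u
  proof -
    define S where "S = D2f u - Df ** ?C u + ?C' u ** Df"
    have S: "S *v v = second_deriv G c c' f z u v" for v
      by (simp add: S_def second_deriv_eq_matrix)
    have S_le: "?N' (S *v v) \<le> \<Gamma> * ?N v" for v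
    proof (cases "v = 0")
      case False
      then have Nv: "?N v > 0" using a(2)[of v] a(1) by (smt (verit) mult_pos_pos zero_less_norm_iff)
      let ?v = "inverse (?N v) *\<^sub>R v"
      have "?N ?v \<le> 1" using Nv by (simp add: tangent_norm_scaleR)
      then have "?N' (S *v ?v) \<le> \<Gamma>" unfolding S by (rule second_deriv_bound[OF c z u])
      moreover have "S *v ?v = inverse (?N v) *\<^sub>R (S *v v)"
        by (simp add: linear_scale[OF matrix_vector_mul_linear])
      ultimately have "inverse (?N v) * ?N' (S *v v) \<le> \<Gamma>"
        using Nv by (simp add: tangent_norm_scaleR)
      then show ?thesis using Nv by (simp add: field_simps)
    qed simp
    have "\<bar>trace (matrix_inv Df ** S)\<bar> \<le> CARD('n) * (\<Gamma> / l)"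
    proof (rule trace_le_norm[OF a b tangent_norm_triangle[OF c(1) local_dom_img[OF c z]] tangent_norm_scaleR])
      fix v
      let ?w = "(matrix_inv Df ** S) *v v"
      have "tangent_map c c' f z ?w = S *v v"
        by (simp add: Df_mult[symmetric] matrix_vector_mul_assoc matrix_mul_assoc Df_inv)
      then have "l * ?N ?w \<le> \<Gamma> * ?N v"
        using tangent_map_expands[OF c z, of ?w] S_le[of v] by simp
      then show "?N ?w \<le> \<Gamma> / l * ?N v" using l by (simp add: field_simps)
    qed (use l \<Gamma> in simp)
    moreover have "trace (matrix_inv Df ** S) = J' u"
    proof -
      have "matrix_inv Df ** S = matrix_inv Df ** D2f u - (matrix_inv Df ** Df) ** ?C u
          + matrix_inv Df ** (?C' u ** Df)"
        by (simp add: S_def matrix_add_ldistrib matrix_matrix_mult_diff_right matrix_mul_assoc)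
      moreover have "trace (matrix_inv Df ** (?C' u ** Df)) = trace (?C' u)"
        by (subst trace_mul_sym) (simp add: matrix_mul_assoc[symmetric] Df_inv)
      ultimately show ?thesis by (simp add: Df_inv trace_add trace_sub J'_def)
    qed
    ultimately show ?thesis by simp
  qed
  have "\<bar>J' u\<bar> \<le> CARD('n) * \<Gamma> / l * ?N u" for u
  proof (cases "u = 0")
    case False
    then have Nu: "?N u > 0" using a(2)[of u] a(1) by (smt (verit) mult_pos_pos zero_less_norm_iff)
    let ?u = "inverse (?N u) *\<^sub>R u"
    have "?N ?u \<le> 1" using Nu by (simp add: tangent_norm_scaleR)
    then have "\<bar>J' ?u\<bar> \<le> CARD('n) * (\<Gamma> / l)" by (rule unit)
    then have "inverse (?N u) * \<bar>J' u\<bar> \<le> CARD('n) * (\<Gamma> / l)"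
      using Nu by (simp add: linear_scale[OF lin] abs_mult)
    then show ?thesis using Nu l by (simp add: field_simps)
  qed (simp add: linear_0[OF lin])
  with der show ?thesis by blast
qed

end

end

section \<open>The transfer operator\<close>

lemma continuous_on_det:
  fixes M :: "'x::topological_space \<Rightarrow> real ^ 'n::finite ^ 'n"
  assumes "continuous_on S M"
  shows "continuous_on S (\<lambda>x. det (M x))"
  unfolding det_def using assms by (intro continuous_intros)

lemma sets_borel_Int_vimage:
  fixes g :: "'x::topological_space \<Rightarrow> 'y::topological_space"
  assumes "continuous_on S g" "S \<in> sets borel" "B \<in> sets borel"
  shows "S \<inter> g -` B \<in> sets borel"
proof -
  have "g -` B \<inter> space (restrict_space borel S) \<in> sets (restrict_space borel S)"
    by (rule measurable_sets[OF borel_measurable_continuous_on_restrict[OF assms(1)] assms(3)])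
  then show ?thesis using assms(2) by (simp add: sets_restrict_space_iff space_restrict_space Int_commute)
qed

lemma slope_constant_perturbation:
  fixes B l e :: real
  assumes "l > 0" "e > 0"
  obtains e' where "e' > 0" "e' < l" "(B + 2 * e') / (l - e') \<le> B / l + e"
proof -
  have "((\<lambda>t. (B + 2 * t) / (l - t)) \<longlongrightarrow> (B + 2 * 0) / (l - 0)) (at_right 0)"
    using assms by (intro tendsto_intros) auto
  then have "\<forall>\<^sub>F t in at_right 0. (B + 2 * t) / (l - t) < B / l + e"
    using assms by (intro order_tendstoD) auto
  moreover have "\<forall>\<^sub>F t in at_right 0. t < l"
    using assms by (auto simp: eventually_at_right intro!: exI[of _ l])
  moreover have "\<forall>\<^sub>F t in at_right (0::real). t > 0"
    by (simp add: eventually_at_filter)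
  ultimately have "\<forall>\<^sub>F t in at_right 0. t > 0 \<and> t < l \<and> (B + 2 * t) / (l - t) \<le> B / l + e"
    by eventually_elim auto
  then obtain t where "t > 0 \<and> t < l \<and> (B + 2 * t) / (l - t) \<le> B / l + e"
    using eventually_happens[of _ "at_right (0::real)"] by (auto simp: trivial_limit_at_right_real)
  then show thesis using that by blast
qed

context expanding_map begin

text \<open>
  The logarithm of the Jacobian of \<open>f\<close> with respect to the Riemannian volume.
\<close>

definition log_jacobian :: "('a, 'n) chart \<Rightarrow> ('a, 'n) chart \<Rightarrow> real ^ 'n \<Rightarrow> real" where
  "log_jacobian c c' y = ln \<bar>det (matrix (tangent_map c c' f y))\<bar>
     + 1/2 * ln \<bar>det (G c' (local_rep c c' f y))\<bar> - 1/2 * ln \<bar>det (G c y)\<bar>"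

context
  fixes c c'
  assumes c: "c \<in> A" "c' \<in> A"
begin

lemma det_tangent_map_nz:
  assumes z: "z \<in> local_dom c c' f"
  shows "det (matrix (tangent_map c c' f z)) \<noteq> 0"
proof
  assume "det (matrix (tangent_map c c' f z)) = 0"
  then show False
    using arg_cong[OF Df_inv(1)[OF c z], of det] by (simp add: det_mul Df_def[OF c z])
qed

lemma exp_log_jacobian:
  assumes z: "z \<in> local_dom c c' f"
  shows "exp (- log_jacobian c c' z) * (sqrt (det (G c' (local_rep c c' f z))) * \<bar>det (matrix (tangent_map c c' f z))\<bar>)
    = sqrt (det (G c z))"
proof -
  let ?a = "\<bar>det (matrix (tangent_map c c' f z))\<bar>" and ?b = "det (G c' (local_rep c c' f z))" and ?g = "det (G c z)"
  have pos: "?a > 0" "?b > 0" "?g > 0"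
    using det_tangent_map_nz[OF z] det_metric_pos[OF c(2) local_rep_img[OF c z]] det_metric_pos[OF c(1) local_dom_img[OF c z]]
    by auto
  have eq: "exp (ln x / 2) = sqrt x" if "x > 0" for x :: real
    using that by (simp flip: ln_sqrt)
  have "exp (log_jacobian c c' z) = ?a * sqrt ?b / sqrt ?g"
    using pos by (simp add: log_jacobian_def exp_diff exp_add eq)
  then show ?thesis using pos by (simp add: exp_minus field_simps)
qed

lemma continuous_on_log_jacobian: "continuous_on (local_dom c c' f) (log_jacobian c c')"
proof (rule continuous_at_imp_continuous_on, rule ballI)
  fix z assume z: "z \<in> local_dom c c' f"
  then show "isCont (log_jacobian c c') z"
    using log_jacobian_has_derivative[OF c z] has_derivative_continuous
    unfolding log_jacobian_def[abs_def] by blast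
qed

lemma continuous_on_tangent_map: "continuous_on (local_dom c c' f) (\<lambda>z. tangent_map c c' f z v)"
  using tangent_map_differentiable[OF c]
  by (meson continuous_at_imp_continuous_on differentiable_imp_continuous_within)

lemma continuous_on_det_tangent_map:
  "continuous_on (local_dom c c' f) (\<lambda>z. det (matrix (tangent_map c c' f z)))"
proof (rule continuous_on_det, rule continuous_at_imp_continuous_on, rule ballI)
  fix z assume z: "z \<in> local_dom c c' f"
  show "isCont (\<lambda>z. matrix (tangent_map c c' f z)) z"
    by (rule has_derivative_continuous[OF Df_has_derivative[OF c z]])
qed

lemma log_jacobian_slope:
  assumes z: "z \<in> local_dom c c' f" and e: "e > 0"
  shows "\<forall>\<^sub>F y in nhds z. \<bar>log_jacobian c c' y - log_jacobian c c' z\<bar>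
    \<le> (CARD('n) * \<Gamma> / l + e) * tangent_norm G c z (y - z)"
proof -
  obtain a where a: "a > 0" "\<And>v. a * norm v \<le> tangent_norm G c z v"
    using tangent_norm_lower[OF c(1) local_dom_img[OF c z]] by blast
  obtain J' where J': "(log_jacobian c c' has_derivative J') (at z)"
    "\<And>u. \<bar>J' u\<bar> \<le> CARD('n) * \<Gamma> / l * tangent_norm G c z u"
    using log_jacobian_has_derivative[OF c z] unfolding log_jacobian_def[abs_def] by blast
  show ?thesis by (rule slope_le_if_has_derivative[OF J' a e])
qed

text \<open>
  The linearisation expands by the factor \<open>l\<close>, and the remainder is of smaller order.
\<close>

lemma expansion_near:
  assumes z: "z \<in> local_dom c c' f" and e: "e > 0"
  shows "\<forall>\<^sub>F y in nhds z. (l - e) * tangent_norm G c z (y - z)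
    \<le> tangent_norm G c' (local_rep c c' f z) (local_rep c c' f y - local_rep c c' f z)"
proof -
  let ?F = "local_rep c c' f" and ?N = "tangent_norm G c z" and ?N' = "tangent_norm G c' (local_rep c c' f z)"
  let ?D = "tangent_map c c' f z"
  obtain a where a: "a > 0" "\<And>v. a * norm v \<le> ?N v"
    using tangent_norm_lower[OF c(1) local_dom_img[OF c z]] by blast
  obtain b where b: "b > 0" "\<And>v. ?N' v \<le> b * norm v"
    using tangent_norm_upper[OF c(2) local_rep_img[OF c z]] by blast
  have "e * a / b > 0" using e a b by simp
  then obtain d where d: "d > 0"
    "\<And>y. norm (y - z) < d \<Longrightarrow> norm (?F y - ?F z - ?D (y - z)) \<le> e * a / b * norm (y - z)"
    using local_rep_has_derivative[OF c z] unfolding has_derivative_at_alt by blast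
  have "(l - e) * ?N (y - z) \<le> ?N' (?F y - ?F z)" if "dist y z < d" for y
  proof -
    let ?r = "?F y - ?F z - ?D (y - z)"
    have "l * ?N (y - z) \<le> ?N' (?D (y - z))" by (rule tangent_map_expands[OF c z])
    also have "\<dots> = ?N' ((?F y - ?F z) + - ?r)" by simp
    also have "\<dots> \<le> ?N' (?F y - ?F z) + ?N' (- ?r)"
      by (rule tangent_norm_triangle[OF c(2) local_rep_img[OF c z]])
    also have "?N' (- ?r) \<le> e * ?N (y - z)"
    proof -
      have "?N' (- ?r) \<le> b * norm ?r" using b(2)[of ?r] by (simp only: tangent_norm_minus)
      also have "\<dots> \<le> b * (e * a / b * norm (y - z))"
        using b(1) d(2)[of y] that by (intro mult_left_mono) (auto simp: dist_norm)
      also have "\<dots> = e * (a * norm (y - z))" using b(1) by simp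
      also have "\<dots> \<le> e * ?N (y - z)" using a(2) e by (intro mult_left_mono) auto
      finally show ?thesis .
    qed
    finally show ?thesis by (simp add: algebra_simps)
  qed
  then show ?thesis using d(1) unfolding eventually_nhds_metric by blast
qed

text \<open>
  The inverse function theorem, with the target cut down to a bounded set so that its volume is
  finite.
\<close>

lemma local_rep_local_diffeomorphism:
  assumes z0: "z0 \<in> local_dom c c' f"
  obtains U V g where "open U" "z0 \<in> U" "U \<subseteq> local_dom c c' f" "open V" "bounded V"
    "homeomorphism U V (local_rep c c' f) g"
proof -
  let ?S = "local_dom c c' f" and ?F = "local_rep c c' f"
  define D where "D z = Blinfun (tangent_map c c' f z)" for z
  have D: "blinfun_apply (D z) = tangent_map c c' f z" if "z \<in> ?S" for z
    unfolding D_def using local_rep_has_derivative[OF c that]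
    by (intro bounded_linear_Blinfun_apply has_derivative_bounded_linear)
  define I where "I = Blinfun ((*v) (matrix_inv (Df c c' z0)))"
  have I: "blinfun_apply I = (*v) (matrix_inv (Df c c' z0))"
    unfolding I_def by (intro bounded_linear_Blinfun_apply matrix_vector_mul_bounded_linear)
  have inv: "I o\<^sub>L D z0 = id_blinfun"
    by (rule blinfun_eqI)
       (simp add: I D[OF z0] Df_mult[OF c z0, symmetric] matrix_vector_mul_assoc Df_inv[OF c z0])
  have cont: "continuous_on ?S D"
  proof (rule continuous_on_blinfun_componentwise)
    fix i :: "real ^ 'n"
    show "continuous_on ?S (\<lambda>z. blinfun_apply (D z) i)"
      using continuous_on_tangent_map[of i] by (rule continuous_on_eq) (simp add: D)
  qed
  have der: "(?F has_derivative blinfun_apply (D z)) (at z)" if "z \<in> ?S" for z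
    using local_rep_has_derivative[OF c that] D[OF that] by simp
  obtain U V g g' where U: "open U" "U \<subseteq> ?S" "z0 \<in> U" and V: "open V" "?F z0 \<in> V"
    and hom: "homeomorphism U V ?F g"
    by (rule inverse_function_theorem[OF open_local_dom[OF c continuous_f] der cont z0 inv])
  let ?V = "V \<inter> ball (?F z0) 1" and ?U = "U \<inter> ?F -` ball (?F z0) 1"
  have F: "continuous_on U ?F" "?F ` U = V" using hom by (auto simp: homeomorphism_def)
  show thesis
  proof (rule that[of ?U ?V g])
    show "open ?U" using F(1) U(1) by (metis continuous_on_open_vimage Int_commute open_ball)
    show "homeomorphism ?U ?V ?F g"
      by (rule homeomorphism_of_subsets[OF hom]) (use F(2) in auto)
    show "bounded ?V" using bounded_ball bounded_Int by blast
  qed (use U V in auto)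
qed

end

text \<open>
  The contribution of one inverse branch \<open>\<gamma>\<close> of \<open>f\<close> to the pushed forward density is \<open>\<alpha> \<circ> \<gamma>\<close> divided
  by the Jacobian at the preimage. The logarithm of the numerator has slope \<open>K\<close> and that of the
  Jacobian has slope \<open>CARD('n) * \<Gamma> / l\<close>; both slopes are divided by \<open>l\<close> because \<open>\<gamma>\<close> contracts by that
  factor. The slope is recorded only at the centre \<open>f x\<close> and in the chart \<open>c'\<close> from which the branch
  was built, so charts never have to be changed; \<open>transfer\<close> recovers the other points and charts
  from the uniqueness of continuous densities.
\<close>

lemma sheet:
  assumes \<alpha>: "\<alpha> \<in> log_lipschitz A G K" and K: "K \<ge> 0" and c': "c' \<in> A" "f x \<in> chart_dom c'"
  obtains W V \<beta> where "open W" "x \<in> W" "open V" "f ` W = V" "inj_on f W"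
    "\<And>T. open T \<Longrightarrow> T \<subseteq> W \<Longrightarrow> open (f ` T)"
    "\<And>y. y \<in> V \<Longrightarrow> \<beta> y > 0" "continuous_on V \<beta>"
    "\<And>e. e > 0 \<Longrightarrow> \<forall>\<^sub>F y in nhds (f x). \<bar>ln (\<beta> y) - ln (\<beta> (f x))\<bar>
      \<le> ((K + CARD('n) * \<Gamma> / l) / l + e) * tangent_norm G c' (chart_map c' (f x)) (chart_map c' y - chart_map c' (f x))"
    "\<And>B. B \<in> sets borel \<Longrightarrow> B \<subseteq> V \<Longrightarrow>
      (\<integral>\<^sup>+y. ennreal (\<beta> y) * indicator B y \<partial>m) = (\<integral>\<^sup>+y. ennreal (\<alpha> y) * indicator (W \<inter> f -` B) y \<partial>m)"
proof -
  obtain c where c0: "c \<in> A" "x \<in> chart_dom c" by (rule chart_at)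
  note c = c0(1) c'(1)
  let ?S = "local_dom c c' f" and ?F = "local_rep c c' f"
  let ?z0 = "chart_map c x"
  have z0: "?z0 \<in> ?S" using c0 c' by (auto simp: local_dom_def)
  obtain U V1 g where U: "open U" "?z0 \<in> U" "U \<subseteq> ?S" and V1: "open V1" "bounded V1"
    and hom: "homeomorphism U V1 ?F g"
    using local_rep_local_diffeomorphism[OF c z0] by blast
  have F: "continuous_on U ?F" "?F ` U = V1" and g: "continuous_on V1 g" "g ` V1 = U"
    and gF: "\<And>z. z \<in> U \<Longrightarrow> g (?F z) = z" and Fg: "\<And>w. w \<in> V1 \<Longrightarrow> ?F (g w) = w"
    using hom by (auto simp: homeomorphism_def)
  have U_img: "z \<in> chart_img c" if "z \<in> U" for z using local_dom_img[OF c] U(3) that by blast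
  have V1_img: "w \<in> chart_img c'" if "w \<in> V1" for w using local_rep_img[OF c] U(3) F(2) that by blast
  have f_inv: "f (chart_inv c z) \<in> chart_dom c'" "chart_map c' (f (chart_inv c z)) = ?F z" if "z \<in> U" for z
    using that U(3) by (auto simp: local_dom_eq[OF c(1)] local_rep_def)
  define W where "W = chart_dom c \<inter> chart_map c -` U"
  define V where "V = chart_dom c' \<inter> chart_map c' -` V1"
  define \<gamma> where "\<gamma> y = chart_inv c (g (chart_map c' y))" for y
  define \<beta> where "\<beta> y = \<alpha> (\<gamma> y) * exp (- log_jacobian c c' (g (chart_map c' y)))" for y
  have oW: "open W" unfolding W_def
    using continuous_on_chart_map[OF c(1)] open_chart_dom[OF c(1)] U(1)
    by (metis continuous_on_open_vimage Int_commute)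
  have oV: "open V" unfolding V_def
    using continuous_on_chart_map[OF c(2)] open_chart_dom[OF c(2)] V1(1)
    by (metis continuous_on_open_vimage Int_commute)
  have fW: "f p \<in> V" "chart_map c' (f p) = ?F (chart_map c p)" "\<gamma> (f p) = p" if p: "p \<in> W" for p
  proof -
    have z: "chart_map c p \<in> U" "chart_inv c (chart_map c p) = p" using p c by (auto simp: W_def)
    show F': "chart_map c' (f p) = ?F (chart_map c p)" using f_inv(2)[OF z(1)] z(2) by simp
    show "f p \<in> V" using f_inv[OF z(1)] z F(2) by (auto simp: V_def)
    show "\<gamma> (f p) = p" unfolding \<gamma>_def F' gF[OF z(1)] by (rule z(2))
  qed
  have V\<gamma>: "\<gamma> y \<in> W" "f (\<gamma> y) = y" if y: "y \<in> V" for y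
  proof -
    let ?w = "chart_map c' y"
    have w: "?w \<in> V1" "y \<in> chart_dom c'" using y by (auto simp: V_def)
    then have gw: "g ?w \<in> U" using g(2) by blast
    show "\<gamma> y \<in> W"
      using gw U_img[OF gw] chart_inv_in_dom[OF c(1) U_img[OF gw]] c by (auto simp: \<gamma>_def W_def)
    have "chart_map c' (f (\<gamma> y)) = ?w" "f (\<gamma> y) \<in> chart_dom c'"
      using f_inv[OF gw] Fg[OF w(1)] by (auto simp: \<gamma>_def)
    then show "f (\<gamma> y) = y" using w(2) c by (metis chart_inv_map)
  qed
  have img: "f ` W = V" using fW(1) V\<gamma> by force
  have inj: "inj_on f W" using fW(3) by (metis inj_onI)
  have cont_g: "continuous_on V (\<lambda>y. g (chart_map c' y))"
    using continuous_on_subset[OF continuous_on_chart_map[OF c(2)]]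
    by (intro continuous_on_compose2[OF g(1)]) (auto simp: V_def)
  have g_U: "g (chart_map c' y) \<in> U" if "y \<in> V" for y using that g(2) by (auto simp: V_def)
  have cont_\<gamma>: "continuous_on V \<gamma>"
    unfolding \<gamma>_def using g_U U_img
    by (intro continuous_on_compose2[OF continuous_on_chart_inv[OF c(1)] cont_g]) blast
  have opn: "open (f ` T)" if T: "open T" "T \<subseteq> W" for T
  proof -
    have "f ` T = V \<inter> \<gamma> -` T"
    proof
      show "f ` T \<subseteq> V \<inter> \<gamma> -` T" using fW T(2) by force
      show "V \<inter> \<gamma> -` T \<subseteq> f ` T" using V\<gamma>(2) by (metis IntE imageI subsetI vimageE)
    qed
    then show ?thesis using cont_\<gamma> oV T(1) by (metis continuous_on_open_vimage Int_commute)
  qed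
  have \<beta>_pos: "\<beta> y > 0" for y using log_lipschitz_pos[OF \<alpha>] by (simp add: \<beta>_def)
  have cont_lj: "continuous_on V (\<lambda>y. log_jacobian c c' (g (chart_map c' y)))"
    using g_U U(3) by (intro continuous_on_compose2[OF continuous_on_log_jacobian[OF c] cont_g]) blast
  have cont_\<beta>: "continuous_on V \<beta>"
    unfolding \<beta>_def
    by (intro continuous_intros cont_lj continuous_on_compose2[OF log_lipschitz_continuous_on[OF \<alpha>] cont_\<gamma>]) simp
  have x: "x \<in> W" using c0 U by (simp add: W_def)
  note fx = fW[OF x]
  have slope: "\<forall>\<^sub>F y in nhds (f x). \<bar>ln (\<beta> y) - ln (\<beta> (f x))\<bar>
      \<le> ((K + CARD('n) * \<Gamma> / l) / l + e) * tangent_norm G c' (chart_map c' (f x)) (chart_map c' y - chart_map c' (f x))"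
    if e: "e > 0" for e
  proof -
    let ?C = "CARD('n) * \<Gamma> / l"
    obtain e' where e': "e' > 0" "e' < l" "(K + ?C + 2 * e') / (l - e') \<le> (K + ?C) / l + e"
      using slope_constant_perturbation[OF l e] by blast
    let ?\<zeta> = "\<lambda>y. g (chart_map c' y)"
    have \<zeta>fx: "?\<zeta> (f x) = ?z0" using fx(2) gF[OF U(2)] by simp
    have lim_\<zeta>: "filterlim ?\<zeta> (nhds ?z0) (nhds (f x))"
      using cont_g oV fx(1) \<zeta>fx
      by (metis continuous_on_eq_continuous_at isCont_def tendsto_at_iff_tendsto_nhds)
    have lim_\<gamma>: "filterlim \<gamma> (nhds x) (nhds (f x))"
      using cont_\<gamma> oV fx(1) fx(3)
      by (metis continuous_on_eq_continuous_at isCont_def tendsto_at_iff_tendsto_nhds)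
    have 1: "\<forall>\<^sub>F y in nhds (f x). \<bar>ln (\<alpha> (\<gamma> y)) - ln (\<alpha> x)\<bar>
        \<le> (K + e') * tangent_norm G c ?z0 (chart_map c (\<gamma> y) - ?z0)"
      by (rule eventually_compose_filterlim[OF log_lipschitzD[OF \<alpha> c0 e'(1)] lim_\<gamma>])
    have 2: "\<forall>\<^sub>F y in nhds (f x). \<bar>log_jacobian c c' (?\<zeta> y) - log_jacobian c c' ?z0\<bar>
        \<le> (?C + e') * tangent_norm G c ?z0 (?\<zeta> y - ?z0)"
      by (rule eventually_compose_filterlim[OF log_jacobian_slope[OF c z0 e'(1)] lim_\<zeta>])
    have 3: "\<forall>\<^sub>F y in nhds (f x). (l - e') * tangent_norm G c ?z0 (?\<zeta> y - ?z0)
        \<le> tangent_norm G c' (?F ?z0) (?F (?\<zeta> y) - ?F ?z0)"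
      by (rule eventually_compose_filterlim[OF expansion_near[OF c z0 e'(1)] lim_\<zeta>])
    have 4: "\<forall>\<^sub>F y in nhds (f x). y \<in> V" by (rule eventually_nhds_in_open[OF oV fx(1)])
    from 1 2 3 4 show ?thesis
    proof eventually_elim
      case (elim y)
      let ?N = "tangent_norm G c ?z0 (?\<zeta> y - ?z0)"
      let ?N' = "tangent_norm G c' (chart_map c' (f x)) (chart_map c' y - chart_map c' (f x))"
      have N: "?N \<ge> 0" by (rule tangent_norm_nonneg[OF c(1) local_dom_img[OF c z0]])
      have N': "?N' \<ge> 0" using c' by (intro tangent_norm_nonneg) auto
      have \<zeta>y: "chart_map c (\<gamma> y) = ?\<zeta> y"
        using U_img[OF g_U[OF elim(4)]] c by (simp add: \<gamma>_def)
      have F\<zeta>: "?F (?\<zeta> y) = chart_map c' y" using elim(4) Fg by (simp add: V_def)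
      have ln\<beta>: "ln (\<beta> y) = ln (\<alpha> (\<gamma> y)) - log_jacobian c c' (?\<zeta> y)" for y
        using log_lipschitz_pos[OF \<alpha>, of "\<gamma> y"] by (simp add: \<beta>_def ln_mult)
      have N_le: "?N \<le> ?N' / (l - e')"
        using elim(3) e' by (simp add: F\<zeta> fx(2) field_simps)
      have "\<bar>ln (\<beta> y) - ln (\<beta> (f x))\<bar> \<le> (K + ?C + 2 * e') * ?N"
        using elim(1,2) unfolding ln\<beta> fx(3) \<zeta>fx \<zeta>y by (simp add: algebra_simps abs_le_iff)
      also have "\<dots> \<le> ((K + ?C) / l + e) * ?N'"
      proof -
        have "K + ?C + 2 * e' \<ge> 0" using K \<Gamma> l e'(1) by simp
        then have "(K + ?C + 2 * e') * ?N \<le> (K + ?C + 2 * e') * (?N' / (l - e'))"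
          using N_le by (intro mult_left_mono)
        also have "\<dots> = (K + ?C + 2 * e') / (l - e') * ?N'" by simp
        also have "\<dots> \<le> ((K + ?C) / l + e) * ?N'" by (rule mult_right_mono[OF e'(3) N'])
        finally show ?thesis .
      qed
      finally show ?case .
    qed
  qed
  have meas: "(\<integral>\<^sup>+y. ennreal (\<beta> y) * indicator B y \<partial>m) = (\<integral>\<^sup>+y. ennreal (\<alpha> y) * indicator (W \<inter> f -` B) y \<partial>m)"
    if B: "B \<in> sets borel" "B \<subseteq> V" for B
  proof -
    define h1 where "h1 y = ennreal (\<beta> y) * indicator B y" for y
    define h2 where "h2 p = ennreal (\<alpha> p) * indicator (W \<inter> f -` B) p" for p
    define k where "k w = h1 (chart_inv c' w) * ennreal (sqrt (det (G c' w)))" for w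
    let ?M = "\<lambda>z. matrix (tangent_map c c' f z)"
    have Vd: "V \<subseteq> chart_dom c'" and Wd: "W \<subseteq> chart_dom c" by (auto simp: V_def W_def)
    have fB: "f -` B \<in> sets borel"
      using continuous_f B(1) by (metis borel_measurable_continuous_onI measurable_sets_borel)
    have mh1: "(\<lambda>y. h1 y * indicator (chart_dom c') y) \<in> borel_measurable borel"
    proof -
      have "(\<lambda>y. ennreal (\<beta> y) * indicator V y * indicator B y) \<in> borel_measurable borel"
        using borel_measurable_continuous_on_times_indicator[OF _ cont_\<beta>] oV B by measurable
      also have "(\<lambda>y. ennreal (\<beta> y) * indicator V y * indicator B y) = (\<lambda>y. h1 y * indicator (chart_dom c') y)"
        using B(2) Vd by (auto simp: h1_def indicator_def fun_eq_iff)
      finally show ?thesis .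
    qed
    have mh2: "(\<lambda>y. h2 y * indicator (chart_dom c) y) \<in> borel_measurable borel"
    proof -
      have "\<alpha> \<in> borel_measurable borel"
        by (rule borel_measurable_continuous_onI[OF log_lipschitz_continuous_on[OF \<alpha>]])
      moreover have [measurable]: "W \<inter> f -` B \<in> sets borel" "chart_dom c \<in> sets borel"
        using oW fB open_chart_dom[OF c(1)] by auto
      ultimately show ?thesis unfolding h2_def by measurable
    qed
    have mk: "(\<lambda>w. k w * indicator V1 w) \<in> borel_measurable borel"
    proof -
      have V1s: "V1 \<subseteq> chart_img c'" using V1_img by blast
      have ci: "continuous_on V1 (chart_inv c')"
        by (rule continuous_on_subset[OF continuous_on_chart_inv[OF c(2)] V1s])
      have iV: "chart_inv c' ` V1 \<subseteq> V"
        using V1_img chart_inv_in_dom[OF c(2)] c by (auto simp: V_def)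
      have "continuous_on V1 (\<lambda>w. \<beta> (chart_inv c' w) * sqrt (det (G c' w)))"
        by (intro continuous_on_mult continuous_on_compose2[OF cont_\<beta> ci iV]
              continuous_on_subset[OF continuous_on_sqrt_det_metric[OF c(2)] V1s])
      then have "(\<lambda>w. ennreal (\<beta> (chart_inv c' w) * sqrt (det (G c' w))) * indicator V1 w) \<in> borel_measurable borel"
        using V1(1) by (intro borel_measurable_continuous_on_times_indicator) auto
      moreover have "V1 \<inter> chart_inv c' -` B \<in> sets borel"
        using V1(1) B(1) by (intro sets_borel_Int_vimage[OF ci]) auto
      ultimately have "(\<lambda>w. ennreal (\<beta> (chart_inv c' w) * sqrt (det (G c' w))) * indicator V1 w
          * indicator (V1 \<inter> chart_inv c' -` B) w) \<in> borel_measurable borel" by measurable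
      also have "(\<lambda>w. ennreal (\<beta> (chart_inv c' w) * sqrt (det (G c' w))) * indicator V1 w
          * indicator (V1 \<inter> chart_inv c' -` B) w) = (\<lambda>w. k w * indicator V1 w)"
        using \<beta>_pos by (auto simp: k_def h1_def indicator_def fun_eq_iff ennreal_mult' less_imp_le)
      finally show ?thesis .
    qed
    have "(\<integral>\<^sup>+y. ennreal (\<beta> y) * indicator B y \<partial>m) = (\<integral>\<^sup>+y. h1 y * indicator (chart_dom c') y \<partial>m)"
      using B(2) Vd by (intro nn_integral_cong) (auto simp: h1_def indicator_def)
    also have "\<dots> = (\<integral>\<^sup>+w. h1 (chart_inv c' w) * (ennreal (sqrt (det (G c' w))) * indicator (chart_img c') w) \<partial>lborel)"
      by (rule nn_integral_volume_in_chart[OF c(2) mh1])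
    also have "\<dots> = (\<integral>\<^sup>+w. k w * indicator V1 w \<partial>lborel)"
    proof (intro nn_integral_cong)
      fix w :: "real ^ 'n"
      have "w \<in> V1" if "w \<in> chart_img c'" "chart_inv c' w \<in> B"
        using that B(2) c by (auto simp: V_def)
      then show "h1 (chart_inv c' w) * (ennreal (sqrt (det (G c' w))) * indicator (chart_img c') w) = k w * indicator V1 w"
        using V1_img by (auto simp: k_def h1_def indicator_def)
    qed
    also have "\<dots> = (\<integral>\<^sup>+z. k (?F z) * (ennreal \<bar>det (?M z)\<bar> * indicator U z) \<partial>lborel)"
    proof (rule nn_integral_diffeomorphism[OF U(1) V1 hom _ _ mk])
      show "(?F has_derivative tangent_map c c' f z) (at z)" if "z \<in> U" for z
        using local_rep_has_derivative[OF c] U(3) that by blast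
      show "continuous_on U (\<lambda>z. det (?M z))"
        by (rule continuous_on_subset[OF continuous_on_det_tangent_map[OF c] U(3)])
    qed
    also have "\<dots> = (\<integral>\<^sup>+z. h2 (chart_inv c z) * (ennreal (sqrt (det (G c z))) * indicator (chart_img c) z) \<partial>lborel)"
    proof (intro nn_integral_cong)
      fix z :: "real ^ 'n"
      show "k (?F z) * (ennreal \<bar>det (?M z)\<bar> * indicator U z)
        = h2 (chart_inv c z) * (ennreal (sqrt (det (G c z))) * indicator (chart_img c) z)"
      proof (cases "z \<in> U")
        case True
        let ?p = "chart_inv c z"
        have zS: "z \<in> ?S" using True U(3) by blast
        have p: "?p \<in> W" "chart_map c ?p = z"
          using True U_img[OF True] chart_inv_in_dom[OF c(1) U_img[OF True]] c by (auto simp: W_def)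
        have F': "chart_inv c' (?F z) = f ?p" using f_inv[OF True] c by (metis chart_inv_map)
        have \<beta>: "\<beta> (f ?p) = \<alpha> ?p * exp (- log_jacobian c c' z)"
          using fW(2,3)[OF p(1)] gF[OF True] by (simp add: \<beta>_def p(2))
        have pos: "\<alpha> ?p \<ge> 0" using log_lipschitz_pos[OF \<alpha>] less_imp_le by blast
        have dpos: "det (G c' (?F z)) \<ge> 0" using det_metric_pos[OF c(2) local_rep_img[OF c zS]] by simp
        have "ennreal (\<beta> (f ?p)) * ennreal (sqrt (det (G c' (?F z)))) * ennreal \<bar>det (?M z)\<bar>
            = ennreal (\<alpha> ?p * (exp (- log_jacobian c c' z) * (sqrt (det (G c' (?F z))) * \<bar>det (?M z)\<bar>)))"
          unfolding \<beta> using pos dpos by (simp add: ennreal_mult' mult_ac)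
        also have "\<dots> = ennreal (\<alpha> ?p) * ennreal (sqrt (det (G c z)))"
          unfolding exp_log_jacobian[OF c zS] using pos by (simp add: ennreal_mult')
        finally show ?thesis
          using True U_img[OF True] p(1) by (simp add: k_def h1_def h2_def F' indicator_def)
      next
        case False
        have "chart_inv c z \<notin> W" if "z \<in> chart_img c"
          using that False c by (auto simp: W_def)
        then show ?thesis using False by (auto simp: h2_def indicator_def)
      qed
    qed
    also have "\<dots> = (\<integral>\<^sup>+y. h2 y * indicator (chart_dom c) y \<partial>m)"
      by (rule nn_integral_volume_in_chart[OF c(1) mh2, symmetric])
    also have "\<dots> = (\<integral>\<^sup>+y. ennreal (\<alpha> y) * indicator (W \<inter> f -` B) y \<partial>m)"
      using Wd by (intro nn_integral_cong) (auto simp: h2_def indicator_def)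
    finally show ?thesis .
  qed
  show thesis
    by (rule that[OF oW x oV img inj opn \<beta>_pos cont_\<beta> slope meas])
qed

end

lemma finite_separating_nbhds:
  fixes X :: "'x::t2_space set"
  assumes "finite X"
  obtains S where "\<And>x. x \<in> X \<Longrightarrow> open (S x)" "\<And>x. x \<in> X \<Longrightarrow> x \<in> S x"
    "\<And>x y. x \<in> X \<Longrightarrow> y \<in> X \<Longrightarrow> x \<noteq> y \<Longrightarrow> S x \<inter> S y = {}"
proof -
  have "\<forall>p :: 'x \<times> 'x. \<exists>q. fst p \<noteq> snd p \<longrightarrow>
      open (fst q) \<and> open (snd q) \<and> fst p \<in> fst q \<and> snd p \<in> snd q \<and> fst q \<inter> snd q = {}"
    using separation_t2 by (metis fst_conv snd_conv)
  then obtain h where h: "\<forall>p :: 'x \<times> 'x. fst p \<noteq> snd p \<longrightarrow> open (fst (h p)) \<and> open (snd (h p)) \<and>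
      fst p \<in> fst (h p) \<and> snd p \<in> snd (h p) \<and> fst (h p) \<inter> snd (h p) = {}"
    by (rule choice[THEN exE])
  define U where "U x y = fst (h (x, y))" for x y
  define V where "V x y = snd (h (x, y))" for x y
  have UV: "open (U x y) \<and> open (V x y) \<and> x \<in> U x y \<and> y \<in> V x y \<and> U x y \<inter> V x y = {}"
    if "x \<noteq> y" for x y
    using spec[OF h, of "(x, y)"] that by (simp add: U_def V_def)
  define S where "S x = (\<Inter>y\<in>X - {x}. U x y \<inter> V y x)" for x
  show thesis
  proof (rule that[of S])
    show "open (S x)" for x
      unfolding S_def using assms UV by (intro open_INT) auto
    show "x \<in> S x" for x
    proof -
      have "x \<in> U x y \<inter> V y x" if "y \<in> X - {x}" for y
        using UV[of x y] UV[of y x] that by blast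
      then show ?thesis unfolding S_def by blast
    qed
    show "S x \<inter> S y = {}" if "x \<in> X" "y \<in> X" "x \<noteq> y" for x y
    proof -
      have "S x \<subseteq> U x y" "S y \<subseteq> V x y" using that by (auto simp: S_def)
      then show ?thesis using UV[OF that(3)] by blast
    qed
  qed
qed

context compact_riemannian begin

lemma log_lipschitz_mono:
  assumes "\<alpha> \<in> log_lipschitz A G K" "K \<le> K'"
  shows "\<alpha> \<in> log_lipschitz A G K'"
  unfolding log_lipschitz_def
proof (intro CollectI conjI allI ballI impI log_lipschitz_pos[OF assms(1)])
  fix c x and e :: real assume c: "c \<in> A" "x \<in> chart_dom c" and e: "e > 0"
  show "\<forall>\<^sub>F y in nhds x. \<bar>ln (\<alpha> y) - ln (\<alpha> x)\<bar>
    \<le> (K' + e) * tangent_norm G c (chart_map c x) (chart_map c y - chart_map c x)"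
    using log_lipschitzD[OF assms(1) c e]
  proof eventually_elim
    case (elim y)
    have "tangent_norm G c (chart_map c x) (chart_map c y - chart_map c x) \<ge> 0"
      using c by (intro tangent_norm_nonneg) auto
    then have "(K + e) * tangent_norm G c (chart_map c x) (chart_map c y - chart_map c x)
      \<le> (K' + e) * tangent_norm G c (chart_map c x) (chart_map c y - chart_map c x)"
      using assms(2) by (intro mult_right_mono) auto
    with elim show ?case by linarith
  qed
qed

lemma const_1_log_lipschitz: "(\<lambda>_. 1) \<in> log_lipschitz A G 0"
  unfolding log_lipschitz_def
  by (intro CollectI conjI allI ballI impI always_eventually)
     (simp_all add: tangent_norm_nonneg)

lemma borel_measurable_log_lipschitz:
  assumes "\<alpha> \<in> log_lipschitz A G K"
  shows "\<alpha> \<in> borel_measurable borel" "\<alpha> \<in> borel_measurable m"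
proof -
  show "\<alpha> \<in> borel_measurable borel"
    by (rule borel_measurable_continuous_onI[OF log_lipschitz_continuous_on[OF assms]])
  then show "\<alpha> \<in> borel_measurable m"
    using measurable_cong_sets[OF sets_m refl] by blast
qed

lemma emeasure_density_m:
  assumes "\<alpha> \<in> log_lipschitz A G K" "B \<in> sets borel"
  shows "emeasure (density m (\<lambda>x. ennreal (\<alpha> x))) B = (\<integral>\<^sup>+x. ennreal (\<alpha> x) * indicator B x \<partial>m)"
  using borel_measurable_log_lipschitz(2)[OF assms(1)] assms(2) sets_m
  by (intro emeasure_density) auto

text \<open>
  If \<open>v y < u y\<close>, two constants separate the functions on an open neighbourhood of \<open>y\<close>. This set has
  positive volume, so the two integrals over it differ.
\<close>

lemma continuous_density_unique:
  fixes u v :: "'a \<Rightarrow> real"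
  assumes T: "open T" and cont: "continuous_on T u" "continuous_on T v"
    and pos: "\<And>y. y \<in> T \<Longrightarrow> u y > 0" "\<And>y. y \<in> T \<Longrightarrow> v y > 0"
    and eq: "\<And>B. B \<in> sets borel \<Longrightarrow> B \<subseteq> T \<Longrightarrow>
      (\<integral>\<^sup>+y. ennreal (u y) * indicator B y \<partial>m) = (\<integral>\<^sup>+y. ennreal (v y) * indicator B y \<partial>m)"
    and y: "y \<in> T"
  shows "u y = v y"
proof -
  have "\<not> v y < u y"
    if cont: "continuous_on T u" "continuous_on T v" and pos: "v y > 0"
    and eq: "\<And>B. B \<in> sets borel \<Longrightarrow> B \<subseteq> T \<Longrightarrow>
      (\<integral>\<^sup>+y. ennreal (u y) * indicator B y \<partial>m) = (\<integral>\<^sup>+y. ennreal (v y) * indicator B y \<partial>m)"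
    for u v :: "'a \<Rightarrow> real"
  proof
    assume less: "v y < u y"
    obtain r1 where r1: "v y < r1" "r1 < u y" using dense[OF less] by blast
    obtain r2 where r2: "r1 < r2" "r2 < u y" using dense[OF r1(2)] by blast
    define S where "S = (T \<inter> u -` {r2<..}) \<inter> (T \<inter> v -` {..<r1})"
    have oS: "open S"
      unfolding S_def using cont T
      by (metis continuous_on_open_vimage Int_commute open_Int open_greaterThan open_lessThan)
    have yS: "y \<in> S" using y r1 r2 by (auto simp: S_def)
    have S: "S \<in> sets m" "S \<in> sets borel" "S \<subseteq> T" using oS sets_m by (auto simp: S_def)
    have mS: "emeasure m S > 0" by (rule volume_open_pos[OF oS yS])
    have mf: "emeasure m S \<noteq> top"
      using prob_space.emeasure_le_1[OF prob_space_m, of S] by (auto simp: top_unique)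
    have "ennreal r2 * emeasure m S = (\<integral>\<^sup>+y. ennreal r2 * indicator S y \<partial>m)"
      using S by (simp add: nn_integral_cmult_indicator)
    also have "\<dots> \<le> (\<integral>\<^sup>+y. ennreal (u y) * indicator S y \<partial>m)"
      by (intro nn_integral_mono) (auto simp: S_def indicator_def intro!: ennreal_leI)
    also have "\<dots> = (\<integral>\<^sup>+y. ennreal (v y) * indicator S y \<partial>m)" using S by (intro eq)
    also have "\<dots> \<le> (\<integral>\<^sup>+y. ennreal r1 * indicator S y \<partial>m)"
      by (intro nn_integral_mono) (auto simp: S_def indicator_def intro!: ennreal_leI)
    also have "\<dots> = ennreal r1 * emeasure m S"
      using S by (simp add: nn_integral_cmult_indicator)
    finally have "ennreal r2 * emeasure m S \<le> ennreal r1 * emeasure m S" .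
    moreover obtain s where s: "emeasure m S = ennreal s" "s \<ge> 0" using mf by (cases "emeasure m S") auto
    ultimately have "r2 * s \<le> r1 * s"
      using r1 r2 pos by (simp add: ennreal_mult'[symmetric] ennreal_le_iff2)
        (smt (verit) mult_less_0_iff zero_le_mult_iff)
    moreover have "s > 0" using mS s by simp
    ultimately show False using r2 by simp
  qed
  from this[OF cont pos(2)[OF y] eq] this[OF cont(2,1) pos(1)[OF y] eq[symmetric]] show ?thesis by simp
qed

end

context expanding_map begin

lemma surj_f: "range f = UNIV"
proof (rule ccontr)
  assume *: "range f \<noteq> UNIV"
  have "open (range f)"
  proof (subst open_subopen, intro ballI)
    fix y assume "y \<in> range f"
    then obtain x where x: "y = f x" by blast
    obtain c' where c': "c' \<in> A" "f x \<in> chart_dom c'" by (rule chart_at)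
    obtain W V where "open V" "f ` W = V" "x \<in> W"
      using sheet[OF const_1_log_lipschitz order_refl c'] by metis
    then show "\<exists>T. open T \<and> y \<in> T \<and> T \<subseteq> range f" using x by blast
  qed
  moreover have "closed (range f)"
    by (intro compact_imp_closed compact_continuous_image continuous_f compact_M)
  ultimately show False
    using connectedD[OF connected_M, of "range f" "- range f"] * by blast
qed

text \<open>
  Above a small neighbourhood of \<open>y\<close>, \<open>f\<close> is a trivial covering: the fibre of \<open>y\<close> is compact and
  discrete, hence finite, its points have disjoint sheets, and the image of the complement of the
  sheets is a closed set that misses \<open>y\<close>. The density is the sum of the contributions of the sheets,
  and a sum of positive functions inherits a common bound on the slopes of their logarithms.
\<close>

lemma transfer_local:
  assumes \<alpha>: "\<alpha> \<in> log_lipschitz A G K" and K: "K \<ge> 0" and c': "c' \<in> A" "y \<in> chart_dom c'"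
  obtains V \<beta> where "open V" "y \<in> V" "\<And>y'. y' \<in> V \<Longrightarrow> \<beta> y' > 0" "continuous_on V \<beta>"
    "\<And>e. e > 0 \<Longrightarrow> \<forall>\<^sub>F y' in nhds y. \<bar>ln (\<beta> y') - ln (\<beta> y)\<bar>
      \<le> ((K + CARD('n) * \<Gamma> / l) / l + e) * tangent_norm G c' (chart_map c' y) (chart_map c' y' - chart_map c' y)"
    "\<And>B. B \<in> sets borel \<Longrightarrow> B \<subseteq> V \<Longrightarrow>
      (\<integral>\<^sup>+y. ennreal (\<beta> y) * indicator B y \<partial>m) = (\<integral>\<^sup>+y. ennreal (\<alpha> y) * indicator (f -` B) y \<partial>m)"
proof -
  define X where "X = f -` {y}"
  let ?q = "\<lambda>e y'. ((K + CARD('n) * \<Gamma> / l) / l + e) * tangent_norm G c' (chart_map c' y) (chart_map c' y' - chart_map c' y)"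
  have fX: "f x = y" if "x \<in> X" for x using that by (simp add: X_def)
  define sheet_at where "sheet_at x W V \<beta> \<longleftrightarrow> open W \<and> x \<in> W \<and> open V \<and> f ` W = V \<and> inj_on f W \<and>
      (\<forall>T. open T \<longrightarrow> T \<subseteq> W \<longrightarrow> open (f ` T)) \<and> (\<forall>y\<in>V. \<beta> y > 0) \<and> continuous_on V \<beta> \<and>
      (\<forall>e>0. \<forall>\<^sub>F y' in nhds y. \<bar>ln (\<beta> y') - ln (\<beta> y)\<bar> \<le> ?q e y') \<and>
      (\<forall>B\<in>sets borel. B \<subseteq> V \<longrightarrow> (\<integral>\<^sup>+y. ennreal (\<beta> y) * indicator B y \<partial>m)
         = (\<integral>\<^sup>+y. ennreal (\<alpha> y) * indicator (W \<inter> f -` B) y \<partial>m))" for x W V and \<beta> :: "'a \<Rightarrow> real"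
  have "\<exists>W V \<beta>. sheet_at x W V \<beta>" if x: "x \<in> X" for x
  proof -
    have c: "f x \<in> chart_dom c'" using c' fX[OF x] by simp
    show ?thesis
    proof (rule sheet[OF \<alpha> K c'(1) c], goal_cases)
      case prems: (1 W V \<beta>)
      show ?case
        unfolding sheet_at_def
        by (intro exI[of _ W] exI[of _ V] exI[of _ \<beta>] conjI allI ballI impI prems[unfolded fX[OF x]])
    qed
  qed
  then obtain W V \<beta> where "\<And>x. x \<in> X \<Longrightarrow> sheet_at x (W x) (V x) (\<beta> x)" by metis
  then have oW: "\<And>x. x \<in> X \<Longrightarrow> open (W x)" and xW: "\<And>x. x \<in> X \<Longrightarrow> x \<in> W x"
    and fW: "\<And>x. x \<in> X \<Longrightarrow> f ` W x = V x"
    and inj: "\<And>x. x \<in> X \<Longrightarrow> inj_on f (W x)"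
    and opn: "\<And>x T. x \<in> X \<Longrightarrow> open T \<Longrightarrow> T \<subseteq> W x \<Longrightarrow> open (f ` T)"
    and pos: "\<And>x y. x \<in> X \<Longrightarrow> y \<in> V x \<Longrightarrow> \<beta> x y > 0"
    and cont: "\<And>x. x \<in> X \<Longrightarrow> continuous_on (V x) (\<beta> x)"
    and slope: "\<And>x e. x \<in> X \<Longrightarrow> e > 0 \<Longrightarrow> \<forall>\<^sub>F y' in nhds y. \<bar>ln (\<beta> x y') - ln (\<beta> x y)\<bar> \<le> ?q e y'"
    and meas: "\<And>x B. x \<in> X \<Longrightarrow> B \<in> sets borel \<Longrightarrow> B \<subseteq> V x \<Longrightarrow>
       (\<integral>\<^sup>+y. ennreal (\<beta> x y) * indicator B y \<partial>m)
         = (\<integral>\<^sup>+y. ennreal (\<alpha> y) * indicator (W x \<inter> f -` B) y \<partial>m)"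
    unfolding sheet_at_def by blast+
  have only: "p = x" if "x \<in> X" "p \<in> X" "p \<in> W x" for x p
    using inj_onD[OF inj[OF that(1)], of p x] fX that xW by simp
  have finX: "finite X"
  proof -
    have "closed X"
      unfolding X_def using continuous_f by (intro closed_vimage) auto
    then have "compact X" using compact_M compact_Int_closed[of UNIV X] by simp
    moreover have "X \<subseteq> (\<Union>x\<in>X. W x)" using xW by blast
    ultimately obtain F where "F \<subseteq> X" "finite F" "X \<subseteq> (\<Union>x\<in>F. W x)"
      using compactE_image[of X X W] oW by metis
    then have "X \<subseteq> F" using only by blast
    then show ?thesis using \<open>finite F\<close> finite_subset by blast
  qed
  have neX: "X \<noteq> {}"
  proof -
    have "y \<in> range f" using surj_f by simp
    then show ?thesis unfolding X_def by blast
  qed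
  obtain S where S: "\<And>x. x \<in> X \<Longrightarrow> open (S x)" "\<And>x. x \<in> X \<Longrightarrow> x \<in> S x"
    "\<And>x p. x \<in> X \<Longrightarrow> p \<in> X \<Longrightarrow> x \<noteq> p \<Longrightarrow> S x \<inter> S p = {}"
    using finite_separating_nbhds[OF finX] by blast
  define N where "N x = W x \<inter> S x" for x
  have N: "open (N x)" "x \<in> N x" "N x \<subseteq> W x" if "x \<in> X" for x
    using oW S xW that by (auto simp: N_def)
  have disjN: "N x \<inter> N p = {}" if "x \<in> X" "p \<in> X" "x \<noteq> p" for x p
    using S(3)[OF that] by (auto simp: N_def)
  \<comment> \<open>every point of \<open>V'\<close> has exactly one preimage in each \<open>N x\<close> and none elsewhere\<close>
  define V' where "V' = (\<Inter>x\<in>X. f ` N x) - f ` (- (\<Union>x\<in>X. N x))"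
  have oV': "open V'"
  proof -
    have "open (\<Inter>x\<in>X. f ` N x)" using finX opn N by (intro open_INT) auto
    moreover have "closed (- (\<Union>x\<in>X. N x))" using N by (intro closed_Compl open_UN) auto
    then have "compact (- (\<Union>x\<in>X. N x))"
      using compact_M compact_Int_closed[of UNIV "- (\<Union>x\<in>X. N x)"] by simp
    then have "closed (f ` (- (\<Union>x\<in>X. N x)))"
      using continuous_on_subset[OF continuous_f] by (intro compact_imp_closed compact_continuous_image) auto
    ultimately show ?thesis unfolding V'_def by (rule open_Diff)
  qed
  have yV': "y \<in> V'"
  proof -
    have "y \<in> f ` N x" if "x \<in> X" for x using fX[OF that] N(2)[OF that] by blast
    moreover have "y \<notin> f ` (- (\<Union>x\<in>X. N x))"
      using N(2) by (auto simp: X_def)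
    ultimately show ?thesis by (simp add: V'_def)
  qed
  have V'V: "V' \<subseteq> V x" if "x \<in> X" for x
  proof -
    have "V' \<subseteq> f ` N x" unfolding V'_def using INT_lower[OF that] by (rule subset_trans[OF Diff_subset])
    also have "\<dots> \<subseteq> f ` W x" by (rule image_mono[OF N(3)[OF that]])
    finally show ?thesis by (simp only: fW[OF that])
  qed
  define \<beta>' where "\<beta>' y' = (\<Sum>x\<in>X. \<beta> x y')" for y'
  show thesis
  proof (rule that[of V' \<beta>'])
    show "open V'" "y \<in> V'" by fact+
    show \<beta>'_pos: "\<beta>' y' > 0" if "y' \<in> V'" for y'
      unfolding \<beta>'_def by (intro sum_pos finX neX pos subsetD[OF V'V that])
    show "continuous_on V' \<beta>'"
      unfolding \<beta>'_def using continuous_on_subset[OF cont V'V] by (intro continuous_on_sum)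
    show "\<forall>\<^sub>F y' in nhds y. \<bar>ln (\<beta>' y') - ln (\<beta>' y)\<bar> \<le> ?q e y'" if e: "e > 0" for e
    proof -
      have "\<forall>\<^sub>F y' in nhds y. \<forall>x\<in>X. \<bar>ln (\<beta> x y') - ln (\<beta> x y)\<bar> \<le> ?q e y'"
        using slope e by (intro eventually_ball_finite[OF finX]) blast
      moreover have "\<forall>\<^sub>F y' in nhds y. y' \<in> V'" by (rule eventually_nhds_in_open[OF oV' yV'])
      ultimately show ?thesis
      proof eventually_elim
        case (elim y')
        have ln_le: "ln (\<beta>' b) \<le> ln (\<beta>' a) + ?q e y'"
          if "a \<in> V'" "b \<in> V'" "\<And>x. x \<in> X \<Longrightarrow> ln (\<beta> x b) \<le> ln (\<beta> x a) + ?q e y'" for a b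
        proof -
          have "\<beta>' b \<le> exp (?q e y') * \<beta>' a"
            unfolding \<beta>'_def sum_distrib_left
          proof (rule sum_mono)
            fix x assume x: "x \<in> X"
            have p: "\<beta> x a > 0" "\<beta> x b > 0" using pos[OF x] V'V[OF x] that by auto
            have "exp (ln (\<beta> x b)) \<le> exp (ln (\<beta> x a) + ?q e y')" using that(3)[OF x] by simp
            then show "\<beta> x b \<le> exp (?q e y') * \<beta> x a" using p by (simp add: exp_add mult.commute)
          qed
          moreover have p: "\<beta>' a > 0" "\<beta>' b > 0" by (rule \<beta>'_pos; rule that)+
          ultimately have "ln (\<beta>' b) \<le> ln (exp (?q e y') * \<beta>' a)" by simp
          then show ?thesis using p by (simp add: ln_mult)
        qed
        have "ln (\<beta>' y') \<le> ln (\<beta>' y) + ?q e y'"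
          by (rule ln_le[OF yV' elim(2)]) (use elim(1) in \<open>fastforce simp: abs_le_iff\<close>)
        moreover have "ln (\<beta>' y) \<le> ln (\<beta>' y') + ?q e y'"
          by (rule ln_le[OF elim(2) yV']) (use elim(1) in \<open>fastforce simp: abs_le_iff\<close>)
        ultimately show ?case by (simp only: abs_le_iff) linarith
      qed
    qed
    fix B assume B: "B \<in> sets borel" "B \<subseteq> V'"
    have fB: "f -` B \<in> sets borel"
      using continuous_f B(1) by (metis borel_measurable_continuous_onI measurable_sets_borel)
    have mN: "N x \<inter> f -` B \<in> sets m" if "x \<in> X" for x using N(1)[OF that] fB sets_m by auto
    have NW: "W x \<inter> f -` B = N x \<inter> f -` B" if x: "x \<in> X" for x
    proof
      show "W x \<inter> f -` B \<subseteq> N x \<inter> f -` B"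
      proof
        fix p assume p: "p \<in> W x \<inter> f -` B"
        then have "f p \<in> V'" using B(2) by blast
        then have "f p \<in> f ` N x" using x unfolding V'_def by blast
        then obtain p' where p': "p' \<in> N x" "f p' = f p" by auto
        then have "p' = p" using inj_onD[OF inj[OF x]] N(3)[OF x] p by blast
        then show "p \<in> N x \<inter> f -` B" using p p' by blast
      qed
    qed (use N(3)[OF x] in blast)
    have "(\<integral>\<^sup>+y. ennreal (\<beta>' y) * indicator B y \<partial>m)
        = (\<integral>\<^sup>+y. (\<Sum>x\<in>X. ennreal (\<beta> x y) * indicator B y) \<partial>m)"
    proof (rule nn_integral_cong)
      fix y' show "ennreal (\<beta>' y') * indicator B y' = (\<Sum>x\<in>X. ennreal (\<beta> x y') * indicator B y')"
      proof (cases "y' \<in> B")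
        case True
        then have "\<beta> x y' \<ge> 0" if "x \<in> X" for x using pos[OF that] V'V[OF that] B(2) by (meson less_imp_le subsetD)
        then show ?thesis using True by (simp add: \<beta>'_def sum_ennreal)
      qed simp
    qed
    also have "\<dots> = (\<Sum>x\<in>X. \<integral>\<^sup>+y. ennreal (\<beta> x y) * indicator B y \<partial>m)"
    proof (rule nn_integral_sum)
      fix x assume x: "x \<in> X"
      have "(\<lambda>y. ennreal (\<beta> x y) * indicator V' y) \<in> borel_measurable borel"
        using oV' by (intro borel_measurable_continuous_on_times_indicator continuous_on_subset[OF cont V'V] x) auto
      then have "(\<lambda>y. ennreal (\<beta> x y) * indicator V' y * indicator B y) \<in> borel_measurable borel"
        using B(1) by measurable
      also have "(\<lambda>y. ennreal (\<beta> x y) * indicator V' y * indicator B y) = (\<lambda>y. ennreal (\<beta> x y) * indicator B y)"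
        using B(2) by (auto simp: indicator_def fun_eq_iff)
      finally show "(\<lambda>y. ennreal (\<beta> x y) * indicator B y) \<in> borel_measurable m"
        using measurable_cong_sets[OF sets_m refl] by blast
    qed
    also have "\<dots> = (\<Sum>x\<in>X. \<integral>\<^sup>+y. ennreal (\<alpha> y) * indicator (N x \<inter> f -` B) y \<partial>m)"
    proof (rule sum.cong[OF refl])
      fix x assume x: "x \<in> X"
      have "B \<subseteq> V x" using B(2) V'V[OF x] by blast
      from meas[OF x B(1) this] show "(\<integral>\<^sup>+y. ennreal (\<beta> x y) * indicator B y \<partial>m)
          = (\<integral>\<^sup>+y. ennreal (\<alpha> y) * indicator (N x \<inter> f -` B) y \<partial>m)" unfolding NW[OF x] .
    qed
    also have "\<dots> = (\<integral>\<^sup>+y. (\<Sum>x\<in>X. ennreal (\<alpha> y) * indicator (N x \<inter> f -` B) y) \<partial>m)"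
      using borel_measurable_log_lipschitz(2)[OF \<alpha>] mN
      by (intro nn_integral_sum[symmetric] borel_measurable_times_ennreal borel_measurable_indicator) auto
    also have "\<dots> = (\<integral>\<^sup>+y. ennreal (\<alpha> y) * indicator (f -` B) y \<partial>m)"
    proof (rule nn_integral_cong)
      fix p
      have "(\<Sum>x\<in>X. indicator (N x \<inter> f -` B) p) = (indicator (\<Union>x\<in>X. N x \<inter> f -` B) p :: ennreal)"
        using disjN by (intro indicator_UN_disjoint[symmetric] finX) (auto simp: disjoint_family_on_def)
      also have "(\<Union>x\<in>X. N x \<inter> f -` B) = f -` B"
      proof
        show "f -` B \<subseteq> (\<Union>x\<in>X. N x \<inter> f -` B)"
        proof
          fix p assume p: "p \<in> f -` B"
          then have "f p \<in> V'" using B(2) by blast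
          then have "p \<in> (\<Union>x\<in>X. N x)" unfolding V'_def by blast
          then show "p \<in> (\<Union>x\<in>X. N x \<inter> f -` B)" using p by blast
        qed
      qed blast
      finally show "(\<Sum>x\<in>X. ennreal (\<alpha> p) * indicator (N x \<inter> f -` B) p) = ennreal (\<alpha> p) * indicator (f -` B) p"
        by (simp only: sum_distrib_left[symmetric])
    qed
    finally show "(\<integral>\<^sup>+y. ennreal (\<beta>' y) * indicator B y \<partial>m) = (\<integral>\<^sup>+y. ennreal (\<alpha> y) * indicator (f -` B) y \<partial>m)" .
  qed
qed

text \<open>
  The local densities agree wherever two of them are defined, so they fit together to a global one,
  and at each point and in each chart its slope can be read off from the local density built there.
  The integral identity extends from small sets to all Borel sets by a finite cover.
\<close>

theorem transfer:
  assumes \<alpha>: "\<alpha> \<in> log_lipschitz A G K" and K: "K \<ge> 0"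
  obtains \<alpha>' where "\<alpha>' \<in> log_lipschitz A G ((K + CARD('n) * \<Gamma> / l) / l)"
    "\<And>B. B \<in> sets borel \<Longrightarrow>
      (\<integral>\<^sup>+y. ennreal (\<alpha>' y) * indicator B y \<partial>m) = (\<integral>\<^sup>+y. ennreal (\<alpha> y) * indicator (f -` B) y \<partial>m)"
proof -
  let ?q = "\<lambda>e c y y'. ((K + CARD('n) * \<Gamma> / l) / l + e) * tangent_norm G c (chart_map c y) (chart_map c y' - chart_map c y)"
  define is_density where "is_density V \<beta> \<longleftrightarrow> open V \<and> (\<forall>y\<in>V. \<beta> y > 0) \<and> continuous_on V \<beta> \<and>
    (\<forall>B\<in>sets borel. B \<subseteq> V \<longrightarrow> (\<integral>\<^sup>+y. ennreal (\<beta> y) * indicator B y \<partial>m)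
       = (\<integral>\<^sup>+y. ennreal (\<alpha> y) * indicator (f -` B) y \<partial>m))" for V and \<beta> :: "'a \<Rightarrow> real"
  have ex: "\<exists>V \<beta>. y \<in> V \<and> is_density V \<beta> \<and> (\<forall>e>0. \<forall>\<^sub>F y' in nhds y. \<bar>ln (\<beta> y') - ln (\<beta> y)\<bar> \<le> ?q e c y y')"
    if c: "c \<in> A" "y \<in> chart_dom c" for c y
  proof (rule transfer_local[OF \<alpha> K c], goal_cases)
    case prems: (1 V \<beta>)
    show ?case
      unfolding is_density_def
      by (intro exI[of _ V] exI[of _ \<beta>] conjI allI ballI impI prems)
  qed
  have "\<exists>V \<beta>. y \<in> V \<and> is_density V \<beta>" for y
  proof -
    obtain c where "c \<in> A" "y \<in> chart_dom c" by (rule chart_at)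
    from ex[OF this] show ?thesis by blast
  qed
  then obtain V \<beta> where V: "\<And>y. y \<in> V y" "\<And>y. is_density (V y) (\<beta> y)" by metis
  define \<alpha>' where "\<alpha>' y = \<beta> y y" for y
  have agree: "\<alpha>' y = b y" if "is_density U b" "y \<in> U" for U b y
  proof -
    have "\<beta> y y = b y"
    proof (rule continuous_density_unique[of "V y \<inter> U" "\<beta> y" b y])
      show "open (V y \<inter> U)" using that V(2)[of y] by (auto simp: is_density_def)
      show "continuous_on (V y \<inter> U) (\<beta> y)" "continuous_on (V y \<inter> U) b"
        using that V(2)[of y] unfolding is_density_def by (meson Int_lower1 Int_lower2 continuous_on_subset)+
      show "(\<integral>\<^sup>+z. ennreal (\<beta> y z) * indicator B z \<partial>m) = (\<integral>\<^sup>+z. ennreal (b z) * indicator B z \<partial>m)"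
        if "B \<in> sets borel" "B \<subseteq> V y \<inter> U" for B
        using \<open>is_density U b\<close> V(2)[of y] that unfolding is_density_def by simp
    qed (use that V[of y] in \<open>auto simp: is_density_def\<close>)
    then show ?thesis by (simp add: \<alpha>'_def)
  qed
  have pos: "\<alpha>' y > 0" for y using V[of y] by (simp add: \<alpha>'_def is_density_def)
  have cls: "\<alpha>' \<in> log_lipschitz A G ((K + CARD('n) * \<Gamma> / l) / l)"
    unfolding log_lipschitz_def
  proof (intro CollectI conjI allI ballI impI pos)
    fix c y and e :: real assume c: "c \<in> A" "y \<in> chart_dom c" and e: "e > 0"
    obtain U b where U: "y \<in> U" "is_density U b"
      and slope: "\<forall>\<^sub>F y' in nhds y. \<bar>ln (b y') - ln (b y)\<bar> \<le> ?q e c y y'"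
      using ex[OF c] e by blast
    have "open U" using U(2) by (simp add: is_density_def)
    then have "\<forall>\<^sub>F y' in nhds y. y' \<in> U" using U(1) by (rule eventually_nhds_in_open)
    with slope show "\<forall>\<^sub>F y' in nhds y. \<bar>ln (\<alpha>' y') - ln (\<alpha>' y)\<bar> \<le> ?q e c y y'"
      by eventually_elim (simp add: agree[OF U(2)] U(1))
  qed
  have loc: "(\<integral>\<^sup>+z. ennreal (\<alpha>' z) * indicator B z \<partial>m) = (\<integral>\<^sup>+z. ennreal (\<alpha> z) * indicator (f -` B) z \<partial>m)"
    if B: "B \<in> sets borel" "B \<subseteq> V y" for B y
  proof -
    have "(\<integral>\<^sup>+z. ennreal (\<alpha>' z) * indicator B z \<partial>m) = (\<integral>\<^sup>+z. ennreal (\<beta> y z) * indicator B z \<partial>m)"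
      using agree[OF V(2)[of y]] B(2) by (intro nn_integral_cong) (auto simp: indicator_def)
    then show ?thesis using V(2)[of y] B by (simp add: is_density_def)
  qed
  let ?N1 = "density m (\<lambda>x. ennreal (\<alpha>' x))" and ?N2 = "distr (density m (\<lambda>x. ennreal (\<alpha> x))) borel f"
  have mf: "f \<in> borel \<rightarrow>\<^sub>M borel" by (rule borel_measurable_continuous_onI[OF continuous_f])
  have sd: "sets (density m g) = sets borel" for g using sets_m by simp
  have mf': "f \<in> density m (\<lambda>x. ennreal (\<alpha> x)) \<rightarrow>\<^sub>M borel"
    using mf measurable_cong_sets[OF sd refl] by blast
  have sp: "space m = UNIV" using sets_eq_imp_space_eq[OF sets_m] by simp
  have N2: "emeasure ?N2 B = (\<integral>\<^sup>+z. ennreal (\<alpha> z) * indicator (f -` B) z \<partial>m)" if "B \<in> sets borel" for B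
    using emeasure_distr[OF mf' that] emeasure_density_m[OF \<alpha> measurable_sets_borel[OF mf that]] by (simp add: sp)
  have N1: "emeasure ?N1 B = (\<integral>\<^sup>+z. ennreal (\<alpha>' z) * indicator B z \<partial>m)" if "B \<in> sets borel" for B
    by (rule emeasure_density_m[OF cls that])
  have eq: "emeasure ?N1 B = emeasure ?N2 B" if "finite F" "B \<in> sets borel" "B \<subseteq> (\<Union>y\<in>F. V y)" for F B
    using that
  proof (induction F arbitrary: B rule: finite_induct)
    case (insert y F)
    have oV: "open (V y)" using V(2)[of y] by (simp add: is_density_def)
    have B: "B \<inter> V y \<in> sets borel" "B - V y \<in> sets borel" using insert.prems oV by auto
    have "emeasure ?N1 (B \<inter> V y) = emeasure ?N2 (B \<inter> V y)"
      using loc[OF B(1) Int_lower2] by (simp only: N1[OF B(1)] N2[OF B(1)])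
    moreover have "emeasure ?N1 (B - V y) = emeasure ?N2 (B - V y)"
      using insert.prems B by (intro insert.IH) auto
    moreover have "emeasure ?N1 B = emeasure ?N1 (B \<inter> V y) + emeasure ?N1 (B - V y)"
      using B sets_m by (subst plus_emeasure) (auto intro!: arg_cong[where f = "emeasure ?N1"])
    moreover have "emeasure ?N2 B = emeasure ?N2 (B \<inter> V y) + emeasure ?N2 (B - V y)"
      using B by (subst plus_emeasure) (auto intro!: arg_cong[where f = "emeasure ?N2"])
    ultimately show ?case by simp
  qed simp
  obtain F where F: "finite F" "UNIV \<subseteq> (\<Union>y\<in>F. V y)"
  proof -
    have "UNIV \<subseteq> \<Union> (range V)" using V(1) by blast
    moreover have "\<And>y. open (V y)" using V(2) by (simp add: is_density_def)
    ultimately show thesis using compactE_image[OF compact_M, of UNIV V] that by metis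
  qed
  show thesis
    by (rule that[OF cls]) (use eq[OF F(1)] F(2) N1 N2 in auto)
qed

end

section \<open>Entropy of asymptotically equal measures\<close>

text \<open>
  Splitting a mass \<open>s\<close> into at most \<open>M\<close> pieces raises its entropy term by at most \<open>s * ln M\<close>. The lower
  bound holds because each piece is at most \<open>s\<close>, the upper one follows from \<open>ln x \<le> x - 1\<close> at
  \<open>x = s / (p * M)\<close>.
\<close>

lemma entropy_of_pieces:
  fixes p :: "'i \<Rightarrow> real"
  assumes X: "finite X" "card X \<le> M" and M: "M \<ge> 1" and p: "\<And>x. x \<in> X \<Longrightarrow> p x \<ge> 0"
  defines "s \<equiv> sum p X"
  shows "- s * ln s \<le> (\<Sum>x\<in>X. - p x * ln (p x))"
    and "(\<Sum>x\<in>X. - p x * ln (p x)) \<le> - s * ln s + s * ln (real M)"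
proof -
  have s0: "s \<ge> 0" unfolding s_def using p by (rule sum_nonneg)
  have ps: "p x \<le> s" if "x \<in> X" for x
    unfolding s_def using X p that by (intro member_le_sum) auto
  have "- p x * ln s \<le> - p x * ln (p x)" if "x \<in> X" for x
  proof (cases "p x = 0")
    case False
    then have "p x > 0" using p that by force
    then have "ln (p x) \<le> ln s" using ps[OF that] by simp
    then show ?thesis using \<open>p x > 0\<close> by (simp add: mult_left_mono)
  qed simp
  then have "(\<Sum>x\<in>X. - p x * ln s) \<le> (\<Sum>x\<in>X. - p x * ln (p x))" by (rule sum_mono)
  then show "- s * ln s \<le> (\<Sum>x\<in>X. - p x * ln (p x))"
    by (simp add: s_def sum_distrib_right sum_negf)
  have "- p x * ln (p x) \<le> p x * (ln (real M) - ln s - 1) + s / M" if x: "x \<in> X" for x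
  proof (cases "p x = 0")
    case False
    then have px: "p x > 0" using p x by force
    then have s: "s > 0" using ps[OF x] by simp
    have "ln (s / (p x * M)) \<le> s / (p x * M) - 1"
      by (rule ln_le_minus_one) (use px s M in auto)
    then have "p x * ln (s / (p x * M)) \<le> p x * (s / (p x * M) - 1)"
      using px by (simp only: mult_le_cancel_left_pos)
    also have "\<dots> = s / M - p x" using px M by (simp add: field_simps)
    also have "ln (s / (p x * M)) = ln s - ln (p x) - ln (real M)"
      using px s M by (simp add: ln_div ln_mult)
    finally show ?thesis by (simp add: algebra_simps)
  qed (use s0 M in auto)
  then have "(\<Sum>x\<in>X. - p x * ln (p x)) \<le> (\<Sum>x\<in>X. p x * (ln (real M) - ln s - 1) + s / M)"
    by (rule sum_mono)
  also have "\<dots> = s * (ln (real M) - ln s - 1) + card X * (s / M)"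
    by (simp add: sum.distrib sum_distrib_right[symmetric] s_def)
  also have "card X * (s / M) \<le> M * (s / M)"
    using X s0 by (intro mult_right_mono) auto
  finally show "(\<Sum>x\<in>X. - p x * ln (p x)) \<le> - s * ln s + s * ln (real M)"
    using M by (simp add: algebra_simps)
qed

text \<open>
  The entropy term can increase only by the entropy term of the difference (subadditivity), and it
  decreases at most with slope \<open>1\<close>.
\<close>

lemma entropy_term_modulus:
  fixes s t :: real
  assumes "0 \<le> s" "s \<le> 1" "0 \<le> t" "t \<le> 1"
  shows "\<bar>(- s * ln s) - (- t * ln t)\<bar> \<le> - \<bar>s - t\<bar> * ln \<bar>s - t\<bar> + \<bar>s - t\<bar>"
proof -
  have *: "\<bar>(- s * ln s) - (- t * ln t)\<bar> \<le> - \<bar>s - t\<bar> * ln \<bar>s - t\<bar> + \<bar>s - t\<bar>"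
    if st: "0 \<le> s" "s < t" "t \<le> 1" for s t :: real
  proof -
    define d where "d = t - s"
    have d: "d > 0" "d \<le> 1" "t = s + d" using st by (auto simp: d_def)
    have "- t * ln t \<le> - s * ln s - d * ln d"
      using entropy_of_pieces(1)[of "{True, False}" 2 "\<lambda>x. if x then s else d"] st d by simp
    moreover have "- s * ln s - (- t * ln t) \<le> d"
    proof (cases "s = 0")
      case True
      have "ln d \<le> 0" using d by simp
      then show ?thesis using d True by (simp del: ln_le_zero_iff)
    next
      case False
      then have s: "s > 0" using st by simp
      have "ln (t / s) \<le> t / s - 1" using s st by (intro ln_le_minus_one) auto
      then have "s * ln (t / s) \<le> s * (t / s - 1)" using s by (simp only: mult_le_cancel_left_pos)
      also have "\<dots> = d" using s by (simp add: field_simps d)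
      finally have "s * ln t - s * ln s \<le> d" using s st by (simp add: ln_div algebra_simps)
      moreover have "d * ln t \<le> 0" using d st s by (intro mult_nonneg_nonpos) auto
      ultimately show ?thesis by (simp add: d algebra_simps)
    qed
    moreover have "d * ln d \<le> 0" using d by (intro mult_nonneg_nonpos) auto
    moreover have "\<bar>s - t\<bar> = d" using d by simp
    ultimately show ?thesis using d by simp
  qed
  consider "s < t" | "s = t" | "t < s" by linarith
  then show ?thesis
  proof cases
    case 3
    then show ?thesis using *[of t s] assms by (simp add: abs_minus_commute)
  qed (use * assms in auto)
qed

lemma neg_mult_ln_le_1:
  fixes x :: real
  assumes "x \<ge> 0"
  shows "- x * ln x \<le> 1"
proof (cases "x = 0")
  case False
  then have x: "x > 0" using assms by simp
  have "ln (1 / x) \<le> 1 / x - 1" using x by (intro ln_le_minus_one) auto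
  then have "x * ln (1 / x) \<le> x * (1 / x - 1)" using x by (simp only: mult_le_cancel_left_pos)
  then show ?thesis using x by (simp add: ln_div algebra_simps)
qed simp

lemma shannon_entropy_eq_sum: "shannon_entropy \<mu> P = (\<Sum>B\<in>P. - measure \<mu> B * ln (measure \<mu> B))"
  by (simp add: shannon_entropy_def sum_negf)

lemma (in prob_space) sum_measure_partition:
  assumes R: "finite R" "R \<subseteq> sets M" "disjoint R"
  shows "(\<Sum>r\<in>R. prob r) = prob (\<Union>R)"
  using finite_measure_finite_Union[of R "\<lambda>x. x"] assms
  by (auto simp: disjoint_family_on_def disjoint_def)

text \<open>
  Each atom of \<open>R\<close> is a disjoint union of at most \<open>M\<close> atoms of \<open>Q\<close>, so \<open>entropy_of_pieces\<close> applies to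
  every atom of \<open>R\<close>; the errors \<open>\<mu> r * ln M\<close> add up to \<open>ln M\<close>.
\<close>

lemma shannon_entropy_refinement:
  assumes "prob_space \<mu>" and sets: "sets \<mu> = sets borel"
    and Q: "finite_borel_partition Q" and R: "finite_borel_partition R"
    and ref: "\<And>q. q \<in> Q \<Longrightarrow> \<exists>r\<in>R. q \<subseteq> r"
    and card: "\<And>r. r \<in> R \<Longrightarrow> card {q\<in>Q. q \<subseteq> r} \<le> M" and M: "M \<ge> 1"
  shows "shannon_entropy \<mu> R \<le> shannon_entropy \<mu> Q"
    and "shannon_entropy \<mu> Q \<le> shannon_entropy \<mu> R + ln (real M)"
proof -
  interpret prob_space \<mu> by fact
  let ?\<eta> = "\<lambda>B. - prob B * ln (prob B)"
  have fin: "finite Q" "finite R" and pQ: "partition_on UNIV Q" and pR: "partition_on UNIV R"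
    and mQ: "Q \<subseteq> sets \<mu>" and mR: "R \<subseteq> sets \<mu>"
    using Q R by (auto simp: finite_borel_partition_def sets)
  have djR: "r = r'" if "r \<in> R" "r' \<in> R" "x \<in> r" "x \<in> r'" for r r' x
    using partition_onD2[OF pR] that by (auto simp: disjoint_def)
  have ne: "q \<noteq> {}" if "q \<in> Q" for q using partition_onD3[OF pQ] that by auto
  have "(\<Sum>q\<in>Q. ?\<eta> q) = (\<Sum>q\<in>(\<Union>r\<in>R. {q\<in>Q. q \<subseteq> r}). ?\<eta> q)"
    using ref by (intro sum.cong) auto
  also have "\<dots> = (\<Sum>r\<in>R. \<Sum>q\<in>{q\<in>Q. q \<subseteq> r}. ?\<eta> q)"
  proof (rule sum.UNION_disjoint)
    show "\<forall>i\<in>R. \<forall>j\<in>R. i \<noteq> j \<longrightarrow> {q\<in>Q. q \<subseteq> i} \<inter> {q\<in>Q. q \<subseteq> j} = {}"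
      using djR ne by fast
  qed (use fin in auto)
  finally have HQ: "shannon_entropy \<mu> Q = (\<Sum>r\<in>R. \<Sum>q\<in>{q\<in>Q. q \<subseteq> r}. ?\<eta> q)"
    by (simp only: shannon_entropy_eq_sum)
  have pr: "prob r = (\<Sum>q\<in>{q\<in>Q. q \<subseteq> r}. prob q)" if r: "r \<in> R" for r
  proof -
    have "\<Union>{q\<in>Q. q \<subseteq> r} = r"
    proof
      show "r \<subseteq> \<Union>{q\<in>Q. q \<subseteq> r}"
      proof
        fix x assume x: "x \<in> r"
        obtain q where q: "q \<in> Q" "x \<in> q" using partition_onD1[OF pQ] by auto
        then obtain r' where "r' \<in> R" "q \<subseteq> r'" using ref by blast
        then have "r' = r" using djR r x q by blast
        then show "x \<in> \<Union>{q\<in>Q. q \<subseteq> r}" using q \<open>q \<subseteq> r'\<close> by blast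
      qed
    qed auto
    moreover have "disjoint {q\<in>Q. q \<subseteq> r}"
      using partition_onD2[OF pQ] by (auto simp: disjoint_def)
    ultimately show ?thesis
      using sum_measure_partition[of "{q\<in>Q. q \<subseteq> r}"] fin mQ by fastforce
  qed
  have bounds: "?\<eta> r \<le> (\<Sum>q\<in>{q\<in>Q. q \<subseteq> r}. ?\<eta> q)"
      "(\<Sum>q\<in>{q\<in>Q. q \<subseteq> r}. ?\<eta> q) \<le> ?\<eta> r + prob r * ln (real M)" if "r \<in> R" for r
    using entropy_of_pieces[of "{q\<in>Q. q \<subseteq> r}" M prob] fin card[OF that] M
    by (auto simp: pr[OF that])
  show "shannon_entropy \<mu> R \<le> shannon_entropy \<mu> Q"
    unfolding HQ unfolding shannon_entropy_eq_sum by (rule sum_mono) (rule bounds)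
  have "shannon_entropy \<mu> Q \<le> (\<Sum>r\<in>R. ?\<eta> r + prob r * ln (real M))"
    unfolding HQ by (rule sum_mono) (rule bounds)
  also have "\<dots> = shannon_entropy \<mu> R + (\<Sum>r\<in>R. prob r) * ln (real M)"
    by (simp only: shannon_entropy_eq_sum sum.distrib sum_distrib_right)
  also have "(\<Sum>r\<in>R. prob r) = prob (\<Union>R)"
    using fin mR partition_onD2[OF pR] by (intro sum_measure_partition)
  also have "\<dots> = 1"
    using partition_onD1[OF pR] prob_space sets_eq_imp_space_eq[OF sets] by simp
  finally show "shannon_entropy \<mu> Q \<le> shannon_entropy \<mu> R + ln (real M)" by simp
qed

text \<open>
  A continuity estimate of Fannes type: the entropy terms of the \<open>card R\<close> differences sum to at most
  \<open>1 + D * ln M\<close>, by concavity.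
\<close>

lemma shannon_entropy_diff_le:
  assumes "prob_space \<mu>" "prob_space \<nu>"
    and R: "finite R" "card R \<le> M" and M: "M \<ge> 1"
    and D: "(\<Sum>r\<in>R. \<bar>measure \<mu> r - measure \<nu> r\<bar>) \<le> D"
  shows "\<bar>shannon_entropy \<mu> R - shannon_entropy \<nu> R\<bar> \<le> 1 + D + D * ln (real M)"
proof -
  interpret A: prob_space \<mu> by fact
  interpret B: prob_space \<nu> by fact
  let ?d = "\<lambda>r. \<bar>measure \<mu> r - measure \<nu> r\<bar>"
  let ?S = "\<Sum>r\<in>R. ?d r"
  have S0: "?S \<ge> 0" by (rule sum_nonneg) simp
  have "\<bar>shannon_entropy \<mu> R - shannon_entropy \<nu> R\<bar>
      = \<bar>\<Sum>r\<in>R. (- measure \<mu> r * ln (measure \<mu> r)) - (- measure \<nu> r * ln (measure \<nu> r))\<bar>"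
    by (simp only: shannon_entropy_eq_sum sum_subtractf)
  also have "\<dots> \<le> (\<Sum>r\<in>R. \<bar>(- measure \<mu> r * ln (measure \<mu> r)) - (- measure \<nu> r * ln (measure \<nu> r))\<bar>)"
    by (rule sum_abs)
  also have "\<dots> \<le> (\<Sum>r\<in>R. - ?d r * ln (?d r) + ?d r)"
    by (intro sum_mono entropy_term_modulus) auto
  also have "\<dots> = (\<Sum>r\<in>R. - ?d r * ln (?d r)) + ?S"
    by (rule sum.distrib)
  also have "(\<Sum>r\<in>R. - ?d r * ln (?d r)) \<le> - ?S * ln ?S + ?S * ln (real M)"
    using R M by (intro entropy_of_pieces) auto
  also have "- ?S * ln ?S \<le> 1" by (rule neg_mult_ln_le_1[OF S0])
  finally have "\<bar>shannon_entropy \<mu> R - shannon_entropy \<nu> R\<bar> \<le> 1 + ?S * ln (real M) + ?S" by simp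
  moreover have "?S * ln (real M) \<le> D * ln (real M)"
    using D M by (intro mult_right_mono) auto
  ultimately show ?thesis using D by linarith
qed

text \<open>
  The sum of the absolute differences is attained by two sets, the union of the atoms on which \<open>\<mu>\<close>
  is at least \<open>\<nu>\<close> and the union of the others. Both are preimages of Borel sets under \<open>T\<close>.
\<close>

lemma sum_abs_diff_measure_le:
  assumes "prob_space \<mu>" "prob_space \<nu>" and sets: "sets \<mu> = sets borel" "sets \<nu> = sets borel"
    and T: "T \<in> borel \<rightarrow>\<^sub>M borel"
    and R: "finite R" "disjoint R" "\<And>r. r \<in> R \<Longrightarrow> \<exists>B\<in>sets borel. r = T -` B"
    and le: "\<And>B. B \<in> sets borel \<Longrightarrow> \<bar>measure \<mu> (T -` B) - measure \<nu> (T -` B)\<bar> \<le> \<epsilon>"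
  shows "(\<Sum>r\<in>R. \<bar>measure \<mu> r - measure \<nu> r\<bar>) \<le> 2 * \<epsilon>"
proof -
  interpret A: prob_space \<mu> by fact
  interpret B: prob_space \<nu> by fact
  have part: "\<bar>\<Sum>r\<in>S. measure \<mu> r - measure \<nu> r\<bar> \<le> \<epsilon>" if S: "S \<subseteq> R" for S
  proof -
    have fS: "finite S" and dS: "disjoint S" using R S by (auto simp: disjoint_def finite_subset)
    obtain b where b: "\<And>r. r \<in> S \<Longrightarrow> b r \<in> sets borel \<and> r = T -` b r"
      using R(3) S by (metis subsetD)
    then have U: "\<Union>S = T -` (\<Union>r\<in>S. b r)" by blast
    have bm: "(\<Union>r\<in>S. b r) \<in> sets borel" using fS b by auto
    have Sm: "S \<subseteq> sets borel" using b measurable_sets_borel[OF T] by (metis subsetI)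
    show ?thesis
      using le[OF bm] A.sum_measure_partition[OF fS _ dS] B.sum_measure_partition[OF fS _ dS] Sm
      by (simp add: sum_subtractf sets U)
  qed
  let ?P = "{r\<in>R. measure \<mu> r \<ge> measure \<nu> r}" and ?N = "{r\<in>R. \<not> measure \<mu> r \<ge> measure \<nu> r}"
  have "(\<Sum>r\<in>R. \<bar>measure \<mu> r - measure \<nu> r\<bar>)
      = (\<Sum>r\<in>?P. \<bar>measure \<mu> r - measure \<nu> r\<bar>) + (\<Sum>r\<in>?N. \<bar>measure \<mu> r - measure \<nu> r\<bar>)"
    using R(1) by (subst sum.union_disjoint[symmetric]) (auto intro!: sum.cong)
  also have "(\<Sum>r\<in>?P. \<bar>measure \<mu> r - measure \<nu> r\<bar>) = (\<Sum>r\<in>?P. measure \<mu> r - measure \<nu> r)"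
    by (rule sum.cong) auto
  also have "(\<Sum>r\<in>?N. \<bar>measure \<mu> r - measure \<nu> r\<bar>) = - (\<Sum>r\<in>?N. measure \<mu> r - measure \<nu> r)"
    unfolding sum_negf[symmetric] by (rule sum.cong) auto
  finally show ?thesis using part[of ?P] part[of ?N] by auto
qed

lemma seq_iter_add: "seq_iter f k (i + j) = seq_iter f (k + i) j \<circ> seq_iter f k i"
  by (induction j) (auto simp: comp_assoc add.assoc)

lemma measurable_seq_iter:
  assumes "\<And>n. f n \<in> borel \<rightarrow>\<^sub>M borel"
  shows "seq_iter f k n \<in> borel \<rightarrow>\<^sub>M borel"
  by (induction n) (use assms in \<open>auto intro: measurable_comp\<close>)

text \<open>
  The join of the pulled back partitions over the times \<open>k \<le> i < n\<close>. Choosing \<open>C i\<close> for all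
  \<open>i < n\<close> makes the case \<open>k = 0\<close> literally \<open>joined_partition\<close>.
\<close>

definition tail_partition :: "(nat \<Rightarrow> 'a \<Rightarrow> 'a) \<Rightarrow> (nat \<Rightarrow> 'a set set) \<Rightarrow> nat \<Rightarrow> nat \<Rightarrow> 'a set set" where
  "tail_partition f P k n =
     {\<Inter>i\<in>{k..<n}. seq_iter f 0 i -` C i | C. \<forall>i<n. C i \<in> P i} - {{}}"

lemma joined_partition_eq_tail: "joined_partition f P n = tail_partition f P 0 n"
  by (simp add: joined_partition_def tail_partition_def lessThan_atLeast0)

lemma card_image_PiE_le:
  fixes P :: "nat \<Rightarrow> 'b set"
  assumes fin: "\<And>i. finite (P i)" and N: "\<And>i. card (P i) \<le> N"
  shows "finite (h ` PiE {..<n} P)" "card (h ` PiE {..<n} P) \<le> N ^ n"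
proof -
  have f: "finite (PiE {..<n} P)" using fin by (intro finite_PiE) auto
  then show "finite (h ` PiE {..<n} P)" by simp
  have "card (h ` PiE {..<n} P) \<le> card (PiE {..<n} P)" by (rule card_image_le[OF f])
  also have "\<dots> = (\<Prod>i<n. card (P i))" by (simp add: card_PiE)
  also have "\<dots> \<le> (\<Prod>i<n. N)" by (rule prod_mono) (use N in auto)
  finally show "card (h ` PiE {..<n} P) \<le> N ^ n" by simp
qed

lemma tail_partition_subset_image_PiE:
  "tail_partition f P k n \<subseteq> (\<lambda>C. \<Inter>i\<in>{k..<n}. seq_iter f 0 i -` C i) ` PiE {..<n} P"
proof
  let ?h = "\<lambda>C. \<Inter>i\<in>{k..<n}. seq_iter f 0 i -` C i"
  fix B assume "B \<in> tail_partition f P k n"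
  then obtain C where C: "B = ?h C" "\<forall>i<n. C i \<in> P i" by (auto simp: tail_partition_def)
  then have "B = ?h (restrict C {..<n})" "restrict C {..<n} \<in> PiE {..<n} P" by auto
  then show "B \<in> ?h ` PiE {..<n} P" by blast
qed

lemma tail_partition_finite_card:
  assumes fin: "\<And>i. finite (P i)" and N: "\<And>i. card (P i) \<le> N"
  shows "finite (tail_partition f P k n)" "card (tail_partition f P k n) \<le> N ^ n"
proof -
  let ?h = "\<lambda>C. \<Inter>i\<in>{k..<n}. seq_iter f 0 i -` C i"
  note PiE = card_image_PiE_le[of P N ?h n, OF assms]
  show "finite (tail_partition f P k n)"
    by (rule finite_subset[OF tail_partition_subset_image_PiE PiE(1)])
  show "card (tail_partition f P k n) \<le> N ^ n"
    using card_mono[OF PiE(1) tail_partition_subset_image_PiE] PiE(2) by (rule le_trans)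
qed

lemma tail_partition_finite_borel_partition:
  assumes P: "\<And>i. finite_borel_partition (P i)" and f: "\<And>n. f n \<in> borel \<rightarrow>\<^sub>M borel"
  shows "finite_borel_partition (tail_partition f P k n)"
proof -
  have fin: "finite (P i)" and bor: "P i \<subseteq> sets borel" and par: "partition_on UNIV (P i)" for i
    using P[of i] by (auto simp: finite_borel_partition_def)
  have "finite (tail_partition f P k n)"
    using fin by (intro finite_subset[OF tail_partition_subset_image_PiE] finite_imageI finite_PiE) auto
  moreover have "tail_partition f P k n \<subseteq> sets borel"
  proof
    fix B assume "B \<in> tail_partition f P k n"
    then obtain C where C: "B = (\<Inter>i\<in>{k..<n}. seq_iter f 0 i -` C i)" "\<forall>i<n. C i \<in> P i"
      by (auto simp: tail_partition_def)
    have "seq_iter f 0 i -` C i \<in> sets borel" if "i \<in> {k..<n}" for i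
    proof -
      have "C i \<in> sets borel" using C(2) bor[of i] that by auto
      then show ?thesis by (rule measurable_sets_borel[OF measurable_seq_iter[OF f]])
    qed
    then show "B \<in> sets borel"
      unfolding C(1) by (cases "{k..<n} = {}") auto
  qed
  moreover have "partition_on UNIV (tail_partition f P k n)"
  proof (rule partition_onI)
    show "\<Union> (tail_partition f P k n) = UNIV"
    proof (intro equalityI subsetI UNIV_I)
      fix x
      have "\<exists>B\<in>P i. seq_iter f 0 i x \<in> B" for i
        using partition_onD1[OF par[of i]] by auto
      then obtain C where C: "\<And>i. C i \<in> P i" "\<And>i. seq_iter f 0 i x \<in> C i" by metis
      let ?B = "\<Inter>i\<in>{k..<n}. seq_iter f 0 i -` C i"
      have "x \<in> ?B" using C by auto
      moreover from this have "?B \<in> tail_partition f P k n"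
        using C unfolding tail_partition_def by blast
      ultimately show "x \<in> \<Union> (tail_partition f P k n)" by blast
    qed
    fix B B' assume B: "B \<in> tail_partition f P k n" "B' \<in> tail_partition f P k n" "B \<noteq> B'"
    show "disjnt B B'"
    proof (rule ccontr)
      assume "\<not> disjnt B B'"
      then obtain x where x: "x \<in> B" "x \<in> B'" by (auto simp: disjnt_def)
      obtain C C' where C: "B = (\<Inter>i\<in>{k..<n}. seq_iter f 0 i -` C i)" "\<forall>i<n. C i \<in> P i"
        "B' = (\<Inter>i\<in>{k..<n}. seq_iter f 0 i -` C' i)" "\<forall>i<n. C' i \<in> P i"
        using B by (auto simp: tail_partition_def)
      have "C i = C' i" if i: "i \<in> {k..<n}" for i
      proof (rule ccontr)
        assume ne: "C i \<noteq> C' i"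
        have "C i \<in> P i" "C' i \<in> P i" using C i by auto
        then have "C i \<inter> C' i = {}"
          using partition_onD2[OF par[of i]] ne by (simp add: disjoint_def)
        moreover have "seq_iter f 0 i x \<in> C i \<inter> C' i" using x i unfolding C(1,3) by blast
        ultimately show False by blast
      qed
      then have "B = B'" unfolding C(1,3) by (intro INF_cong) auto
      then show False using B(3) by simp
    qed
  qed (auto simp: tail_partition_def)
  ultimately show ?thesis by (simp add: finite_borel_partition_def)
qed

text \<open>
  Dropping the first \<open>k\<close> partitions costs at most \<open>k * ln N\<close> of entropy for either measure. The atoms
  that remain are preimages under \<open>seq_iter f 0 k\<close>, on which the measures differ by at most \<open>\<epsilon>\<close>, and
  there are at most \<open>N ^ n\<close> of them.
\<close>

lemma joined_partition_entropy_diff_le: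
  fixes f :: "nat \<Rightarrow> 'a::topological_space \<Rightarrow> 'a"
  assumes f: "\<And>n. f n \<in> borel \<rightarrow>\<^sub>M borel"
    and P: "\<And>i. finite_borel_partition (P i)" and N: "\<And>i. card (P i) \<le> N" "N \<ge> 1"
    and prob: "prob_space \<mu>" "prob_space \<nu>" and sets: "sets \<mu> = sets borel" "sets \<nu> = sets borel"
    and le: "\<And>B. B \<in> sets borel \<Longrightarrow>
      \<bar>measure \<mu> (seq_iter f 0 k -` B) - measure \<nu> (seq_iter f 0 k -` B)\<bar> \<le> \<epsilon>"
    and kn: "k \<le> n"
  shows "\<bar>shannon_entropy \<mu> (joined_partition f P n) - shannon_entropy \<nu> (joined_partition f P n)\<bar>
    \<le> 1 + 2 * \<epsilon> + k * ln (real N) + 2 * \<epsilon> * (n * ln (real N))"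
proof -
  let ?Q = "tail_partition f P 0 n" and ?R = "tail_partition f P k n"
  have fin: "finite (P i)" for i using P[of i] by (auto simp: finite_borel_partition_def)
  note part = tail_partition_finite_borel_partition[of P f, OF P f]
  have Rdis: "disjoint ?R" using part[of k n] by (auto simp: finite_borel_partition_def dest: partition_onD2)
  have split: "(\<Inter>i\<in>{0..<n}. seq_iter f 0 i -` C i) =
      (\<Inter>i\<in>{..<k}. seq_iter f 0 i -` C i) \<inter> (\<Inter>i\<in>{k..<n}. seq_iter f 0 i -` C i)" for C
  proof -
    have "{0..<n} = {..<k} \<union> {k..<n}" using kn by auto
    then show ?thesis by (simp add: INT_Un)
  qed
  have ref: "\<exists>r\<in>?R. q \<subseteq> r" if q: "q \<in> ?Q" for q
  proof -
    obtain C where C: "q = (\<Inter>i\<in>{0..<n}. seq_iter f 0 i -` C i)" "\<forall>i<n. C i \<in> P i" "q \<noteq> {}"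
      using q by (auto simp: tail_partition_def)
    then have "(\<Inter>i\<in>{k..<n}. seq_iter f 0 i -` C i) \<in> ?R" "q \<subseteq> (\<Inter>i\<in>{k..<n}. seq_iter f 0 i -` C i)"
      unfolding tail_partition_def split by blast+
    then show ?thesis by blast
  qed
  have card: "card {q\<in>?Q. q \<subseteq> r} \<le> N ^ k" if r: "r \<in> ?R" for r
  proof -
    let ?h = "\<lambda>C. (\<Inter>i\<in>{..<k}. seq_iter f 0 i -` C i) \<inter> r"
    have "{q\<in>?Q. q \<subseteq> r} \<subseteq> ?h ` PiE {..<k} P"
    proof
      fix q assume q: "q \<in> {q\<in>?Q. q \<subseteq> r}"
      then obtain C where C: "q = (\<Inter>i\<in>{0..<n}. seq_iter f 0 i -` C i)" "\<forall>i<n. C i \<in> P i" "q \<noteq> {}"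
        by (auto simp: tail_partition_def)
      let ?r = "\<Inter>i\<in>{k..<n}. seq_iter f 0 i -` C i"
      have "?r \<in> ?R" "q \<subseteq> ?r"
        using C unfolding tail_partition_def split by blast+
      moreover obtain x where "x \<in> q" using C(3) by blast
      ultimately have "?r \<inter> r \<noteq> {}" using q by blast
      with \<open>?r \<in> ?R\<close> have req: "?r = r"
        using Rdis r unfolding disjoint_def by metis
      have "q = ?h C" using C(1) split[of C] req by (simp only:)
      also have "?h C = ?h (restrict C {..<k})" by (rule arg_cong[where f = "\<lambda>X. X \<inter> r"]) auto
      finally have "q = ?h (restrict C {..<k})" .
      moreover have "restrict C {..<k} \<in> PiE {..<k} P" using C(2) kn by auto
      ultimately show "q \<in> ?h ` PiE {..<k} P" by blast
    qed
    from card_mono[OF card_image_PiE_le(1)[of P N, OF fin N(1)] this]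
      card_image_PiE_le(2)[of P N ?h k, OF fin N(1)]
    show ?thesis by (rule le_trans)
  qed
  have Nk: "N ^ k \<ge> 1" "N ^ n \<ge> 1" using N(2) by auto
  have lnN: "ln (real (N ^ j)) = j * ln (real N)" for j
    using N(2) by (simp add: ln_realpow)
  have R: "\<exists>B\<in>sets borel. r = seq_iter f 0 k -` B" if r: "r \<in> ?R" for r
  proof -
    obtain C where C: "r = (\<Inter>i\<in>{k..<n}. seq_iter f 0 i -` C i)" "\<forall>i<n. C i \<in> P i"
      using r by (auto simp: tail_partition_def)
    have "seq_iter f 0 i -` C i = seq_iter f 0 k -` (seq_iter f k (i - k) -` C i)" if "i \<in> {k..<n}" for i
      using seq_iter_add[of f 0 k "i - k"] that by (simp add: vimage_comp)
    then have "r = (\<Inter>i\<in>{k..<n}. seq_iter f 0 k -` (seq_iter f k (i - k) -` C i))"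
      unfolding C(1) by (intro INF_cong refl)
    then have "r = seq_iter f 0 k -` (\<Inter>i\<in>{k..<n}. seq_iter f k (i - k) -` C i)"
      by (simp only: vimage_INT)
    moreover have "seq_iter f k (i - k) -` C i \<in> sets borel" if "i \<in> {k..<n}" for i
    proof -
      have "C i \<in> sets borel" using C(2) P[of i] that by (auto simp: finite_borel_partition_def)
      then show ?thesis by (rule measurable_sets_borel[OF measurable_seq_iter[OF f]])
    qed
    then have "(\<Inter>i\<in>{k..<n}. seq_iter f k (i - k) -` C i) \<in> sets borel"
      by (cases "{k..<n} = {}") auto
    ultimately show ?thesis by blast
  qed
  have "(\<Sum>r\<in>?R. \<bar>measure \<mu> r - measure \<nu> r\<bar>) \<le> 2 * \<epsilon>"
    using tail_partition_finite_card[of P N, OF fin N(1)] Rdis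
    by (intro sum_abs_diff_measure_le[OF prob sets measurable_seq_iter[OF f] _ _ R le]) auto
  then have "\<bar>shannon_entropy \<mu> ?R - shannon_entropy \<nu> ?R\<bar> \<le> 1 + 2 * \<epsilon> + 2 * \<epsilon> * ln (real (N ^ n))"
    using tail_partition_finite_card[of P N, OF fin N(1)] Nk by (intro shannon_entropy_diff_le[OF prob])
  moreover have "shannon_entropy \<mu> ?R \<le> shannon_entropy \<mu> ?Q"
    "shannon_entropy \<mu> ?Q \<le> shannon_entropy \<mu> ?R + ln (real (N ^ k))"
    using shannon_entropy_refinement[OF prob(1) sets(1) part part ref card Nk(1)] by auto
  moreover have "shannon_entropy \<nu> ?R \<le> shannon_entropy \<nu> ?Q"
    "shannon_entropy \<nu> ?Q \<le> shannon_entropy \<nu> ?R + ln (real (N ^ k))"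
    using shannon_entropy_refinement[OF prob(2) sets(2) part part ref card Nk(1)] by auto
  ultimately show ?thesis
    unfolding lnN joined_partition_eq_tail by linarith
qed

lemma limsup_eq_if_diff_tendsto_0:
  fixes a b :: "nat \<Rightarrow> real"
  assumes "(\<lambda>n. a n - b n) \<longlonglongrightarrow> 0"
  shows "limsup (\<lambda>n. ereal (a n)) = limsup (\<lambda>n. ereal (b n))"
proof -
  have "(\<lambda>n. ereal (a n - b n)) \<longlonglongrightarrow> 0"
    using assms by (simp add: zero_ereal_def)
  then have "limsup (\<lambda>n. ereal (a n - b n) + ereal (b n)) = 0 + limsup (\<lambda>n. ereal (b n))"
    by (intro ereal_limsup_lim_add) auto
  then show ?thesis by simp
qed

text \<open>
  After division by \<open>n\<close>, only the term \<open>2 * \<epsilon> * ln N\<close> of the preceding bound survives as \<open>n\<close> grows,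
  and \<open>\<epsilon>\<close> is arbitrary.
\<close>

theorem partition_entropy_eq_if_asymptotically_equal:
  fixes f :: "nat \<Rightarrow> 'a::topological_space \<Rightarrow> 'a"
  assumes f: "\<And>n. f n \<in> borel \<rightarrow>\<^sub>M borel"
    and P: "\<And>i. finite_borel_partition (P i)" and bdd: "bdd_above (range (\<lambda>n. card (P n)))"
    and prob: "prob_space (\<mu> 0)" "prob_space (\<nu> 0)" and sets: "sets (\<mu> 0) = sets borel" "sets (\<nu> 0) = sets borel"
    and merge: "\<And>\<epsilon>. \<epsilon> > 0 \<Longrightarrow> \<exists>k. \<forall>B\<in>sets borel.
      \<bar>measure (\<mu> 0) (seq_iter f 0 k -` B) - measure (\<nu> 0) (seq_iter f 0 k -` B)\<bar> \<le> \<epsilon>"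
  shows "partition_entropy f P \<mu> = partition_entropy f P \<nu>"
  unfolding partition_entropy_def
proof (rule limsup_eq_if_diff_tendsto_0)
  obtain N0 where N0: "\<And>i. card (P i) \<le> N0" using bdd by (auto simp: bdd_above_def)
  define N where "N = Suc N0"
  have N: "card (P i) \<le> N" "N \<ge> 1" for i using N0[of i] by (auto simp: N_def)
  define L where "L = ln (real N)"
  have L: "L \<ge> 0" using N by (simp add: L_def)
  let ?H = "\<lambda>\<mu> n. shannon_entropy (\<mu> 0) (joined_partition f P n)"
  show "(\<lambda>n. ?H \<mu> n / real n - ?H \<nu> n / real n) \<longlonglongrightarrow> 0"
  proof (rule LIMSEQ_I)
    fix r :: real assume r: "r > 0"
    define \<epsilon> where "\<epsilon> = r / (4 * (L + 1))"
    have \<epsilon>: "\<epsilon> > 0" using r L by (simp add: \<epsilon>_def)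
    from merge[OF this] obtain k where k: "\<And>B. B \<in> sets borel \<Longrightarrow>
      \<bar>measure (\<mu> 0) (seq_iter f 0 k -` B) - measure (\<nu> 0) (seq_iter f 0 k -` B)\<bar> \<le> \<epsilon>" by blast
    define c where "c = 1 + 2 * \<epsilon> + k * L"
    have c: "c \<ge> 0" using \<epsilon> L by (simp add: c_def)
    obtain n0 where n0: "real n0 > 2 * c / r" using reals_Archimedean2 by blast
    have "norm (?H \<mu> n / real n - ?H \<nu> n / real n - 0) < r" if n: "n \<ge> max (Suc n0) k" for n
    proof -
      have n1: "real n > 0" "real n > 2 * c / r" using n n0 by auto
      have "\<bar>?H \<mu> n - ?H \<nu> n\<bar> \<le> c + 2 * \<epsilon> * (n * L)"
        using joined_partition_entropy_diff_le[OF f P N prob sets k] n by (simp add: c_def L_def)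
      then have "\<bar>?H \<mu> n - ?H \<nu> n\<bar> / n \<le> (c + 2 * \<epsilon> * (n * L)) / n"
        using n1 by (intro divide_right_mono) auto
      also have "\<dots> = c / n + 2 * \<epsilon> * L" using n1 by (simp add: field_simps)
      also have "c / n < r / 2" using n1 r by (simp add: field_simps)
      also have "2 * \<epsilon> * L \<le> r / 2"
      proof -
        have "2 * \<epsilon> * L = (r / 2) * (L / (L + 1))" using L by (simp add: \<epsilon>_def divide_simps)
        also have "\<dots> \<le> (r / 2) * 1" using r L by (intro mult_left_mono) auto
        finally show ?thesis by simp
      qed
      finally show ?thesis using n1 by (simp add: diff_divide_distrib[symmetric])
    qed
    then show "\<exists>n0. \<forall>n\<ge>n0. norm (?H \<mu> n / real n - ?H \<nu> n / real n - 0) < r" by blast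
  qed
qed

section \<open>Loss of memory\<close>

text \<open>
  The mean value theorem for \<open>\<lambda>t. ln (exp t - \<kappa>)\<close>, whose derivative \<open>x / (x - \<kappa>)\<close> at \<open>x = exp t\<close> is at
  most \<open>1 / (1 - \<eta>)\<close> as long as \<open>\<kappa> \<le> \<eta> * x\<close>.
\<close>

lemma ln_minus_const_le:
  fixes a b \<kappa> \<eta> :: real
  assumes \<eta>: "0 \<le> \<eta>" "\<eta> < 1" and \<kappa>: "0 \<le> \<kappa>" "\<kappa> \<le> \<eta> * a" "\<kappa> \<le> \<eta> * b" and pos: "a > 0" "b > 0"
  shows "\<bar>ln (a - \<kappa>) - ln (b - \<kappa>)\<bar> \<le> \<bar>ln a - ln b\<bar> / (1 - \<eta>)"
proof -
  have *: "\<bar>ln (a - \<kappa>) - ln (b - \<kappa>)\<bar> \<le> \<bar>ln a - ln b\<bar> / (1 - \<eta>)"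
    if less: "b < a" and \<kappa>b: "\<kappa> \<le> \<eta> * b" and b: "b > 0" for a b
  proof -
    have ab: "ln b < ln a" using less b by simp
    have gt: "\<kappa> < x" "x / (x - \<kappa>) \<le> 1 / (1 - \<eta>)" if "b \<le> x" for x
    proof -
      have "\<kappa> \<le> \<eta> * x" using \<kappa>b mult_left_mono[OF that \<eta>(1)] by linarith
      moreover have "\<eta> * x < x" using \<eta>(2) that b by simp
      ultimately show "\<kappa> < x" by linarith
      show "x / (x - \<kappa>) \<le> 1 / (1 - \<eta>)"
        using \<open>\<kappa> \<le> \<eta> * x\<close> \<open>\<kappa> < x\<close> \<eta>(2) by (simp add: field_simps)
    qed
    have "\<exists>z. ln b < z \<and> z < ln a \<and> ln (exp (ln a) - \<kappa>) - ln (exp (ln b) - \<kappa>)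
        = (ln a - ln b) * (exp z / (exp z - \<kappa>))"
    proof (rule MVT2[OF ab])
      fix t assume t: "ln b \<le> t" "t \<le> ln a"
      then have "b \<le> exp t" using b by (metis exp_le_cancel_iff exp_ln)
      then have "\<kappa> < exp t" by (rule gt)
      then show "((\<lambda>t. ln (exp t - \<kappa>)) has_real_derivative exp t / (exp t - \<kappa>)) (at t)"
        by (auto intro!: derivative_eq_intros)
    qed
    then obtain z where z: "ln b < z" "ln (a - \<kappa>) - ln (b - \<kappa>) = (ln a - ln b) * (exp z / (exp z - \<kappa>))"
      using less b by auto
    have bz: "b \<le> exp z" using z(1) b by (metis exp_le_cancel_iff exp_ln less_imp_le)
    have "(ln a - ln b) * (exp z / (exp z - \<kappa>)) \<le> (ln a - ln b) * (1 / (1 - \<eta>))"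
      using gt(2)[OF bz] ab by (intro mult_left_mono) auto
    moreover have "(ln a - ln b) * (exp z / (exp z - \<kappa>)) \<ge> 0"
      using gt(1)[OF bz] ab by simp
    moreover have "\<bar>ln a - ln b\<bar> = ln a - ln b" using ab by simp
    ultimately show ?thesis unfolding z(2) by (simp only: abs_of_nonneg) simp
  qed
  consider "a < b" | "a = b" | "b < a" by linarith
  then show ?thesis
  proof cases
    case 1
    then show ?thesis using *[OF 1 \<kappa>(2) pos(1)] by (simp add: abs_minus_commute)
  next
    case 3
    then show ?thesis by (rule *[OF _ \<kappa>(3) pos(2)])
  qed simp
qed

context compact_riemannian begin

definition with_density :: "('a \<Rightarrow> real) \<Rightarrow> 'a measure" where
  "with_density \<alpha> = density m (\<lambda>x. ennreal (\<alpha> x))"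

lemma sets_with_density: "sets (with_density \<alpha>) = sets borel"
  using sets_m by (simp add: with_density_def)

lemma space_with_density: "space (with_density \<alpha>) = UNIV"
  using sets_eq_imp_space_eq[OF sets_with_density] by simp

lemma finite_measure_with_density:
  assumes "\<alpha> \<in> log_lipschitz A G K"
  shows "finite_measure (with_density \<alpha>)"
proof
  obtain b where b: "\<And>x. \<alpha> x \<le> b"
    using continuous_attains_sup[OF compact_M _ log_lipschitz_continuous_on[OF assms]] by auto
  have "emeasure (with_density \<alpha>) UNIV = (\<integral>\<^sup>+x. ennreal (\<alpha> x) \<partial>m)"
    unfolding with_density_def using emeasure_density_m[OF assms, of UNIV] by simp
  also have "\<dots> \<le> (\<integral>\<^sup>+x. ennreal b \<partial>m)" using b by (intro nn_integral_mono ennreal_leI)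
  also have "\<dots> = ennreal b" using sets_eq_imp_space_eq[OF sets_m] volume_1 by simp
  finally show "emeasure (with_density \<alpha>) (space (with_density \<alpha>)) \<noteq> \<infinity>"
    by (auto simp: space_with_density top_unique)
qed

lemma subtract_constant:
  assumes \<alpha>: "\<alpha> \<in> log_lipschitz A G K" and K: "K \<ge> 0" and \<eta>: "0 \<le> \<eta>" "\<eta> < 1"
    and \<kappa>: "0 \<le> \<kappa>" "\<And>x. \<kappa> \<le> \<eta> * \<alpha> x"
  shows "(\<lambda>x. \<alpha> x - \<kappa>) \<in> log_lipschitz A G (K / (1 - \<eta>))"
    and "B \<in> sets borel \<Longrightarrow>
      measure (with_density \<alpha>) B = measure (with_density (\<lambda>x. \<alpha> x - \<kappa>)) B + \<kappa> * measure m B"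
proof -
  have pos: "\<alpha> x - \<kappa> > 0" for x
  proof -
    have "\<eta> * \<alpha> x < \<alpha> x" using \<eta> log_lipschitz_pos[OF \<alpha>] by simp
    then show ?thesis using \<kappa>(2)[of x] by linarith
  qed
  show cls: "(\<lambda>x. \<alpha> x - \<kappa>) \<in> log_lipschitz A G (K / (1 - \<eta>))"
    unfolding log_lipschitz_def
  proof (intro CollectI conjI allI ballI impI pos)
    fix c x and e :: real assume c: "c \<in> A" "x \<in> chart_dom c" and e: "e > 0"
    have "(1 - \<eta>) * e > 0" using \<eta> e by simp
    from log_lipschitzD[OF \<alpha> c this]
    show "\<forall>\<^sub>F y in nhds x. \<bar>ln (\<alpha> y - \<kappa>) - ln (\<alpha> x - \<kappa>)\<bar>
        \<le> (K / (1 - \<eta>) + e) * tangent_norm G c (chart_map c x) (chart_map c y - chart_map c x)"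
    proof eventually_elim
      case (elim y)
      let ?N = "tangent_norm G c (chart_map c x) (chart_map c y - chart_map c x)"
      have "\<bar>ln (\<alpha> y - \<kappa>) - ln (\<alpha> x - \<kappa>)\<bar> \<le> \<bar>ln (\<alpha> y) - ln (\<alpha> x)\<bar> / (1 - \<eta>)"
        by (rule ln_minus_const_le[OF \<eta> \<kappa>(1) \<kappa>(2) \<kappa>(2)]) (rule log_lipschitz_pos[OF \<alpha>])+
      also have "\<dots> \<le> (K + (1 - \<eta>) * e) * ?N / (1 - \<eta>)"
        using elim \<eta> by (intro divide_right_mono) auto
      also have "\<dots> = (K / (1 - \<eta>) + e) * ?N" using \<eta> by (simp add: field_simps)
      finally show ?case .
    qed
  qed
  assume B: "B \<in> sets borel"
  have "emeasure (with_density \<alpha>) B = (\<integral>\<^sup>+x. ennreal (\<alpha> x - \<kappa>) * indicator B x + ennreal \<kappa> * indicator B x \<partial>m)"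
    unfolding with_density_def emeasure_density_m[OF \<alpha> B]
    using pos \<kappa>(1) by (intro nn_integral_cong) (auto simp: indicator_def ennreal_plus[symmetric] less_imp_le simp del: ennreal_plus)
  also have "\<dots> = (\<integral>\<^sup>+x. ennreal (\<alpha> x - \<kappa>) * indicator B x \<partial>m) + (\<integral>\<^sup>+x. ennreal \<kappa> * indicator B x \<partial>m)"
    using borel_measurable_log_lipschitz(2)[OF cls] B sets_m by (intro nn_integral_add) auto
  also have "\<dots> = emeasure (with_density (\<lambda>x. \<alpha> x - \<kappa>)) B + ennreal \<kappa> * emeasure m B"
    unfolding with_density_def emeasure_density_m[OF cls B] using B sets_m by (simp add: nn_integral_cmult_indicator)
  finally have split: "emeasure (with_density \<alpha>) B = emeasure (with_density (\<lambda>x. \<alpha> x - \<kappa>)) B + ennreal \<kappa> * emeasure m B" .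
  interpret M: prob_space m by (rule prob_space_m)
  interpret M1: finite_measure "with_density \<alpha>" by (rule finite_measure_with_density[OF \<alpha>])
  interpret M2: finite_measure "with_density (\<lambda>x. \<alpha> x - \<kappa>)" by (rule finite_measure_with_density[OF cls])
  have "ennreal (measure (with_density \<alpha>) B)
      = ennreal (measure (with_density (\<lambda>x. \<alpha> x - \<kappa>)) B + \<kappa> * measure m B)"
    using split \<kappa>(1) by (simp add: M.emeasure_eq_measure M1.emeasure_eq_measure M2.emeasure_eq_measure
        ennreal_mult'[symmetric] ennreal_plus[symmetric] del: ennreal_plus)
  then show "measure (with_density \<alpha>) B = measure (with_density (\<lambda>x. \<alpha> x - \<kappa>)) B + \<kappa> * measure m B"
    using \<kappa>(1) by (subst (asm) ennreal_inj) auto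
qed

lemma mass_le_sup:
  assumes \<alpha>: "\<alpha> \<in> log_lipschitz A G K" and b: "\<And>x. \<alpha> x \<le> b"
  shows "measure (with_density \<alpha>) UNIV \<le> b"
proof -
  have b0: "b \<ge> 0" using b log_lipschitz_pos[OF \<alpha>] by (meson less_imp_le order_trans)
  have "emeasure (with_density \<alpha>) UNIV = (\<integral>\<^sup>+x. ennreal (\<alpha> x) \<partial>m)"
    unfolding with_density_def using emeasure_density_m[OF \<alpha>, of UNIV] by simp
  also have "\<dots> \<le> (\<integral>\<^sup>+x. ennreal b \<partial>m)" using b by (intro nn_integral_mono ennreal_leI)
  also have "\<dots> = ennreal b" using sets_eq_imp_space_eq[OF sets_m] volume_1 by simp
  finally show ?thesis
    using b0 finite_measure.emeasure_eq_measure[OF finite_measure_with_density[OF \<alpha>]] by simp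
qed

text \<open>
  A coupling argument. By Harnack's inequality, a density of mass \<open>s\<close> in the class with constant \<open>K\<close>
  is at least \<open>s / H\<close> everywhere, so the constant \<open>\<eta> * s / H\<close> can be subtracted from both densities
  without affecting their difference. This turns \<open>K\<close> into \<open>K / (1 - \<eta>)\<close>, and one application of the
  transfer operator brings the constant back below \<open>K\<close>. The difference of the two measures is thus
  always a difference of two measures whose common mass shrinks by the factor \<open>\<theta>\<close> in each step.
\<close>

lemma memory_loss:
  assumes f: "\<And>n. f n \<in> expanding_maps A G l \<Gamma>" and l: "1 < l" and \<Gamma>: "\<Gamma> > 0"
    and \<phi>: "\<phi> \<in> log_lipschitz A G K1" "measure (with_density \<phi>) UNIV = 1"
    and \<psi>: "\<psi> \<in> log_lipschitz A G K2" "measure (with_density \<psi>) UNIV = 1"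
  shows "\<exists>\<theta>::real. 0 \<le> \<theta> \<and> \<theta> < 1 \<and> (\<forall>n. \<forall>B\<in>sets borel.
    \<bar>measure (with_density \<phi>) (seq_iter f 0 n -` B)
       - measure (with_density \<psi>) (seq_iter f 0 n -` B)\<bar> \<le> \<theta> ^ n)"
proof -
  define C where "C = CARD('n) * \<Gamma> / l"
  \<comment> \<open>half of \<open>1 - 1 / l\<close>, the proportion at which \<open>l * (1 - \<eta>)\<close> would drop to \<open>1\<close>\<close>
  define \<eta> where "\<eta> = (1 - 1 / l) / 2"
  have \<eta>: "0 < \<eta>" "\<eta> < 1" using l by (auto simp: \<eta>_def field_simps)
  have l\<eta>: "l * (1 - \<eta>) = (l + 1) / 2" using l by (simp add: \<eta>_def field_simps)
  \<comment> \<open>the last term is where \<open>K\<close> absorbs the additive distortion, see \<open>contract\<close>\<close>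
  define K where "K = max (max K1 K2) (max 0 (C * (l + 1) / (l * (l - 1))))"
  have K: "K \<ge> K1" "K \<ge> K2" "K \<ge> 0" "K \<ge> C * (l + 1) / (l * (l - 1))" by (auto simp: K_def)
  have contract: "(K / (1 - \<eta>) + C) / l \<le> K"
  proof -
    have "(K / (1 - \<eta>) + C) / l = K / (l * (1 - \<eta>)) + C / l"
      using l \<eta> by (simp add: field_simps)
    also have "\<dots> = 2 * K / (l + 1) + C / l" unfolding l\<eta> by simp
    also have "C / l \<le> K * (l - 1) / (l + 1)"
    proof -
      have "C * (l + 1) \<le> K * (l * (l - 1))" using K(4) l by (simp add: pos_divide_le_eq)
      then show ?thesis using l by (simp add: field_simps)
    qed
    also have "2 * K / (l + 1) + K * (l - 1) / (l + 1) = K * (l + 1) / (l + 1)"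
      unfolding add_divide_distrib[symmetric] by (simp add: algebra_simps)
    also have "\<dots> = K" using l by simp
    finally show ?thesis by simp
  qed
  obtain H where H: "H > 0" "\<And>\<alpha> x y. \<alpha> \<in> log_lipschitz A G K \<Longrightarrow> \<alpha> x \<le> H * \<alpha> y"
    using harnack[OF K(3)] by blast
  have \<phi>K: "\<phi> \<in> log_lipschitz A G K" and \<psi>K: "\<psi> \<in> log_lipschitz A G K"
    using log_lipschitz_mono \<phi>(1) \<psi>(1) K by blast+
  have H1: "H \<ge> 1"
    using H(2)[OF \<phi>K, of undefined undefined] log_lipschitz_pos[OF \<phi>K, of undefined] by simp
  define \<theta> where "\<theta> = 1 - \<eta> / H"
  have \<theta>: "0 \<le> \<theta>" "\<theta> < 1" using H1 \<eta> by (auto simp: \<theta>_def field_simps)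
  have step: "\<exists>\<alpha>'\<in>log_lipschitz A G K. measure (with_density \<alpha>') UNIV = \<theta> * s \<and>
      (\<forall>B\<in>sets borel. measure (with_density \<alpha>) (f n -` B) = measure (with_density \<alpha>') B + \<eta> * s / H * measure m (f n -` B))"
    if \<alpha>: "\<alpha> \<in> log_lipschitz A G K" and s: "measure (with_density \<alpha>) UNIV = s" for \<alpha> s n
  proof -
    interpret E: expanding_map A G m l \<Gamma> "f n"
      by unfold_locales (use l \<Gamma> f in auto)
    have s0: "s \<ge> 0" using s by auto
    define \<kappa> where "\<kappa> = \<eta> * s / H"
    have "\<kappa> \<le> \<eta> * \<alpha> x" for x
    proof -
      have "s \<le> H * \<alpha> x" using mass_le_sup[OF \<alpha>, of "H * \<alpha> x"] H(2)[OF \<alpha>] s by blast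
      then have "s / H \<le> \<alpha> x" using H(1) by (simp add: field_simps)
      then have "\<eta> * (s / H) \<le> \<eta> * \<alpha> x" using \<eta> by (intro mult_left_mono) auto
      then show ?thesis by (simp add: \<kappa>_def)
    qed
    moreover have "\<kappa> \<ge> 0" using s0 \<eta> H(1) by (simp add: \<kappa>_def)
    ultimately have sub: "(\<lambda>x. \<alpha> x - \<kappa>) \<in> log_lipschitz A G (K / (1 - \<eta>))"
      and split: "\<And>B. B \<in> sets borel \<Longrightarrow>
        measure (with_density \<alpha>) B = measure (with_density (\<lambda>x. \<alpha> x - \<kappa>)) B + \<kappa> * measure m B"
      using subtract_constant[OF \<alpha> K(3) less_imp_le[OF \<eta>(1)] \<eta>(2)] by blast+
    have "K / (1 - \<eta>) \<ge> 0" using K \<eta> by simp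
    from E.transfer[OF sub this] obtain \<alpha>' where \<alpha>': "\<alpha>' \<in> log_lipschitz A G ((K / (1 - \<eta>) + C) / l)"
      and eq: "\<And>B. B \<in> sets borel \<Longrightarrow> (\<integral>\<^sup>+y. ennreal (\<alpha>' y) * indicator B y \<partial>m)
        = (\<integral>\<^sup>+y. ennreal (\<alpha> y - \<kappa>) * indicator (f n -` B) y \<partial>m)"
      unfolding C_def by blast
    have fn: "f n -` B \<in> sets borel" if "B \<in> sets borel" for B
      using E.continuous_f that by (metis borel_measurable_continuous_onI measurable_sets_borel)
    have rel: "measure (with_density \<alpha>) (f n -` B) = measure (with_density \<alpha>') B + \<kappa> * measure m (f n -` B)"
      if B: "B \<in> sets borel" for B
    proof -
      have "emeasure (with_density \<alpha>') B = emeasure (with_density (\<lambda>x. \<alpha> x - \<kappa>)) (f n -` B)"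
        unfolding with_density_def emeasure_density_m[OF \<alpha>' B] emeasure_density_m[OF sub fn[OF B]] by (rule eq[OF B])
      then show ?thesis using split[OF fn[OF B]] by (simp add: measure_def)
    qed
    have "measure m UNIV = 1" by (simp add: measure_def volume_1)
    then have "measure (with_density \<alpha>') UNIV = \<theta> * s"
      using rel[of UNIV] s H(1) by (simp add: \<kappa>_def \<theta>_def field_simps)
    then show ?thesis
      using log_lipschitz_mono[OF \<alpha>' contract] rel unfolding \<kappa>_def by blast
  qed
  have dec: "\<exists>\<alpha> \<beta>. \<alpha> \<in> log_lipschitz A G K \<and> \<beta> \<in> log_lipschitz A G K \<and>
      measure (with_density \<alpha>) UNIV = \<theta> ^ n \<and> measure (with_density \<beta>) UNIV = \<theta> ^ n \<and>
      (\<forall>B\<in>sets borel. measure (with_density \<phi>) (seq_iter f 0 n -` B) - measure (with_density \<psi>) (seq_iter f 0 n -` B)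
        = measure (with_density \<alpha>) B - measure (with_density \<beta>) B)" for n
  proof (induction n)
    case 0
    show ?case using \<phi>K \<psi>K \<phi>(2) \<psi>(2) by (intro exI[of _ \<phi>] exI[of _ \<psi>]) simp
  next
    case (Suc n)
    then obtain \<alpha> \<beta> where ab: "\<alpha> \<in> log_lipschitz A G K" "\<beta> \<in> log_lipschitz A G K"
      "measure (with_density \<alpha>) UNIV = \<theta> ^ n" "measure (with_density \<beta>) UNIV = \<theta> ^ n"
      and eq: "\<And>B. B \<in> sets borel \<Longrightarrow> measure (with_density \<phi>) (seq_iter f 0 n -` B) - measure (with_density \<psi>) (seq_iter f 0 n -` B)
        = measure (with_density \<alpha>) B - measure (with_density \<beta>) B" by blast
    obtain \<alpha>' where a': "\<alpha>' \<in> log_lipschitz A G K" "measure (with_density \<alpha>') UNIV = \<theta> * \<theta> ^ n"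
      "\<And>B. B \<in> sets borel \<Longrightarrow> measure (with_density \<alpha>) (f n -` B) = measure (with_density \<alpha>') B + \<eta> * \<theta> ^ n / H * measure m (f n -` B)"
      using step[OF ab(1,3)] by blast
    obtain \<beta>' where b': "\<beta>' \<in> log_lipschitz A G K" "measure (with_density \<beta>') UNIV = \<theta> * \<theta> ^ n"
      "\<And>B. B \<in> sets borel \<Longrightarrow> measure (with_density \<beta>) (f n -` B) = measure (with_density \<beta>') B + \<eta> * \<theta> ^ n / H * measure m (f n -` B)"
      using step[OF ab(2,4)] by blast
    have "measure (with_density \<phi>) (seq_iter f 0 (Suc n) -` B) - measure (with_density \<psi>) (seq_iter f 0 (Suc n) -` B)
        = measure (with_density \<alpha>') B - measure (with_density \<beta>') B" if B: "B \<in> sets borel" for B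
    proof -
      have fB: "f n -` B \<in> sets borel"
        using f[of n] B by (auto simp: expanding_maps_def C2_map_def intro: measurable_sets_borel borel_measurable_continuous_onI)
      have "seq_iter f 0 (Suc n) -` B = seq_iter f 0 n -` (f n -` B)" by (simp add: vimage_comp)
      then show ?thesis using eq[OF fB] a'(3)[OF B] b'(3)[OF B] by simp
    qed
    then show ?case
      using a'(1,2) b'(1,2) unfolding power_Suc by (intro exI[of _ \<alpha>'] exI[of _ \<beta>'] conjI ballI)
  qed
  show ?thesis
  proof (intro exI[of _ \<theta>] conjI \<theta> allI ballI)
    fix n and B :: "'a set" assume B: "B \<in> sets borel"
    obtain \<alpha> \<beta> where ab: "\<alpha> \<in> log_lipschitz A G K" "\<beta> \<in> log_lipschitz A G K"
      "measure (with_density \<alpha>) UNIV = \<theta> ^ n" "measure (with_density \<beta>) UNIV = \<theta> ^ n"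
      and eq: "measure (with_density \<phi>) (seq_iter f 0 n -` B) - measure (with_density \<psi>) (seq_iter f 0 n -` B)
        = measure (with_density \<alpha>) B - measure (with_density \<beta>) B" using dec[of n] B by blast
    have "measure (with_density \<gamma>) B \<le> \<theta> ^ n"
      if "\<gamma> \<in> log_lipschitz A G K" "measure (with_density \<gamma>) UNIV = \<theta> ^ n" for \<gamma>
      using finite_measure.bounded_measure[OF finite_measure_with_density[OF that(1)], of B] that(2)
      by (simp add: space_with_density)
    from this[OF ab(1,3)] this[OF ab(2,4)]
    show "\<bar>measure (with_density \<phi>) (seq_iter f 0 n -` B) - measure (with_density \<psi>) (seq_iter f 0 n -` B)\<bar> \<le> \<theta> ^ n"
      unfolding eq using measure_nonneg[of "with_density \<alpha>" B] measure_nonneg[of "with_density \<beta>" B] by linarith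
  qed
qed

lemma measure_with_density_le:
  assumes \<phi>: "\<phi> \<in> log_lipschitz A G K1" and \<psi>: "\<psi> \<in> log_lipschitz A G K2"
  obtains C where "C > 0" "\<And>B. B \<in> sets borel \<Longrightarrow> measure (with_density \<phi>) B \<le> C * measure (with_density \<psi>) B"
proof -
  obtain a where a: "\<And>x. \<phi> x \<le> \<phi> a"
    using continuous_attains_sup[OF compact_M _ log_lipschitz_continuous_on[OF \<phi>]] by auto
  obtain b where b: "\<And>x. \<psi> b \<le> \<psi> x"
    using continuous_attains_inf[OF compact_M _ log_lipschitz_continuous_on[OF \<psi>]] by auto
  define C where "C = \<phi> a / \<psi> b"
  have C: "C > 0" using log_lipschitz_pos[OF \<phi>] log_lipschitz_pos[OF \<psi>] by (simp add: C_def)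
  have le: "\<phi> x \<le> C * \<psi> x" for x
  proof -
    have "\<phi> x \<le> C * \<psi> b" using a[of x] log_lipschitz_pos[OF \<psi>, of b] by (simp add: C_def)
    also have "\<dots> \<le> C * \<psi> x" using b C by (intro mult_left_mono) auto
    finally show ?thesis .
  qed
  have "measure (with_density \<phi>) B \<le> C * measure (with_density \<psi>) B" if B: "B \<in> sets borel" for B
  proof -
    have "emeasure (with_density \<phi>) B \<le> (\<integral>\<^sup>+x. ennreal C * (ennreal (\<psi> x) * indicator B x) \<partial>m)"
      unfolding with_density_def emeasure_density_m[OF \<phi> B]
      using le C by (intro nn_integral_mono) (auto simp: indicator_def ennreal_mult'[symmetric] intro!: ennreal_leI)
    also have "\<dots> = ennreal C * emeasure (with_density \<psi>) B"
      unfolding with_density_def emeasure_density_m[OF \<psi> B]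
      using borel_measurable_log_lipschitz(2)[OF \<psi>] B sets_m by (intro nn_integral_cmult) auto
    finally show ?thesis
      using C finite_measure.emeasure_eq_measure[OF finite_measure_with_density[OF \<phi>]]
        finite_measure.emeasure_eq_measure[OF finite_measure_with_density[OF \<psi>]]
      by (simp add: ennreal_mult'[symmetric])
  qed
  with C show thesis by (rule that)
qed

text \<open>
  The compact sets that serve \<open>\<epsilon> / C\<close> for \<open>\<mu>\<close> serve \<open>\<epsilon>\<close> for \<open>\<nu>\<close>.
\<close>

lemma misiurewicz_class_mono:
  assumes C: "C > 0" and le: "\<And>n B. measure (\<nu> n) B \<le> C * measure (\<mu> n) B"
  shows "misiurewicz_class A G \<mu> \<subseteq> misiurewicz_class A G \<nu>"
proof
  fix P assume P: "P \<in> misiurewicz_class A G \<mu>"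
  define separated where "separated \<rho> \<epsilon> \<delta> K \<longleftrightarrow> (\<forall>n.
        (\<forall>B \<in> P n. compact (K n B) \<and> K n B \<subseteq> B \<and> measure (\<rho> n) (B - K n B) \<le> \<epsilon>) \<and>
        (\<forall>B \<in> P n. \<forall>B' \<in> P n. B \<noteq> B' \<longrightarrow>
           (\<forall>x \<in> K n B. \<forall>y \<in> K n B'. riem_dist A G x y \<ge> \<delta>)))"
    for \<rho> :: "nat \<Rightarrow> 'a measure" and \<epsilon> \<delta> :: real and K :: "nat \<Rightarrow> 'a set \<Rightarrow> 'a set"
  have mem: "P \<in> misiurewicz_class A G \<rho> \<longleftrightarrow>
     (\<forall>n. finite_borel_partition (P n)) \<and> bdd_above (range (\<lambda>n. card (P n))) \<and>
     (\<forall>\<epsilon>>0. \<exists>\<delta>>0. \<exists>K. separated \<rho> \<epsilon> \<delta> K)" for \<rho>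
    by (simp only: misiurewicz_class_def mem_Collect_eq separated_def)
  have "\<exists>\<delta>>0. \<exists>K. separated \<nu> \<epsilon> \<delta> K" if \<epsilon>: "\<epsilon> > 0" for \<epsilon>
  proof -
    have "\<epsilon> / C > 0" using \<epsilon> C by simp
    then obtain \<delta> K where \<delta>: "\<delta> > 0" and K: "separated \<mu> (\<epsilon> / C) \<delta> K"
      using P unfolding mem by blast
    have "measure (\<nu> n) X \<le> \<epsilon>" if "measure (\<mu> n) X \<le> \<epsilon> / C" for n X
    proof -
      have "C * measure (\<mu> n) X \<le> C * (\<epsilon> / C)" using that C by (intro mult_left_mono) auto
      then show ?thesis using le[of n X] C by simp
    qed
    then have "separated \<nu> \<epsilon> \<delta> K" using K unfolding separated_def by simp
    with \<delta> show ?thesis by blast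
  qed
  then show "P \<in> misiurewicz_class A G \<nu>" using P unfolding mem by simp
qed

end

section \<open>Equality of the entropies\<close>

theorem theorem4p6:
  fixes A :: "('a::t2_space, 'n::finite) chart set"
    and G :: "('a, 'n) metric_coeffs"
    and m :: "'a measure"
    and l \<Gamma> :: real
    and f :: "nat \<Rightarrow> 'a \<Rightarrow> 'a"
    and \<phi> \<psi> :: "'a \<Rightarrow> real"
    and \<mu> \<nu> :: "nat \<Rightarrow> 'a measure"
  assumes "riemannian_manifold A G"
    and "compact (UNIV :: 'a set)"
    and "connected (UNIV :: 'a set)"
    and "riemannian_volume A G m"
    and "emeasure m UNIV = 1"
    and "1 < l" and "l < \<Gamma>"
    and "\<And>n. f n \<in> expanding_maps A G l \<Gamma>"
    and "\<phi> \<in> lipschitz_densities A G m"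
    and "\<psi> \<in> lipschitz_densities A G m"
    and "\<And>n. \<mu> n = distr (density m (\<lambda>x. ennreal (\<phi> x))) borel (seq_iter f 0 n)"
    and "\<And>n. \<nu> n = distr (density m (\<lambda>x. ennreal (\<psi> x))) borel (seq_iter f 0 n)"
  shows "(\<exists>c>0. \<forall>P :: nat \<Rightarrow> 'a set set.
            (\<forall>n. finite_borel_partition (P n)) \<and>
            bdd_above (range (\<lambda>n. card (P n))) \<and>
            (\<forall>n. \<forall>B \<in> P n. measure m B < c) \<longrightarrow>
            partition_entropy f P \<mu> = partition_entropy f P \<nu>) \<and>
         misiurewicz_entropy A G f \<mu> = misiurewicz_entropy A G f \<nu>"
proof -
  interpret compact_riemannian A G m
    by unfold_locales (fact assms)+
  have \<mu>: "\<mu> n = distr (with_density \<phi>) borel (seq_iter f 0 n)"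
    and \<nu>: "\<nu> n = distr (with_density \<psi>) borel (seq_iter f 0 n)" for n
    using assms(11,12) by (simp_all add: with_density_def)
  obtain K1 where \<phi>: "\<phi> \<in> log_lipschitz A G K1" using lipschitz_density_in_log_lipschitz[OF assms(9)] .
  obtain K2 where \<psi>: "\<psi> \<in> log_lipschitz A G K2" using lipschitz_density_in_log_lipschitz[OF assms(10)] .
  have f_meas: "f n \<in> borel \<rightarrow>\<^sub>M borel" for n
    using assms(8)[of n] by (auto simp: expanding_maps_def C2_map_def intro: borel_measurable_continuous_onI)
  have prob: "prob_space (with_density \<alpha>)"
    if \<alpha>: "\<alpha> \<in> lipschitz_densities A G m" "\<alpha> \<in> log_lipschitz A G K" for \<alpha> K
  proof
    have int: "(\<integral>x. \<alpha> x \<partial>m) = 1" and pos: "\<And>x. \<alpha> x \<ge> 0"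
      using \<alpha>(1) by (auto simp: lipschitz_densities_def less_imp_le)
    have "integrable m \<alpha>" using int not_integrable_integral_eq by fastforce
    then have "(\<integral>\<^sup>+x. ennreal (\<alpha> x) \<partial>m) = ennreal 1"
      using nn_integral_eq_integral[of m \<alpha>] pos int by simp
    then show "emeasure (with_density \<alpha>) (space (with_density \<alpha>)) = 1"
      using emeasure_density_m[OF \<alpha>(2), of UNIV] unfolding space_with_density by (simp add: with_density_def)
  qed
  note prob\<phi> = prob[OF assms(9) \<phi>] and prob\<psi> = prob[OF assms(10) \<psi>]
  have iter_meas: "seq_iter f 0 n \<in> with_density \<alpha> \<rightarrow>\<^sub>M borel" for n \<alpha>
    using measurable_seq_iter[of f, OF f_meas] measurable_cong_sets[OF sets_with_density refl] by blast
  have meas: "measure (distr (with_density \<alpha>) borel (seq_iter f 0 n)) B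
      = (if B \<in> sets borel then measure (with_density \<alpha>) (seq_iter f 0 n -` B) else 0)" for n B \<alpha>
    using measure_distr[OF iter_meas, of B] by (auto simp: space_with_density measure_notin_sets)
  have mass: "measure (with_density \<phi>) UNIV = 1" "measure (with_density \<psi>) UNIV = 1"
    using prob_space.prob_space[OF prob\<phi>] prob_space.prob_space[OF prob\<psi>] by (simp_all add: space_with_density)
  have \<Gamma>: "\<Gamma> > 0" using assms(6,7) by simp
  obtain \<theta> where \<theta>: "0 \<le> \<theta>" "\<theta> < 1"
    and decay: "\<And>n B. B \<in> sets borel \<Longrightarrow> \<bar>measure (with_density \<phi>) (seq_iter f 0 n -` B)
       - measure (with_density \<psi>) (seq_iter f 0 n -` B)\<bar> \<le> \<theta> ^ n"
    using memory_loss[of f, OF assms(8,6) \<Gamma> \<phi> mass(1) \<psi> mass(2)] by blast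
  have entropy: "partition_entropy f P \<mu> = partition_entropy f P \<nu>"
    if P: "\<And>n. finite_borel_partition (P n)" "bdd_above (range (\<lambda>n. card (P n)))" for P
  proof (rule partition_entropy_eq_if_asymptotically_equal[OF f_meas P])
    show "prob_space (\<mu> 0)" "prob_space (\<nu> 0)"
      unfolding \<mu> \<nu> by (intro prob_space.prob_space_distr prob\<phi> prob\<psi> iter_meas)+
    show "sets (\<mu> 0) = sets borel" "sets (\<nu> 0) = sets borel" by (simp_all add: \<mu> \<nu>)
    fix \<epsilon> :: real assume "\<epsilon> > 0"
    then obtain k where k: "\<theta> ^ k < \<epsilon>" using real_arch_pow_inv[OF _ \<theta>(2)] by blast
    have "\<bar>measure (\<mu> 0) (seq_iter f 0 k -` B) - measure (\<nu> 0) (seq_iter f 0 k -` B)\<bar> \<le> \<epsilon>"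
      if B: "B \<in> sets borel" for B
    proof -
      have "seq_iter f 0 k -` B \<in> sets borel"
        by (rule measurable_sets_borel[OF measurable_seq_iter[of f, OF f_meas] B])
      then show ?thesis using decay[OF B, of k] k unfolding \<mu> \<nu> meas by simp
    qed
    then show "\<exists>k. \<forall>B\<in>sets borel.
        \<bar>measure (\<mu> 0) (seq_iter f 0 k -` B) - measure (\<nu> 0) (seq_iter f 0 k -` B)\<bar> \<le> \<epsilon>" by blast
  qed
  have cls: "misiurewicz_class A G \<mu> = misiurewicz_class A G \<nu>"
  proof -
    have mono: "\<exists>C>0. \<forall>n B. measure (distr (with_density \<alpha>) borel (seq_iter f 0 n)) B
        \<le> C * measure (distr (with_density \<beta>) borel (seq_iter f 0 n)) B"
      if "\<alpha> \<in> log_lipschitz A G K" "\<beta> \<in> log_lipschitz A G K'" for \<alpha> \<beta> K K'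
    proof -
      obtain C where C: "C > 0" "\<And>B. B \<in> sets borel \<Longrightarrow> measure (with_density \<alpha>) B \<le> C * measure (with_density \<beta>) B"
        using measure_with_density_le[OF \<open>\<alpha> \<in> log_lipschitz A G K\<close> \<open>\<beta> \<in> log_lipschitz A G K'\<close>] by blast
      have "seq_iter f 0 n -` B \<in> sets borel" if "B \<in> sets borel" for n B
        by (rule measurable_sets_borel[OF measurable_seq_iter[of f, OF f_meas] that])
      then show ?thesis using C unfolding meas by (intro exI[of _ C]) auto
    qed
    from mono[OF \<phi> \<psi>] mono[OF \<psi> \<phi>] show ?thesis
      using misiurewicz_class_mono[of _ \<nu> \<mu>] misiurewicz_class_mono[of _ \<mu> \<nu>]
      unfolding \<mu>[symmetric] \<nu>[symmetric] by blast
  qed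
  have "misiurewicz_entropy A G f \<mu> = misiurewicz_entropy A G f \<nu>"
    unfolding misiurewicz_entropy_def cls
    by (rule SUP_cong[OF refl], rule entropy) (auto simp: misiurewicz_class_def)
  moreover have "\<exists>c>0::real. \<forall>P :: nat \<Rightarrow> 'a set set.
            (\<forall>n. finite_borel_partition (P n)) \<and> bdd_above (range (\<lambda>n. card (P n))) \<and>
            (\<forall>n. \<forall>B \<in> P n. measure m B < c) \<longrightarrow> partition_entropy f P \<mu> = partition_entropy f P \<nu>"
    by (rule exI[of _ 1]) (use entropy in auto)
  ultimately show ?thesis by blast
qed

end
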